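(* Let $p$ be an odd prime integer, let $\mathcal X$ be a compact Riemann surface of genus $g\ge2$, and let $\varphi:\mathcal X\to\mathbb P^1$ be a cyclic $p$-gonal cover. Let $\psi:\mathcal Y\to\mathcal X$ be a $q$-cyclic étale cover, where $q\ne p$ is a prime integer such that $\gcd(p,q-1)=1$. Then: (1) the composition $\varphi\circ\psi:\mathcal Y\to\mathcal X\to\mathbb P^1$ is non-Galois; (2) if $\mathcal Z\to\mathbb P^1$ denotes the Galois closure of the composition $\varphi\circ\psi$, then its Galois group is $$G=N\rtimes P\cong(\mathbb Z_q)^s\rtimes\mathbb Z_p,$$ for some $s\in\{1,2,\dots,p-1\}$ such that $q^s\equiv1\bmod p$.
   Context: A cyclic $p$-gonal cover $\varphi:\mathcal X\to\mathbb P^1$ is a Galois (branched) cover of degree $p$ with cyclic deck group $\langle\tau\rangle\cong\mathbb Z_p$, $\tau$ a conformal automorphism of order $p$ of $\mathcal X$ with $\mathcal X/\langle\tau\rangle\cong\mathbb P^1$. A $q$-cyclic étale cover $\psi:\mathcal Y\to\mathcal X$ is an unramified Galois cover by a (connected) compact Riemann surface $\mathcal Y$ with deck group $\cong\mathbb Z_q$. The Galois closure of a cover of $\mathbb P^1$ is the minimal Galois cover of $\mathbb P^1$ factoring through it; its Galois group is its deck group over $\mathbb P^1$. *)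

theory Defs
  imports
    "HOL-Complex_Analysis.Complex_Analysis"
    "HOL-Homology.Homology"
    "HOL-Algebra.Bij"
    "HOL-Algebra.Product_Groups"
    "HOL-Number_Theory.Cong"
begin

section \<open>Riemann surfaces\<close>

record 'a surface =
  surf_top :: "'a topology"
  charts :: "('a set \<times> ('a \<Rightarrow> complex)) set"

abbreviation points :: "'a surface \<Rightarrow> 'a set" where
  "points S \<equiv> topspace (surf_top S)"

text \<open>The atlas is not required to be maximal. Second countability is not demanded;
  it is automatic in the compact case.\<close>

definition riemann_surface :: "'a surface \<Rightarrow> bool" where
  "riemann_surface S \<longleftrightarrow>
     points S \<noteq> {} \<and> connected_space (surf_top S) \<and> Hausdorff_space (surf_top S) \<and>
     (\<Union>(U, u)\<in>charts S. U) = points S \<and>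
     (\<forall>(U, u)\<in>charts S. openin (surf_top S) U \<and> open (u ` U) \<and>
        homeomorphic_map (subtopology (surf_top S) U) (top_of_set (u ` U)) u) \<and>
     (\<forall>(U, u)\<in>charts S. \<forall>(V, v)\<in>charts S. (v \<circ> inv_into U u) holomorphic_on u ` (U \<inter> V))"

definition compact_riemann_surface :: "'a surface \<Rightarrow> bool" where
  "compact_riemann_surface S \<longleftrightarrow> riemann_surface S \<and> compact_space (surf_top S)"

text \<open>Topological genus: the first integral homology group is free abelian of rank \<open>2 g\<close>.\<close>

definition has_genus :: "'a surface \<Rightarrow> nat \<Rightarrow> bool" where
  "has_genus S g \<longleftrightarrow>
     homology_group 1 (surf_top S) \<cong> product_group {..<2 * g} (\<lambda>_. integer_group)"

text \<open>Functions between surfaces are total on the underlying types; only their values on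
  \<^term>\<open>points A\<close> are meaningful.\<close>

definition holomorphic_map :: "'a surface \<Rightarrow> 'b surface \<Rightarrow> ('a \<Rightarrow> 'b) \<Rightarrow> bool" where
  "holomorphic_map A B f \<longleftrightarrow>
     continuous_map (surf_top A) (surf_top B) f \<and>
     (\<forall>(U, u)\<in>charts A. \<forall>(V, v)\<in>charts B.
        (v \<circ> f \<circ> inv_into U u) holomorphic_on u ` (U \<inter> f -` V))"

definition biholomorphic_map :: "'a surface \<Rightarrow> 'b surface \<Rightarrow> ('a \<Rightarrow> 'b) \<Rightarrow> bool" where
  "biholomorphic_map A B f \<longleftrightarrow>
     holomorphic_map A B f \<and>
     (\<exists>h. holomorphic_map B A h \<and>
        (\<forall>x\<in>points A. h (f x) = x) \<and> (\<forall>y\<in>points B. f (h y) = y))"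

text \<open>The projective line as the one-point compactification of the plane, \<^term>\<open>None\<close>
  being the point at infinity, with the charts \<open>z\<close> and \<open>1 / z\<close>.\<close>

definition projective_line :: "complex option surface" where
  "projective_line =
     \<lparr>surf_top = Alexandroff_compactification euclidean,
      charts = {(range Some, the),
                (- {Some 0}, \<lambda>x. case x of None \<Rightarrow> 0 | Some z \<Rightarrow> inverse z)}\<rparr>"


lemma compact_riemann_surface_projective_line: "compact_riemann_surface projective_line"
proof -
  let ?P = "Alexandroff_compactification (euclidean :: complex topology)"
  let ?V = "- {Some 0} :: complex option set"
  let ?v = "\<lambda>x. case x of None \<Rightarrow> 0 | Some z \<Rightarrow> inverse (z::complex)"
  let ?w = "\<lambda>z. if z = 0 then None else Some (inverse z :: complex)"
  have range_eq: "range Some = - {None :: complex option}"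
    by (auto simp: notin_range_Some)
  have haus: "Hausdorff_space ?P"
    by (simp add: Hausdorff_space_Alexandroff_compactification locally_compact_space_euclidean)
  have conn: "connected_space ?P"
  proof -
    have "?P closure_of (Some ` topspace euclidean) = topspace ?P"
      by (rule Alexandroff_compactification_dense) (simp add: compact_space_def)
    moreover have "connectedin ?P (Some ` topspace euclidean)"
      by (rule connectedin_continuous_map_image[OF continuous_map_Some])
        (simp add: connected_UNIV)
    ultimately show ?thesis
      by (metis connectedin_closure_of connectedin_topspace)
  qed
  have V_eq: "?V = insert None (Some ` (UNIV - {0}))"
    by (auto simp: image_iff)
  have Vo: "openin ?P ?V"
    unfolding openin_Alexandroff_compactification V_eq
    by (rule disjI2, rule exI[of _ "{0}"]) simp
  have u_img: "the ` range Some = (UNIV :: complex set)"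
    by (simp add: image_image)
  have v_w: "?v (?w z) = z" and w_V: "?w z \<in> ?V" for z
    by auto
  have w_v: "?w (?v x) = x" if "x \<in> ?V" for x
    using that by (auto split: option.splits)
  have v_img: "?v ` ?V = UNIV"
  proof -
    have "z \<in> ?v ` ?V" for z
      using v_w[of z, symmetric] w_V[of z] by (rule image_eqI)
    then show ?thesis
      by blast
  qed
  have inv_u: "inv_into (range Some) the z = Some (z::complex)" for z
    by (rule inv_into_f_eq) (auto simp: inj_on_def)
  have inj_v: "inj_on ?v ?V"
    by (rule inj_on_inverseI[of _ ?w]) (rule w_v)
  have inv_v: "inv_into ?V ?v z = ?w z" for z
    using inj_v w_V v_w by (rule inv_into_f_eq)
  have cont_inv: "continuous_on (- {0}) (inverse :: complex \<Rightarrow> complex)"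
    by (intro continuous_intros) auto
  have open_inv: "open {z :: complex. z \<noteq> 0 \<and> inverse z \<in> W}" if "open W" for W
  proof -
    have "open ((- {0}) \<inter> inverse -` W)"
      using cont_inv that by (simp add: continuous_open_preimage open_Compl)
    moreover have "(- {0}) \<inter> inverse -` W = {z. z \<noteq> 0 \<and> inverse z \<in> W}"
      by auto
    ultimately show ?thesis
      by simp
  qed
  have hu: "homeomorphic_map (subtopology ?P (range Some)) euclidean the"
  proof -
    have "homeomorphic_map euclidean (subtopology ?P (Some ` topspace euclidean)) Some"
      using embedding_map_Some embedding_map_def by blast
    then obtain g where g: "homeomorphic_maps euclidean (subtopology ?P (range Some)) Some g"
      by (auto simp: homeomorphic_map_maps)
    then have "homeomorphic_map (subtopology ?P (range Some)) euclidean g"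
      using homeomorphic_maps_map by blast
    moreover have "g x = the x" if "x \<in> topspace (subtopology ?P (range Some))" for x
      using g that by (auto simp: homeomorphic_maps_def)
    ultimately show ?thesis
      using homeomorphic_map_eq by blast
  qed
  have cont_v: "continuous_map (subtopology ?P ?V) euclidean ?v"
    unfolding continuous_map_def
  proof (intro conjI allI impI)
    show "?v \<in> topspace (subtopology ?P ?V) \<rightarrow> topspace euclidean"
      by simp
    fix W :: "complex set" assume "openin euclidean W"
    then have W: "open W"
      by simp
    let ?T = "{x. x \<in> insert None (range Some) \<and> x \<noteq> Some 0 \<and> ?v x \<in> W}"
    have "openin ?P ?T"
    proof (cases "0 \<in> W")
      case True
      let ?C = "- {z. z \<noteq> 0 \<and> inverse z \<in> W}"
      obtain e where e: "e > 0" "ball 0 e \<subseteq> W"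
        using W True open_contains_ball by blast
      have "norm z \<le> inverse e" if "z \<in> ?C" for z
      proof (cases "z = 0")
        case False
        then have "inverse z \<notin> ball 0 e"
          using that e by auto
        then have "e \<le> inverse (norm z)"
          by (simp add: norm_inverse)
        then show ?thesis
          using e by (metis inverse_inverse_eq le_imp_inverse_le)
      qed (use e in auto)
      then have "compact ?C"
        using open_inv[OF W] by (auto simp: compact_eq_bounded_closed bounded_iff closed_def)
      moreover have "?T = insert None (Some ` (UNIV - ?C))"
      proof (rule Set.set_eqI)
        show "x \<in> ?T \<longleftrightarrow> x \<in> insert None (Some ` (UNIV - ?C))" for x
          using True by (cases x) auto
      qed
      ultimately show ?thesis
        unfolding openin_Alexandroff_compactification
        by (intro disjI2 exI[of _ ?C]) (auto simp: compact_imp_closed)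
    next
      case False
      then have "?T = Some ` {z. z \<noteq> 0 \<and> inverse z \<in> W}"
        by (auto split: option.splits)
      then show ?thesis
        using open_inv[OF W] by simp
    qed
    moreover have "?T \<subseteq> ?V"
      by auto
    ultimately have "openin (subtopology ?P ?V) ?T"
      by (simp add: openin_open_subtopology[OF Vo])
    moreover have "{x \<in> topspace (subtopology ?P ?V). ?v x \<in> W} = ?T"
      by auto
    ultimately show "openin (subtopology ?P ?V) {x \<in> topspace (subtopology ?P ?V). ?v x \<in> W}"
      by simp
  qed
  have cont_w: "continuous_map euclidean (subtopology ?P ?V) ?w"
  proof (rule continuous_map_into_subtopology)
    show "?w \<in> topspace euclidean \<rightarrow> ?V"
      by auto
    show "continuous_map euclidean ?P ?w"
      unfolding continuous_map_def
    proof (intro conjI allI impI)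
      show "?w \<in> topspace euclidean \<rightarrow> topspace ?P"
        by auto
      fix T assume "openin ?P T"
      then consider (fin) U where "open U" "T = Some ` U"
        | (inf) C where "compact C" "T = insert None (Some ` (- C))"
        unfolding openin_Alexandroff_compactification by (auto simp: Compl_eq_Diff_UNIV)
      then have "open {z. ?w z \<in> T}"
      proof cases
        case fin
        then have "{z. ?w z \<in> T} = {z. z \<noteq> 0 \<and> inverse z \<in> U}"
          by auto
        then show ?thesis
          using open_inv fin by simp
      next
        case inf
        obtain b where b: "b > 0" "\<forall>z\<in>C. norm z \<le> b"
          using inf compact_imp_bounded bounded_pos by blast
        have "closed ((- ball 0 (inverse b)) \<inter> inverse -` C)"
        proof (rule continuous_closed_preimage)
          show "continuous_on (- ball 0 (inverse b)) (inverse :: complex \<Rightarrow> complex)"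
            by (rule continuous_on_subset[OF cont_inv]) (use b in auto)
        qed (use inf compact_imp_closed in auto)
        moreover have lb: "inverse b \<le> norm z" if "z \<noteq> 0" "inverse z \<in> C" for z
          using that b by (metis inverse_inverse_eq le_imp_inverse_le norm_inverse
              zero_less_norm_iff inverse_nonzero_iff_nonzero)
        have "{z. ?w z \<in> T} = {z. z \<noteq> 0 \<longrightarrow> inverse z \<notin> C}"
          using inf by auto
        moreover have "\<dots> = - ((- ball 0 (inverse b)) \<inter> inverse -` C)"
          using b by (auto simp: not_less dest: lb)
        ultimately show ?thesis
          by (metis open_Compl)
      qed
      then show "openin euclidean {x \<in> topspace euclidean. ?w x \<in> T}"
        by simp
    qed
  qed
  have hv: "homeomorphic_map (subtopology ?P ?V) euclidean ?v"
    using cont_v cont_w v_w w_v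
    by (auto simp: homeomorphic_map_maps homeomorphic_maps_def intro!: exI[of _ ?w])
  have uu: "(the \<circ> inv_into (range Some) the) holomorphic_on the ` (range Some \<inter> range Some)"
    by (rule holomorphic_transform[of "\<lambda>z. z"]) (auto simp: inv_u)
  have vv: "(?v \<circ> inv_into ?V ?v) holomorphic_on ?v ` (?V \<inter> ?V)"
    by (rule holomorphic_transform[of "\<lambda>z. z"]) (auto simp: inv_v)
  have inv_hol: "inverse holomorphic_on (- {0} :: complex set)"
    by (intro holomorphic_intros) auto
  have uv: "(?v \<circ> inv_into (range Some) the) holomorphic_on the ` (range Some \<inter> ?V)"
  proof (rule holomorphic_transform)
    show "inverse holomorphic_on the ` (range Some \<inter> ?V)"
      by (rule holomorphic_on_subset[OF inv_hol]) auto
  qed (simp add: inv_u)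
  have vu: "(the \<circ> inv_into ?V ?v) holomorphic_on ?v ` (?V \<inter> range Some)"
  proof (rule holomorphic_transform)
    show "inverse holomorphic_on ?v ` (?V \<inter> range Some)"
      by (rule holomorphic_on_subset[OF inv_hol]) auto
  qed (auto simp: inv_v)
  have cover: "range Some \<union> ?V = insert None (range Some)"
    by auto
  have rs: "riemann_surface projective_line"
    unfolding riemann_surface_def
  proof (intro conjI)
    show "(\<Union>(U, u)\<in>charts projective_line. U) = points projective_line"
      using cover by (simp add: projective_line_def)
    show "\<forall>(U, u)\<in>charts projective_line. openin (surf_top projective_line) U \<and> open (u ` U) \<and>
        homeomorphic_map (subtopology (surf_top projective_line) U) (top_of_set (u ` U)) u"
      using Vo hu hv u_img v_img by (simp add: projective_line_def)
    show "\<forall>(U, u)\<in>charts projective_line. \<forall>(V, v)\<in>charts projective_line.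
        (v \<circ> inv_into U u) holomorphic_on u ` (U \<inter> V)"
      using uu vv uv vu by (simp add: projective_line_def)
  qed (use haus conn in \<open>simp_all add: projective_line_def\<close>)
  then show ?thesis
    by (simp add: compact_riemann_surface_def projective_line_def)
qed


section \<open>Covers\<close>

text \<open>A nonconstant holomorphic map between compact Riemann surfaces is a finite branched
  covering.\<close>

definition branched_cover :: "'a surface \<Rightarrow> 'b surface \<Rightarrow> ('a \<Rightarrow> 'b) \<Rightarrow> bool" where
  "branched_cover A B f \<longleftrightarrow>
     compact_riemann_surface A \<and> compact_riemann_surface B \<and>
     holomorphic_map A B f \<and> \<not> f constant_on points A"

text \<open>Number of sheets: the cardinality of all but finitely many fibres.\<close>

definition has_degree :: "'a surface \<Rightarrow> 'b surface \<Rightarrow> ('a \<Rightarrow> 'b) \<Rightarrow> nat \<Rightarrow> bool" where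
  "has_degree A B f n \<longleftrightarrow>
     finite {b \<in> points B. \<not> (finite {a \<in> points A. f a = b} \<and> card {a \<in> points A. f a = b} = n)}"

text \<open>No point is a branch point, that is, the map is locally injective.\<close>

definition unramified :: "'a surface \<Rightarrow> ('a \<Rightarrow> 'b) \<Rightarrow> bool" where
  "unramified A f \<longleftrightarrow> (\<forall>a\<in>points A. \<exists>U. openin (surf_top A) U \<and> a \<in> U \<and> inj_on f U)"

text \<open>Deck transformations are taken extensional, so that distinct elements of the group are
  distinct as maps of \<^term>\<open>points A\<close>.\<close>

definition deck_group :: "'a surface \<Rightarrow> ('a \<Rightarrow> 'b) \<Rightarrow> ('a \<Rightarrow> 'a) monoid" where
  "deck_group A f =
     (BijGroup (points A))
       \<lparr>carrier := {t \<in> Bij (points A).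
          biholomorphic_map A A t \<and> (\<forall>a\<in>points A. f (t a) = f a)}\<rparr>"

text \<open>The fibres are the orbits of the deck group.\<close>

definition galois_map :: "'a surface \<Rightarrow> ('a \<Rightarrow> 'b) \<Rightarrow> bool" where
  "galois_map A f \<longleftrightarrow>
     (\<forall>a\<in>points A. \<forall>a'\<in>points A. f a = f a' \<longrightarrow> (\<exists>t\<in>carrier (deck_group A f). t a = a'))"

definition galois_cover :: "'a surface \<Rightarrow> 'b surface \<Rightarrow> ('a \<Rightarrow> 'b) \<Rightarrow> bool" where
  "galois_cover A B f \<longleftrightarrow> branched_cover A B f \<and> galois_map A f"

definition cyclic_gonal_cover :: "nat \<Rightarrow> 'a surface \<Rightarrow> ('a \<Rightarrow> complex option) \<Rightarrow> bool" where
  "cyclic_gonal_cover p S f \<longleftrightarrow>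
     galois_cover S projective_line f \<and> has_degree S projective_line f p \<and>
     deck_group S f \<cong> integer_mod_group p"

definition cyclic_etale_cover :: "nat \<Rightarrow> 'a surface \<Rightarrow> 'b surface \<Rightarrow> ('a \<Rightarrow> 'b) \<Rightarrow> bool" where
  "cyclic_etale_cover q Y S f \<longleftrightarrow>
     galois_cover Y S f \<and> unramified Y f \<and> deck_group Y f \<cong> integer_mod_group q"

text \<open>\<open>h : Z \<rightarrow> Y\<close> exhibits \<open>f \<circ> h : Z \<rightarrow> B\<close> as the Galois closure of \<open>f : Y \<rightarrow> B\<close>: it is
  a Galois cover factoring through \<open>f\<close>, and every intermediate surface \<open>Z \<rightarrow> W \<rightarrow> Y\<close> that
  is Galois over \<open>B\<close> equals \<open>Z\<close>. Letting \<open>W\<close> live on the type of \<open>Z\<close> loses no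
  generality: any such \<open>W\<close> is a quotient of \<open>Z\<close>, and a system of representatives of the
  classes carries an isomorphic surface.\<close>

definition galois_closure ::
  "'b surface \<Rightarrow> 'c surface \<Rightarrow> ('b \<Rightarrow> 'c) \<Rightarrow> 'z surface \<Rightarrow> ('z \<Rightarrow> 'b) \<Rightarrow> bool" where
  "galois_closure Y B f Z h \<longleftrightarrow>
     branched_cover Z Y h \<and> galois_cover Z B (f \<circ> h) \<and>
     (\<forall>(W :: 'z surface) r k.
        branched_cover Z W r \<and> branched_cover W Y k \<and>
        (\<forall>z\<in>points Z. k (r z) = h z) \<and> galois_cover W B (f \<circ> k)
        \<longrightarrow> biholomorphic_map Z W r)"


section \<open>Semidirect products\<close>

definition internal_semidirect_product ::
  "('a, 'b) monoid_scheme \<Rightarrow> 'a set \<Rightarrow> 'a set \<Rightarrow> bool" where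
  "internal_semidirect_product G N P \<longleftrightarrow>
     N \<lhd> G \<and> subgroup P G \<and> N \<inter> P = {\<one>\<^bsub>G\<^esub>} \<and> N <#>\<^bsub>G\<^esub> P = carrier G"

end

theory Submission
  imports Defs
begin

text \<open>
  Let \<open>Z\<close> be the Galois closure, \<open>G\<close> the deck group of \<open>\<phi> \<circ> \<psi> \<circ> \<pi>\<close>, \<open>N\<close> its subgroup of deck
  transformations over \<open>S\<close>, and \<open>H\<close> that of deck transformations over \<open>Y\<close>. Two lifts of a map
  that agree at one generic point agree everywhere (\<open>lifts_agree\<close>), so deck transformations
  descend along the tower: \<open>N\<close> is the kernel of a surjection of \<open>G\<close> onto the deck group \<open>\<int>/p\<close> of
  \<open>\<phi>\<close>, and \<open>H\<close> the kernel of a surjection \<open>\<xi>\<close> of \<open>N\<close> onto the deck group \<open>\<int>/q\<close> of \<open>\<psi>\<close>. Three facts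
  determine \<open>G\<close>.

  \<^item> The conjugates of \<open>H\<close> in \<open>G\<close> intersect trivially (\<open>galois_closure_faithful\<close>). Otherwise the
    image of \<open>Z\<close> in a product of copies of \<open>Y\<close> under all maps \<open>\<pi> \<circ> t\<close> would be a smaller Galois
    cover. Hence \<open>N\<close> embeds into a power of \<open>\<int>/q\<close>.
  \<^item> Let \<open>T\<close> be the set of elements of \<open>G\<close> that fix some point of \<open>Z\<close>. As \<open>\<psi>\<close> is unramified, an
    element of \<open>T \<inter> N\<close> lies in all conjugates of \<open>H\<close>, so \<open>T \<inter> N\<close> is trivial.
  \<^item> A normal subgroup \<open>L\<close> containing \<open>T\<close> is all of \<open>G\<close> (\<open>stabilizers_generate\<close>), because
    \<open>Z/L\<close> is an unramified connected cover of the simply connected sphere.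

  The rest is group theory (\<open>elementary_abelian_semidirect_cyclic\<close>). Some \<open>\<tau> \<in> T\<close> lies outside
  \<open>N\<close>, and \<open>\<tau>\<^sup>p \<in> T \<inter> N\<close> is trivial, so \<open>\<tau>\<close> generates a complement of \<open>N\<close> of order \<open>p\<close>. The map
  sending \<open>k \<tau>\<^sup>i\<close> to the norm of \<open>k\<close>, the product of all \<open>\<tau>\<^sup>j k \<tau>\<^sup>-\<^sup>j\<close>, is a homomorphism of \<open>G\<close> into
  the \<open>q\<close>-group \<open>N\<close>. It kills \<open>T\<close>, whose elements have order dividing \<open>p\<close>, so it is trivial. Thus
  an element of \<open>N\<close> that commutes with \<open>\<tau>\<close> satisfies \<open>k\<^sup>p = 1\<close> and is trivial; counting the
  cycles of conjugation by \<open>\<tau>\<close> on \<open>N\<close> gives \<open>q\<^sup>s \<equiv> 1\<close> modulo \<open>p\<close>. Moreover the \<open>p\<close> conjugates of \<open>\<xi>\<close>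
  under powers of \<open>\<tau>\<close> add up to zero, so \<open>p - 1\<close> of them already separate the points of \<open>N\<close>,
  whence \<open>s \<le> p - 1\<close>.

  If \<open>\<phi> \<circ> \<psi>\<close> were Galois, the same argument would apply to \<open>Z = Y\<close> with \<open>N\<close> of order \<open>q\<close>. Then
  \<open>s = 1\<close> and \<open>q \<equiv> 1\<close> modulo \<open>p\<close>, against \<open>gcd p (q - 1) = 1\<close>.
\<close>

section \<open>Holomorphic maps between Riemann surfaces\<close>

abbreviation open_in :: "'a surface \<Rightarrow> 'a set \<Rightarrow> bool" where
  "open_in A \<equiv> openin (surf_top A)"

lemma chartD:
  assumes "riemann_surface A" "(U, u) \<in> charts A"
  shows chart_open: "open_in A U" and chart_subset: "U \<subseteq> points A"
    and chart_inj: "inj_on u U" and chart_open_image: "open (u ` U)"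
    and chart_homeomorphic: "homeomorphic_map (subtopology (surf_top A) U) (top_of_set (u ` U)) u"
proof -
  have *: "open_in A U \<and> open (u ` U) \<and>
        homeomorphic_map (subtopology (surf_top A) U) (top_of_set (u ` U)) u"
    using assms by (auto simp: riemann_surface_def)
  then show "open_in A U" "open (u ` U)"
    "homeomorphic_map (subtopology (surf_top A) U) (top_of_set (u ` U)) u"
    by auto
  then show "U \<subseteq> points A"
    by (simp add: openin_subset)
  then show "inj_on u U"
    using * homeomorphic_imp_injective_map by (fastforce simp: topspace_subtopology inf_absorb2)
qed

lemma chart_image_open:
  assumes A: "riemann_surface A" "(U, u) \<in> charts A" and W: "open_in A W" "W \<subseteq> U"
  shows "open (u ` W)"
proof -
  have "openin (subtopology (surf_top A) U) W"
    using W by (simp add: openin_subset_topspace_eq openin_open_subtopology chart_open[OF A])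
  then have "openin (top_of_set (u ` U)) (u ` W)"
    using chart_homeomorphic[OF A] homeomorphic_imp_open_map open_map_def by blast
  then show ?thesis
    using chart_open_image[OF A] openin_open_trans by blast
qed

lemma chart_preimage_open:
  assumes A: "riemann_surface A" "(U, u) \<in> charts A" and W: "open W"
  shows "open_in A {x \<in> U. u x \<in> W}"
proof -
  have "continuous_map (subtopology (surf_top A) U) euclidean u"
    using chart_homeomorphic[OF A] homeomorphic_imp_continuous_map continuous_map_in_subtopology
    by blast
  then have "openin (subtopology (surf_top A) U) {x \<in> topspace (subtopology (surf_top A) U). u x \<in> W}"
    using W by (intro openin_continuous_map_preimage) auto
  moreover have "{x \<in> topspace (subtopology (surf_top A) U). u x \<in> W} = {x \<in> U. u x \<in> W}"
    using chart_subset[OF A] by auto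
  ultimately show ?thesis
    using chart_open[OF A] by (simp add: openin_open_subtopology)
qed

lemma chart_at:
  assumes "riemann_surface A" "a \<in> points A"
  obtains U u where "(U, u) \<in> charts A" "a \<in> U"
proof -
  have "(\<Union>(U, u)\<in>charts A. U) = points A"
    using assms by (auto simp only: riemann_surface_def)
  then show ?thesis
    using assms that by auto
qed

lemma chart_inverse:
  assumes "riemann_surface A" "(U, u) \<in> charts A" "x \<in> U"
  shows "inv_into U u (u x) = x"
  using chart_inj[OF assms(1,2)] assms(3) by simp

lemma transition_holomorphic:
  assumes "riemann_surface A" "(U, u) \<in> charts A" "(V, v) \<in> charts A"
  shows "(v \<circ> inv_into U u) holomorphic_on u ` (U \<inter> V)"
  using assms by (auto simp: riemann_surface_def)

lemma holomorphic_mapD: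
  assumes "holomorphic_map A B f"
  shows holomorphic_map_continuous: "continuous_map (surf_top A) (surf_top B) f"
    and holomorphic_map_points: "a \<in> points A \<Longrightarrow> f a \<in> points B"
    and holomorphic_map_in_charts: "\<lbrakk>(U, u) \<in> charts A; (V, v) \<in> charts B; W \<subseteq> U; f ` W \<subseteq> V\<rbrakk>
      \<Longrightarrow> (v \<circ> f \<circ> inv_into U u) holomorphic_on u ` W"
proof -
  show 1: "continuous_map (surf_top A) (surf_top B) f"
    using assms by (simp add: holomorphic_map_def)
  show "a \<in> points A \<Longrightarrow> f a \<in> points B"
    using continuous_map_funspace[OF 1] by auto
  assume W: "(U, u) \<in> charts A" "(V, v) \<in> charts B" "W \<subseteq> U" "f ` W \<subseteq> V"
  then have "(v \<circ> f \<circ> inv_into U u) holomorphic_on u ` (U \<inter> f -` V)"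
    using assms by (auto simp: holomorphic_map_def)
  then show "(v \<circ> f \<circ> inv_into U u) holomorphic_on u ` W"
    by (rule holomorphic_on_subset) (use W(3,4) in blast)
qed

lemma open_in_preimage:
  assumes "continuous_map (surf_top A) (surf_top B) f" "open_in B V"
  shows "open_in A {x \<in> points A. f x \<in> V}"
  using assms by (simp add: openin_continuous_map_preimage)

text \<open>Transition functions are holomorphic, so one pair of charts per point is enough to test
  holomorphy.\<close>

lemma holomorphic_map_localI:
  assumes A: "riemann_surface A" and B: "riemann_surface B"
    and cont: "continuous_map (surf_top A) (surf_top B) f"
    and loc: "\<And>a. a \<in> points A \<Longrightarrow> \<exists>U u V v W. (U, u) \<in> charts A \<and> (V, v) \<in> charts B \<and>
        open_in A W \<and> a \<in> W \<and> W \<subseteq> U \<and> f ` W \<subseteq> V \<and> (v \<circ> f \<circ> inv_into U u) holomorphic_on u ` W"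
  shows "holomorphic_map A B f"
proof -
  have "(v' \<circ> f \<circ> inv_into U' u') holomorphic_on u' ` (U' \<inter> f -` V')"
    if c: "(U', u') \<in> charts A" "(V', v') \<in> charts B" for U' u' V' v'
    unfolding holomorphic_on_def
  proof (rule ballI)
    fix x assume "x \<in> u' ` (U' \<inter> f -` V')"
    then obtain a where a: "a \<in> U'" "f a \<in> V'" "x = u' a"
      by auto
    have U': "open_in A U'" "U' \<subseteq> points A" "inj_on u' U'"
      using chartD[OF A c(1)] by auto
    obtain U u V v W where uv: "(U, u) \<in> charts A" "(V, v) \<in> charts B"
      and W: "open_in A W" "a \<in> W" "W \<subseteq> U" "f ` W \<subseteq> V"
      and hol: "(v \<circ> f \<circ> inv_into U u) holomorphic_on u ` W"
      using loc a U' by blast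
    have iu: "inj_on u U" and iv: "inj_on v V"
      using chart_inj A B uv by auto
    define N where "N = W \<inter> (U' \<inter> {z \<in> points A. f z \<in> V'})"
    have N: "open_in A N" "a \<in> N" "N \<subseteq> U'" "N \<subseteq> W"
      using W U' a open_in_preimage[OF cont chart_open[OF B c(2)]] by (auto simp: N_def)
    have h1: "(u \<circ> inv_into U' u') holomorphic_on u' ` N"
      by (rule holomorphic_on_subset[OF transition_holomorphic[OF A c(1) uv(1)]]) (use N W in auto)
    have h3: "(v' \<circ> inv_into V v) holomorphic_on v ` (V \<inter> V')"
      by (rule transition_holomorphic[OF B uv(2) c(2)])
    have i1: "(u \<circ> inv_into U' u') ` u' ` N \<subseteq> u ` W"
    proof clarsimp
      fix x assume "x \<in> N"
      then show "u (inv_into U' u' (u' x)) \<in> u ` W"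
        using N(3,4) chart_inverse[OF A c(1), of x] by (metis imageI subsetD)
    qed
    have h12: "((v \<circ> f \<circ> inv_into U u) \<circ> (u \<circ> inv_into U' u')) holomorphic_on u' ` N"
      by (rule holomorphic_on_compose_gen[OF h1 hol i1])
    have eq12: "((v \<circ> f \<circ> inv_into U u) \<circ> (u \<circ> inv_into U' u')) (u' n) = v (f n)" if "n \<in> N" for n
    proof -
      have "n \<in> U'" "n \<in> U"
        using that N W by auto
      then show ?thesis
        using chart_inverse[OF A c(1)] chart_inverse[OF A uv(1)] by simp
    qed
    have "((v' \<circ> inv_into V v) \<circ> ((v \<circ> f \<circ> inv_into U u) \<circ> (u \<circ> inv_into U' u'))) holomorphic_on u' ` N"
    proof (rule holomorphic_on_compose_gen[OF h12 h3])
      show "((v \<circ> f \<circ> inv_into U u) \<circ> (u \<circ> inv_into U' u')) ` u' ` N \<subseteq> v ` (V \<inter> V')"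
        using eq12 W N by (auto simp: N_def)
    qed
    moreover have "((v' \<circ> inv_into V v) \<circ> ((v \<circ> f \<circ> inv_into U u) \<circ> (u \<circ> inv_into U' u'))) z
        = (v' \<circ> f \<circ> inv_into U' u') z" if z: "z \<in> u' ` N" for z
    proof -
      obtain n where n: "n \<in> N" "z = u' n"
        using z by auto
      have "f n \<in> V"
        using n(1) N(4) W(4) by blast
      then have "inv_into V v (v (f n)) = f n"
        using iv by simp
      moreover have "inv_into U' u' z = n"
        using n N U' by auto
      ultimately show ?thesis
        using eq12[OF n(1)] n by simp
    qed
    ultimately have "(v' \<circ> f \<circ> inv_into U' u') holomorphic_on u' ` N"
      by (rule holomorphic_transform)
    moreover have "open (u' ` N)"
      using chart_image_open[OF A c(1)] N by blast
    moreover have "x \<in> u' ` N"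
      using a N by blast
    ultimately show "(v' \<circ> f \<circ> inv_into U' u') field_differentiable at x within u' ` (U' \<inter> f -` V')"
      using holomorphic_on_imp_differentiable_at field_differentiable_at_within by blast
  qed
  then show ?thesis
    using cont by (auto simp: holomorphic_map_def)
qed

lemma holomorphic_map_compose:
  assumes A: "riemann_surface A" and B: "riemann_surface B" and C: "riemann_surface C"
    and f: "holomorphic_map A B f" and g: "holomorphic_map B C g"
  shows "holomorphic_map A C (g \<circ> f)"
proof (rule holomorphic_map_localI[OF A C])
  show cont: "continuous_map (surf_top A) (surf_top C) (g \<circ> f)"
    by (rule continuous_map_compose[OF holomorphic_map_continuous[OF f] holomorphic_map_continuous[OF g]])
  fix a assume a: "a \<in> points A"
  obtain U u where u: "(U, u) \<in> charts A" "a \<in> U"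
    using chart_at[OF A a] .
  obtain V v where v: "(V, v) \<in> charts B" "f a \<in> V"
    using chart_at[OF B holomorphic_map_points[OF f a]] .
  obtain N n where n: "(N, n) \<in> charts C" "g (f a) \<in> N"
    using chart_at[OF C holomorphic_map_points[OF g holomorphic_map_points[OF f a]]] .
  define M where "M = {y \<in> points B. g y \<in> N} \<inter> V"
  define W where "W = {x \<in> points A. f x \<in> M} \<inter> U"
  have M: "open_in B M" "f a \<in> M"
    using open_in_preimage[OF holomorphic_map_continuous[OF g] chart_open[OF C n(1)]]
      chart_open[OF B v(1)] v n holomorphic_map_points[OF f a] by (auto simp: M_def)
  have W: "open_in A W" "a \<in> W" "W \<subseteq> U" "f ` W \<subseteq> M" "M \<subseteq> V" "g ` M \<subseteq> N"
    using open_in_preimage[OF holomorphic_map_continuous[OF f] M(1)] chart_open[OF A u(1)] u M a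
    by (auto simp: W_def M_def)
  have "((n \<circ> g \<circ> inv_into V v) \<circ> (v \<circ> f \<circ> inv_into U u)) holomorphic_on u ` W"
  proof (rule holomorphic_on_compose_gen)
    show "(v \<circ> f \<circ> inv_into U u) holomorphic_on u ` W"
      by (rule holomorphic_map_in_charts[OF f u(1) v(1)]) (use W in auto)
    show "(n \<circ> g \<circ> inv_into V v) holomorphic_on v ` M"
      by (rule holomorphic_map_in_charts[OF g v(1) n(1)]) (use W in auto)
    show "(v \<circ> f \<circ> inv_into U u) ` u ` W \<subseteq> v ` M"
    proof clarsimp
      fix x assume "x \<in> W"
      then show "v (f (inv_into U u (u x))) \<in> v ` M"
        using W(3,4) chart_inverse[OF A u(1), of x] by (metis imageI subsetD)
    qed
  qed
  then have "(n \<circ> (g \<circ> f) \<circ> inv_into U u) holomorphic_on u ` W"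
  proof (rule holomorphic_transform)
    fix z assume "z \<in> u ` W"
    then obtain x where x: "x \<in> W" "z = u x"
      by auto
    then have "f x \<in> V" "inv_into U u z = x"
      using W chart_inverse[OF A u(1), of x] by auto
    then show "((n \<circ> g \<circ> inv_into V v) \<circ> (v \<circ> f \<circ> inv_into U u)) z = (n \<circ> (g \<circ> f) \<circ> inv_into U u) z"
      using chart_inverse[OF B v(1), of "f x"] by simp
  qed
  moreover have "(g \<circ> f) ` W \<subseteq> N"
    using W(4,6) by auto
  ultimately show "\<exists>U u V v W. (U, u) \<in> charts A \<and> (V, v) \<in> charts C \<and> open_in A W \<and> a \<in> W \<and> W \<subseteq> U
      \<and> (g \<circ> f) ` W \<subseteq> V \<and> (v \<circ> (g \<circ> f) \<circ> inv_into U u) holomorphic_on u ` W"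
    using u(1) n(1) W(1-3) by blast
qed

lemma holomorphic_map_const:
  assumes "riemann_surface A" "c \<in> points B"
  shows "holomorphic_map A B (\<lambda>_. c)"
proof -
  have "(v \<circ> (\<lambda>_. c) \<circ> inv_into U u) holomorphic_on X" for v U and u :: "'a \<Rightarrow> complex" and X
    by (simp add: comp_def)
  then show ?thesis
    using assms by (auto simp only: holomorphic_map_def continuous_map_const)
qed

lemma holomorphic_map_id:
  assumes A: "riemann_surface A"
  shows "holomorphic_map A A (\<lambda>x. x)"
  using transition_holomorphic[OF A] by (auto simp: holomorphic_map_def comp_def)

lemma holomorphic_map_cong:
  assumes A: "riemann_surface A" and "\<And>x. x \<in> points A \<Longrightarrow> f x = g x" and f: "holomorphic_map A B f"
  shows "holomorphic_map A B g"
proof -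
  have "(v \<circ> g \<circ> inv_into U u) holomorphic_on u ` (U \<inter> g -` V)"
    if c: "(U, u) \<in> charts A" "(V, v) \<in> charts B" for U u V v
  proof (rule holomorphic_transform)
    have U: "U \<subseteq> points A" "inj_on u U"
      using chartD[OF A c(1)] by auto
    show "(v \<circ> f \<circ> inv_into U u) holomorphic_on u ` (U \<inter> g -` V)"
      by (rule holomorphic_map_in_charts[OF f c]) (use U assms(2) in auto)
    show "(v \<circ> f \<circ> inv_into U u) x = (v \<circ> g \<circ> inv_into U u) x" if "x \<in> u ` (U \<inter> g -` V)" for x
      using that U assms(2) by (auto simp: subset_iff)
  qed
  then show ?thesis
    using continuous_map_eq[OF holomorphic_map_continuous[OF f] assms(2)]
    by (auto simp: holomorphic_map_def)
qed

text \<open>A holomorphic map that is injective near a point has a holomorphic inverse there, so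
  continuous lifts through it are holomorphic.\<close>

lemma holomorphic_map_lift:
  assumes A: "riemann_surface A" and B: "riemann_surface B" and C: "riemann_surface C"
    and cont: "continuous_map (surf_top A) (surf_top B) f"
    and g: "holomorphic_map B C g" "unramified B g"
    and gf: "holomorphic_map A C (g \<circ> f)"
  shows "holomorphic_map A B f"
proof (rule holomorphic_map_localI[OF A B cont])
  fix a assume a: "a \<in> points A"
  have fa: "f a \<in> points B"
    using continuous_map_funspace[OF cont] a by auto
  obtain U u where u: "(U, u) \<in> charts A" "a \<in> U"
    using chart_at[OF A a] .
  obtain V v where v: "(V, v) \<in> charts B" "f a \<in> V"
    using chart_at[OF B fa] .
  obtain N n where n: "(N, n) \<in> charts C" "g (f a) \<in> N"
    using chart_at[OF C holomorphic_map_points[OF g(1) fa]] .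
  obtain Q where Q: "open_in B Q" "f a \<in> Q" "inj_on g Q"
    using g(2) fa by (auto simp: unramified_def)
  define M where "M = {y \<in> points B. g y \<in> N} \<inter> V \<inter> Q"
  define W where "W = {x \<in> points A. f x \<in> M} \<inter> U"
  have M: "open_in B M" "f a \<in> M"
    using open_in_preimage[OF holomorphic_map_continuous[OF g(1)] chart_open[OF C n(1)]]
      chart_open[OF B v(1)] v n Q fa by (auto simp: M_def)
  have W: "open_in A W" "a \<in> W" "W \<subseteq> U" "f ` W \<subseteq> M" "M \<subseteq> V" "g ` M \<subseteq> N" "M \<subseteq> Q"
    using open_in_preimage[OF cont M(1)] chart_open[OF A u(1)] u M a
    by (auto simp: W_def M_def)
  have "inj_on n N"
    using chart_inj[OF C n(1)] .
  let ?G = "n \<circ> g \<circ> inv_into V v"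
  have G_eq: "?G (v y) = n (g y)" if "y \<in> M" for y
  proof -
    have "y \<in> V"
      using that W(5) by blast
    then show ?thesis
      using chart_inverse[OF B v(1)] by simp
  qed
  have G: "?G holomorphic_on v ` M"
    by (rule holomorphic_map_in_charts[OF g(1) v(1) n(1)]) (use W in auto)
  have inj: "inj_on ?G (v ` M)"
  proof (rule inj_onI)
    fix x y assume "x \<in> v ` M" "y \<in> v ` M" "?G x = ?G y"
    then obtain x' y' where xy: "x' \<in> M" "y' \<in> M" "x = v x'" "y = v y'" "n (g x') = n (g y')"
      using G_eq by auto
    then have "g x' = g y'"
      using \<open>inj_on n N\<close> W by (meson image_subset_iff inj_onD)
    then show "x = y"
      using xy Q W by (metis inj_onD subsetD)
  qed
  obtain k where k: "k holomorphic_on ?G ` v ` M" "\<And>z. z \<in> v ` M \<Longrightarrow> k (?G z) = z"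
    by (rule holomorphic_has_inverse[OF G chart_image_open[OF B v(1) M(1) W(5)] inj]) (erule that, simp)
  have "(k \<circ> (n \<circ> (g \<circ> f) \<circ> inv_into U u)) holomorphic_on u ` W"
  proof (rule holomorphic_on_compose_gen[OF _ k(1)])
    have "(g \<circ> f) ` W \<subseteq> N"
      using W(4,6) by auto
    then show "(n \<circ> (g \<circ> f) \<circ> inv_into U u) holomorphic_on u ` W"
      by (rule holomorphic_map_in_charts[OF gf u(1) n(1) W(3)])
    show "(n \<circ> (g \<circ> f) \<circ> inv_into U u) ` u ` W \<subseteq> ?G ` v ` M"
    proof clarsimp
      fix x assume x: "x \<in> W"
      then have "f x \<in> M"
        using W by blast
      then have "n (g (f x)) = ?G (v (f x))"
        using G_eq by simp
      moreover have "inv_into U u (u x) = x"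
        using chart_inverse[OF A u(1)] x W(3) by blast
      ultimately show "n (g (f (inv_into U u (u x)))) \<in> (\<lambda>x. n (g (inv_into V v x))) ` v ` M"
        using \<open>f x \<in> M\<close> by auto
    qed
  qed
  then have "(v \<circ> f \<circ> inv_into U u) holomorphic_on u ` W"
  proof (rule holomorphic_transform)
    fix z assume "z \<in> u ` W"
    then obtain x where x: "x \<in> W" "z = u x"
      by auto
    then have "f x \<in> M" "inv_into U u z = x"
      using W(3,4) chart_inverse[OF A u(1), of x] by auto
    then show "(k \<circ> (n \<circ> (g \<circ> f) \<circ> inv_into U u)) z = (v \<circ> f \<circ> inv_into U u) z"
      using k(2)[of "v (f x)"] G_eq[of "f x"] by simp
  qed
  moreover have "f ` W \<subseteq> V"
    using W(4,5) by auto
  ultimately show "\<exists>U u V v W. (U, u) \<in> charts A \<and> (V, v) \<in> charts B \<and> open_in A W \<and> a \<in> W \<and> W \<subseteq> U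
      \<and> f ` W \<subseteq> V \<and> (v \<circ> f \<circ> inv_into U u) holomorphic_on u ` W"
    using u(1) v(1) W(1-3) by blast
qed

text \<open>The target chart is prescribed, so that two maps with a common value can be compared in
  the same coordinates.\<close>

lemma local_representation:
  assumes A: "riemann_surface A" and B: "riemann_surface B" and f: "holomorphic_map A B f"
    and W: "open_in A W" "a \<in> W" and v: "(V, v) \<in> charts B" "f a \<in> V"
  obtains U u D r F where "(U, u) \<in> charts A" "open_in A D" "a \<in> D" "D \<subseteq> W" "D \<subseteq> U" "f ` D \<subseteq> V"
    "r > 0" "u ` D = ball (u a) r" "F holomorphic_on ball (u a) r" "\<forall>x\<in>D. F (u x) = v (f x)"
proof -
  have a: "a \<in> points A"
    using W openin_subset by blast
  obtain U u where u: "(U, u) \<in> charts A" "a \<in> U"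
    using chart_at[OF A a] .
  define E where "E = {x \<in> points A. f x \<in> V} \<inter> W \<inter> U"
  have E: "open_in A E" "a \<in> E" "E \<subseteq> U" "E \<subseteq> W" "f ` E \<subseteq> V"
    using open_in_preimage[OF holomorphic_map_continuous[OF f] chart_open[OF B v(1)]]
      chart_open[OF A u(1)] u v W a by (auto simp: E_def)
  obtain r where r: "r > 0" "ball (u a) r \<subseteq> u ` E"
    using chart_image_open[OF A u(1) E(1,3)] E(2) by (meson imageI openE)
  define D where "D = {x \<in> U. u x \<in> ball (u a) r}"
  have DE: "D \<subseteq> E"
  proof
    fix x assume x: "x \<in> D"
    then obtain y where "y \<in> E" "u x = u y"
      using r by (auto simp: D_def)
    then show "x \<in> E"
      using x E(3) inj_onD[OF chart_inj[OF A u(1)], of x y] by (auto simp: D_def)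
  qed
  have im: "u ` D = ball (u a) r"
  proof
    show "ball (u a) r \<subseteq> u ` D"
      using r(2) E(3) unfolding D_def by blast
  qed (auto simp: D_def)
  let ?F = "v \<circ> f \<circ> inv_into U u"
  have "?F holomorphic_on u ` D"
    by (rule holomorphic_map_in_charts[OF f u(1) v(1)]) (use DE E(3,5) in blast)+
  moreover have "?F (u x) = v (f x)" if "x \<in> D" for x
    using chart_inverse[OF A u(1), of x] that by (simp add: D_def)
  moreover have "open_in A D"
    unfolding D_def by (rule chart_preimage_open[OF A u(1)]) simp
  moreover have "a \<in> D" "D \<subseteq> U"
    using u r by (auto simp: D_def)
  ultimately show ?thesis
    using that[of U u D r ?F] u(1) DE E(4,5) r(1) im by (metis image_mono order_trans)
qed

text \<open>The interior of the set where the maps agree is closed: near one of its limit points both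
  maps are holomorphic functions on a disc that coincide on an open part of it.\<close>

theorem holomorphic_map_identity:
  assumes A: "riemann_surface A" and B: "riemann_surface B"
    and f: "holomorphic_map A B f" and g: "holomorphic_map A B g"
    and W: "open_in A W" "W \<noteq> {}" and eq: "\<And>x. x \<in> W \<Longrightarrow> f x = g x" and a: "a \<in> points A"
  shows "f a = g a"
proof -
  define E where "E = \<Union>{X. open_in A X \<and> (\<forall>x\<in>X. f x = g x)}"
  have E: "open_in A E" "\<And>x. x \<in> E \<Longrightarrow> f x = g x"
    "\<And>X. \<lbrakk>open_in A X; \<And>x. x \<in> X \<Longrightarrow> f x = g x\<rbrakk> \<Longrightarrow> X \<subseteq> E"
    by (auto simp: E_def)
  have "\<exists>N. open_in A N \<and> b \<in> N \<and> N \<subseteq> points A - E" if b: "b \<in> points A - E" for b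
  proof (cases "f b = g b")
    case False
    have "f b \<in> points B" "g b \<in> points B"
      using b holomorphic_map_points[OF f] holomorphic_map_points[OF g] by auto
    moreover have "Hausdorff_space (surf_top B)"
      using B by (simp add: riemann_surface_def)
    ultimately obtain X Y where XY: "open_in B X" "open_in B Y" "f b \<in> X" "g b \<in> Y" "disjnt X Y"
      using False unfolding Hausdorff_space_def by metis
    let ?N = "{x \<in> points A. f x \<in> X} \<inter> {x \<in> points A. g x \<in> Y}"
    have "open_in A ?N"
      using open_in_preimage[OF holomorphic_map_continuous[OF f] XY(1)]
        open_in_preimage[OF holomorphic_map_continuous[OF g] XY(2)] by blast
    moreover have "?N \<inter> E = {}"
      using XY(5) E(2) by (auto simp: disjnt_def)
    ultimately show ?thesis
      using b XY by blast
  next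
    case True
    obtain V v where v: "(V, v) \<in> charts B" "f b \<in> V"
      using chart_at[OF B holomorphic_map_points[OF f]] b by blast
    define Q where "Q = {x \<in> points A. g x \<in> V}"
    have Q: "open_in A Q" "b \<in> Q"
      using open_in_preimage[OF holomorphic_map_continuous[OF g] chart_open[OF B v(1)]] b v True
      by (auto simp: Q_def)
    obtain U u D r F where u: "(U, u) \<in> charts A" and D: "open_in A D" "b \<in> D" "D \<subseteq> Q" "D \<subseteq> U" "f ` D \<subseteq> V"
      and r: "r > 0" "u ` D = ball (u b) r" and F: "F holomorphic_on ball (u b) r"
      "\<forall>x\<in>D. F (u x) = v (f x)"
      using local_representation[OF A B f Q v] .
    let ?G = "v \<circ> g \<circ> inv_into U u"
    have gV: "g ` D \<subseteq> V"
      using D by (auto simp: Q_def)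
    then have G: "?G holomorphic_on ball (u b) r"
      using holomorphic_map_in_charts[OF g u v(1) D(4)] r by simp
    have Gu: "?G (u x) = v (g x)" if "x \<in> D" for x
      using chart_inverse[OF A u, of x] that D(4) by auto
    have "D \<inter> E = {}"
    proof (rule ccontr)
      assume ne: "D \<inter> E \<noteq> {}"
      have "F z = ?G z" if "z \<in> ball (u b) r" for z
      proof (rule analytic_continuation_open[OF _ _ _ _ _ F(1) G _ that])
        show "open (u ` (D \<inter> E))"
          by (rule chart_image_open[OF A u]) (use D E in auto)
        fix w assume "w \<in> u ` (D \<inter> E)"
        then obtain x where x: "x \<in> D" "x \<in> E" "w = u x"
          by blast
        show "F w = ?G w"
          unfolding x(3) bspec[OF F(2) x(1)] Gu[OF x(1)] E(2)[OF x(2)] ..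
      qed (use ne r in auto)
      then have "v (f x) = v (g x)" if "x \<in> D" for x
        using that F(2) Gu r by (metis imageI)
      then have "f x = g x" if "x \<in> D" for x
        using inj_onD[OF chart_inj[OF B v(1)], of "f x" "g x"] that D(5) gV by blast
      then show False
        using E(3)[OF D(1)] D(2) b by blast
    qed
    then show ?thesis
      using D openin_subset[OF D(1)] by blast
  qed
  then have "open_in A (points A - E)"
    by (subst openin_subopen) blast
  then have "closedin (surf_top A) E"
    using E(1) by (simp add: closedin_def openin_subset)
  then have "E = {} \<or> E = points A"
    using A E(1) unfolding riemann_surface_def connected_space_clopen_in by blast
  then show ?thesis
    using E(2,3) W eq a by blast
qed

lemma nonconstant_on_open:
  assumes A: "riemann_surface A" and B: "riemann_surface B" and f: "holomorphic_map A B f"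
    and nc: "\<not> f constant_on points A" and W: "open_in A W" "W \<noteq> {}"
  shows "\<not> f constant_on W"
proof
  assume "f constant_on W"
  then obtain c where c: "\<And>x. x \<in> W \<Longrightarrow> f x = c"
    by (auto simp: constant_on_def)
  have "c \<in> points B"
    using W c openin_subset[OF W(1)] holomorphic_map_points[OF f] by blast
  then have "f a = c" if "a \<in> points A" for a
    using holomorphic_map_identity[OF A B f holomorphic_map_const[OF A] W c that] by blast
  then show False
    using nc by (auto simp: constant_on_def)
qed

lemma local_representation_nonconstant:
  assumes A: "riemann_surface A" and B: "riemann_surface B" and f: "holomorphic_map A B f"
    and nc: "\<not> f constant_on points A" and W: "open_in A W" "a \<in> W"
  obtains U u V v D r F where "(U, u) \<in> charts A" "(V, v) \<in> charts B" "open_in A D" "a \<in> D" "D \<subseteq> W"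
    "D \<subseteq> U" "f ` D \<subseteq> V" "r > 0" "u ` D = ball (u a) r" "F holomorphic_on ball (u a) r"
    "\<forall>x\<in>D. F (u x) = v (f x)" "\<not> F constant_on ball (u a) r"
proof -
  have a: "a \<in> points A"
    using W openin_subset by blast
  obtain V v where v: "(V, v) \<in> charts B" "f a \<in> V"
    using chart_at[OF B holomorphic_map_points[OF f a]] .
  obtain U u D r F where u: "(U, u) \<in> charts A" and D: "open_in A D" "a \<in> D" "D \<subseteq> W" "D \<subseteq> U" "f ` D \<subseteq> V"
    and r: "r > 0" "u ` D = ball (u a) r" and F: "F holomorphic_on ball (u a) r"
    "\<forall>x\<in>D. F (u x) = v (f x)"
    using local_representation[OF A B f W v] .
  have "\<not> F constant_on ball (u a) r"
  proof
    assume "F constant_on ball (u a) r"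
    then obtain c where "\<And>z. z \<in> ball (u a) r \<Longrightarrow> F z = c"
      by (auto simp: constant_on_def)
    then have "v (f x) = c" if "x \<in> D" for x
      using that F(2) r by (metis imageI)
    then have "f x = f a" if "x \<in> D" for x
      using inj_onD[OF chart_inj[OF B v(1)], of "f x" "f a"] that D(2,5) by auto
    then have "f constant_on D"
      unfolding constant_on_def by blast
    moreover have "D \<noteq> {}"
      using D(2) by blast
    ultimately show False
      using nonconstant_on_open[OF A B f nc D(1)] by blast
  qed
  then show ?thesis
    using that[OF u v(1) D r F] by blast
qed

theorem holomorphic_map_open:
  assumes A: "riemann_surface A" and B: "riemann_surface B" and f: "holomorphic_map A B f"
    and nc: "\<not> f constant_on points A"
  shows "open_map (surf_top A) (surf_top B) f"
  unfolding open_map_def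
proof (intro allI impI)
  fix W assume W: "open_in A W"
  have "\<exists>N. open_in B N \<and> f a \<in> N \<and> N \<subseteq> f ` W" if a: "a \<in> W" for a
  proof -
    obtain U u V v D r F where u: "(U, u) \<in> charts A" "(V, v) \<in> charts B"
      and D: "open_in A D" "a \<in> D" "D \<subseteq> W" "D \<subseteq> U" "f ` D \<subseteq> V"
      and r: "r > 0" "u ` D = ball (u a) r" and F: "F holomorphic_on ball (u a) r"
      "\<forall>x\<in>D. F (u x) = v (f x)" "\<not> F constant_on ball (u a) r"
      using local_representation_nonconstant[OF A B f nc W a] .
    let ?N = "{y \<in> V. v y \<in> F ` ball (u a) r}"
    have "open (F ` ball (u a) r)"
      by (rule open_mapping_thm[OF F(1) _ _ _ _ F(3)]) auto
    then have "open_in B ?N"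
      by (rule chart_preimage_open[OF B u(2)])
    moreover have "f a \<in> ?N"
      using D(2,5) bspec[OF F(2) D(2)] r(1) by (metis (mono_tags, lifting) centre_in_ball imageI image_subset_iff mem_Collect_eq)
    moreover have "?N \<subseteq> f ` D"
    proof
      fix y assume y: "y \<in> ?N"
      then obtain x where x: "x \<in> D" "v y = F (u x)"
        unfolding r(2)[symmetric] by blast
      then have "y = f x"
        using inj_onD[OF chart_inj[OF B u(2)], of y "f x"] y D(5) bspec[OF F(2) x(1)] by auto
      then show "y \<in> f ` D"
        using x by blast
    qed
    ultimately show ?thesis
      using D(3) by blast
  qed
  then show "open_in B (f ` W)"
    by (subst openin_subopen) blast
qed

text \<open>The critical points, where the derivative in coordinates vanishes, are nowhere dense.\<close>

lemma locally_injective_somewhere: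
  assumes A: "riemann_surface A" and B: "riemann_surface B" and f: "holomorphic_map A B f"
    and nc: "\<not> f constant_on points A" and W: "open_in A W" "W \<noteq> {}"
  obtains N a where "open_in A N" "a \<in> N" "N \<subseteq> W" "inj_on f N"
proof -
  obtain b where b: "b \<in> W"
    using W by blast
  obtain U u V v D r F where u: "(U, u) \<in> charts A" "(V, v) \<in> charts B"
    and D: "open_in A D" "b \<in> D" "D \<subseteq> W" "D \<subseteq> U" "f ` D \<subseteq> V"
    and r: "r > 0" "u ` D = ball (u b) r" and F: "F holomorphic_on ball (u b) r"
    "\<forall>x\<in>D. F (u x) = v (f x)" "\<not> F constant_on ball (u b) r"
    using local_representation_nonconstant[OF A B f nc W(1) b] .
  obtain z where z: "z \<in> ball (u b) r" "deriv F z \<noteq> 0"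
  proof (rule ccontr)
    assume "\<not> thesis"
    then have "\<And>z. z \<in> ball (u b) r \<Longrightarrow> (F has_field_derivative 0) (at z within ball (u b) r)"
      using that F(1) holomorphic_derivI has_field_derivative_at_within by (metis open_ball)
    then have "\<exists>c. \<forall>z\<in>ball (u b) r. F z = c"
      by (intro has_field_derivative_zero_constant) auto
    then show False
      using F(3) by (auto simp: constant_on_def)
  qed
  obtain e where e: "e > 0" "ball z e \<subseteq> ball (u b) r" "inj_on F (ball z e)"
    using has_complex_derivative_locally_injective[OF F(1) z(1) open_ball z(2)] .
  obtain a where a: "a \<in> D" "z = u a"
    using z(1) unfolding r(2)[symmetric] by blast
  let ?N = "{x \<in> U. u x \<in> ball z e} \<inter> D"
  have "inj_on f ?N"
  proof (rule inj_onI)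
    fix x y assume xy: "x \<in> ?N" "y \<in> ?N" "f x = f y"
    then have "F (u x) = F (u y)"
      using F(2) by simp
    then have "u x = u y"
      using inj_onD[OF e(3)] xy by blast
    then show "x = y"
      using inj_onD[OF chart_inj[OF A u(1)], of x y] xy by blast
  qed
  moreover have "open_in A ?N"
    using chart_preimage_open[OF A u(1), of "ball z e"] D(1) by blast
  moreover have "a \<in> ?N"
    using a e(1) D(4) by auto
  ultimately show ?thesis
    using that[of ?N a] D(3) by blast
qed

text \<open>An infinite fibre would accumulate, against the isolation of zeros.\<close>

lemma finite_fibres:
  assumes A: "compact_riemann_surface A" and B: "riemann_surface B" and f: "holomorphic_map A B f"
    and nc: "\<not> f constant_on points A"
  shows "finite {a \<in> points A. f a = b}"
proof (rule ccontr)
  let ?T = "{a \<in> points A. f a = b}"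
  have RA: "riemann_surface A" and cpt: "compactin (surf_top A) (points A)"
    using A by (auto simp: compact_riemann_surface_def compact_space_def)
  assume inf: "infinite ?T"
  then have "points A \<inter> surf_top A derived_set_of ?T \<noteq> {}"
    by (intro compactin_imp_Bolzano_Weierstrass[OF cpt]) auto
  then obtain a where a: "a \<in> points A" and "a \<in> surf_top A derived_set_of ?T"
    by blast
  then have acc: "\<exists>y\<in>?T. y \<noteq> a \<and> y \<in> X" if "open_in A X" "a \<in> X" for X
    using that unfolding in_derived_set_of by blast
  have fab: "f a = b"
  proof (rule ccontr)
    assume ne: "f a \<noteq> b"
    obtain c where "c \<in> ?T"
      using inf by (metis (no_types, lifting) ex_in_conv finite.emptyI)
    then have b: "b \<in> points B"
      using holomorphic_map_points[OF f, of c] by auto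
    have "Hausdorff_space (surf_top B)"
      using B by (simp add: riemann_surface_def)
    then obtain X Y where XY: "open_in B X" "f a \<in> X" "b \<in> Y" "disjnt X Y"
      using ne b holomorphic_map_points[OF f a] unfolding Hausdorff_space_def by metis
    then obtain y where "y \<in> ?T" "f y \<in> X"
      using acc[OF open_in_preimage[OF holomorphic_map_continuous[OF f] XY(1)]] a by blast
    then show False
      using XY by (auto simp: disjnt_def)
  qed
  obtain U u V v D r F where u: "(U, u) \<in> charts A" "(V, v) \<in> charts B"
    and D: "open_in A D" "a \<in> D" "D \<subseteq> points A" "D \<subseteq> U" "f ` D \<subseteq> V"
    and r: "r > 0" "u ` D = ball (u a) r" and F: "F holomorphic_on ball (u a) r"
    "\<forall>x\<in>D. F (u x) = v (f x)" "\<not> F constant_on ball (u a) r"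
    using local_representation_nonconstant[OF RA B f nc openin_topspace a] .
  let ?G = "\<lambda>z. F z - F (u a)"
  obtain z where z: "z \<in> ball (u a) r" "?G z \<noteq> 0"
    using F(3) unfolding constant_on_def by (metis right_minus_eq)
  have G: "?G holomorphic_on ball (u a) r"
    by (intro holomorphic_intros F(1))
  have ua: "u a \<in> ball (u a) r" "?G (u a) = 0"
    using r(1) by auto
  obtain e where e: "e > 0" "ball (u a) e \<subseteq> ball (u a) r" "\<And>z. z \<in> ball (u a) e - {u a} \<Longrightarrow> ?G z \<noteq> 0"
    by (rule isolated_zeros[OF G open_ball connected_ball ua z]) (erule that, auto)
  let ?N = "{x \<in> U. u x \<in> ball (u a) e} \<inter> D"
  have "open_in A ?N" "a \<in> ?N"
    using chart_preimage_open[OF RA u(1), of "ball (u a) e"] D e(1) by auto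
  then obtain y where y: "y \<in> ?N" "y \<noteq> a" "f y = b"
    using acc by blast
  then have "u y \<noteq> u a"
    using inj_onD[OF chart_inj[OF RA u(1)], of y a] D(2,4) by blast
  then have "?G (u y) \<noteq> 0"
    using e(3) y by blast
  moreover have "F (u y) = F (u a)"
    using bspec[OF F(2), of y] bspec[OF F(2) D(2)] y fab by auto
  ultimately show False
    by simp
qed

lemma surj_of_nonconstant:
  assumes A: "compact_riemann_surface A" and B: "riemann_surface B" and f: "holomorphic_map A B f"
    and nc: "\<not> f constant_on points A"
  shows "f ` points A = points B"
proof -
  have RA: "riemann_surface A" and cpt: "compactin (surf_top A) (points A)"
    using A by (auto simp: compact_riemann_surface_def compact_space_def)
  have "open_in B (f ` points A)"
    using holomorphic_map_open[OF RA B f nc] by (simp add: open_map_def)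
  moreover have "closedin (surf_top B) (f ` points A)"
    using B image_compactin[OF cpt holomorphic_map_continuous[OF f]]
    by (simp add: compactin_imp_closedin riemann_surface_def)
  moreover have "f ` points A \<noteq> {}"
    using RA by (auto simp: riemann_surface_def)
  moreover have "connected_space (surf_top B)"
    using B by (simp add: riemann_surface_def)
  ultimately show ?thesis
    unfolding connected_space_clopen_in by blast
qed

text \<open>Where \<open>h\<close> is injective, equality after composition with \<open>h\<close> forces the lifts to agree near
  \<open>z\<close>; the identity theorem does the rest. Freeness of deck groups and descent along a tower rest on
  this rigidity.\<close>

lemma lifts_agree:
  assumes A: "riemann_surface A" and B: "riemann_surface B"
    and f: "holomorphic_map A B f" and g: "holomorphic_map A B g"
    and lift: "\<And>x. x \<in> points A \<Longrightarrow> h (f x) = h (g x)"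
    and z: "z \<in> points A" "f z = g z" and N: "open_in B N" "f z \<in> N" "inj_on h N"
    and a: "a \<in> points A"
  shows "f a = g a"
proof (rule holomorphic_map_identity[OF A B f g _ _ _ a])
  let ?W = "{x \<in> points A. f x \<in> N} \<inter> {x \<in> points A. g x \<in> N}"
  show "open_in A ?W"
    using open_in_preimage[OF holomorphic_map_continuous[OF f] N(1)]
      open_in_preimage[OF holomorphic_map_continuous[OF g] N(1)] by blast
  show "?W \<noteq> {}"
    using z N by auto
  show "f x = g x" if "x \<in> ?W" for x
    using that inj_onD[OF N(3), of "f x" "g x"] lift[of x] by blast
qed

section \<open>The sphere is simply connected\<close>

text \<open>Simple connectivity of the plane in the form needed for gluing sections of covers. Boxes are
  exhausted by bisection, first along vertical segments, then horizontally; all the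
  intersections that occur are boxes, hence connected.\<close>

lemma glue_over_box:
  fixes Q :: "complex set \<Rightarrow> bool"
  assumes sub: "\<And>U V. \<lbrakk>Q U; open V; V \<subseteq> U\<rbrakk> \<Longrightarrow> Q V"
    and un: "\<And>U V. \<lbrakk>Q U; Q V; connected (U \<inter> V)\<rbrakk> \<Longrightarrow> Q (U \<union> V)"
    and loc: "\<And>z. \<exists>U. open U \<and> z \<in> U \<and> Q U"
  shows "Q (box a b)"
proof -
  define R where "R x x' y y' = box (Complex x y) (Complex x' y')" for x x' y y'
  have in_R: "z \<in> R x x' y y' \<longleftrightarrow> x < Re z \<and> Re z < x' \<and> y < Im z \<and> Im z < y'" for z x x' y y'
    by (auto simp: R_def in_box_complex_iff)
  have open_R: "open (R x x' y y')" and conn_R: "connected (R x x' y y')" for x x' y y'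
    by (simp_all add: R_def open_box convex_box convex_connected)
  have square: "\<exists>e>0. Q (R (x - e) (x + e) (y - e) (y + e))" for x y
  proof -
    obtain U where U: "open U" "Complex x y \<in> U" "Q U"
      using loc by blast
    obtain r where r: "r > 0" "ball (Complex x y) r \<subseteq> U"
      using U openE by blast
    have "R (x - r / 2) (x + r / 2) (y - r / 2) (y + r / 2) \<subseteq> ball (Complex x y) r"
    proof
      fix z assume "z \<in> R (x - r / 2) (x + r / 2) (y - r / 2) (y + r / 2)"
      then have "\<bar>x - Re z\<bar> < r / 2" "\<bar>y - Im z\<bar> < r / 2"
        unfolding in_R by linarith+
      moreover have "cmod (Complex x y - z) \<le> \<bar>x - Re z\<bar> + \<bar>y - Im z\<bar>"
        using cmod_le[of "Complex x y - z"] by simp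
      ultimately show "z \<in> ball (Complex x y) r"
        by (simp add: dist_norm)
    qed
    then have "Q (R (x - r / 2) (x + r / 2) (y - r / 2) (y + r / 2))"
      using sub[OF U(3) open_R] r(2) by blast
    then show ?thesis
      using r(1) by (intro exI[of _ "r / 2"]) auto
  qed
  have strip: "\<exists>e>0. Q (R (x - e) (x + e) (c - e) (d + e))" if "c \<le> d" for x c d
    using that
  proof (induction rule: Bolzano)
    case (trans a b c)
    then obtain e1 e2 where e: "e1 > 0" "Q (R (x - e1) (x + e1) (a - e1) (b + e1))"
      "e2 > 0" "Q (R (x - e2) (x + e2) (b - e2) (c + e2))"
      by blast
    define e where "e = min e1 e2"
    let ?U = "R (x - e) (x + e) (a - e) (b + e)" and ?V = "R (x - e) (x + e) (b - e) (c + e)"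
    have "Q ?U" "Q ?V"
      by (rule sub[OF e(2) open_R], force simp: in_R e_def)
        (rule sub[OF e(4) open_R], force simp: in_R e_def)
    moreover have "?U \<inter> ?V = R (x - e) (x + e) (b - e) (b + e)"
      using trans by (auto simp: in_R)
    moreover have "?U \<union> ?V = R (x - e) (x + e) (a - e) (c + e)"
      using trans e by (auto simp: in_R e_def)
    ultimately have "Q (R (x - e) (x + e) (a - e) (c + e))"
      using un[of ?U ?V] conn_R by simp
    then show ?case
      using e by (intro exI[of _ e]) (auto simp: e_def)
  next
    case (local y)
    obtain e where e: "e > 0" "Q (R (x - e) (x + e) (y - e) (y + e))"
      using square by blast
    have "Q (R (x - e / 2) (x + e / 2) (a - e / 2) (b + e / 2))"
      if "a \<le> y" "y \<le> b" "b - a < e / 2" for a b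
      by (rule sub[OF e(2) open_R]) (use that e in \<open>auto simp: in_R\<close>)
    then show ?case
      using e(1) by (metis half_gt_zero)
  qed
  have rect: "\<exists>e>0. Q (R (a - e) (b + e) (c - e) (d + e))" if cd: "c \<le> d" and "a \<le> b" for a b c d
    using that(2)
  proof (induction rule: Bolzano)
    case (trans a b b')
    then obtain e1 e2 where e: "e1 > 0" "Q (R (a - e1) (b + e1) (c - e1) (d + e1))"
      "e2 > 0" "Q (R (b - e2) (b' + e2) (c - e2) (d + e2))"
      by blast
    define e where "e = min e1 e2"
    let ?U = "R (a - e) (b + e) (c - e) (d + e)" and ?V = "R (b - e) (b' + e) (c - e) (d + e)"
    have "Q ?U" "Q ?V"
      by (rule sub[OF e(2) open_R], force simp: in_R e_def)
        (rule sub[OF e(4) open_R], force simp: in_R e_def)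
    moreover have "?U \<inter> ?V = R (b - e) (b + e) (c - e) (d + e)"
      using trans by (auto simp: in_R)
    moreover have "?U \<union> ?V = R (a - e) (b' + e) (c - e) (d + e)"
      using trans e by (auto simp: in_R e_def)
    ultimately have "Q (R (a - e) (b' + e) (c - e) (d + e))"
      using un[of ?U ?V] conn_R by simp
    then show ?case
      using e by (intro exI[of _ e]) (auto simp: e_def)
  next
    case (local x)
    obtain e where e: "e > 0" "Q (R (x - e) (x + e) (c - e) (d + e))"
      using strip cd by blast
    have "Q (R (a - e / 2) (b + e / 2) (c - e / 2) (d + e / 2))"
      if "a \<le> x" "x \<le> b" "b - a < e / 2" for a b
      by (rule sub[OF e(2) open_R]) (use that e in \<open>auto simp: in_R\<close>)
    then show ?case
      using e(1) by (metis half_gt_zero)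
  qed
  let ?x = "max (Re a) (Re b)" and ?y = "max (Im a) (Im b)"
  obtain e where "e > 0" "Q (R (Re a - e) (?x + e) (Im a - e) (?y + e))"
    using rect[of "Im a" ?y "Re a" ?x] by auto
  then show ?thesis
    by (rule_tac sub[OF _ open_box]) (auto simp: in_R in_box_complex_iff)
qed

abbreviation sphere_top :: "complex option topology" where
  "sphere_top \<equiv> Alexandroff_compactification euclidean"

text \<open>The assumptions say that \<open>f\<close> identifies \<open>X/G\<close> with the sphere. For a normal subgroup \<open>L\<close> that
  contains all stabilizers, \<open>X/L \<rightarrow> X/G\<close> is a covering. It is handled through \<open>L\<close>-invariant
  subsets of \<open>X\<close>, so that the space \<open>X/L\<close> itself never has to be formed.\<close>

locale finite_action_over_sphere = group G for G (structure) +
  fixes X :: "'x topology" and act :: "'a \<Rightarrow> 'x \<Rightarrow> 'x" and f :: "'x \<Rightarrow> complex option"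
  assumes fin: "finite (carrier G)"
    and haus: "Hausdorff_space X" and conn: "connected_space X"
    and act_one: "x \<in> topspace X \<Longrightarrow> act \<one> x = x"
    and act_mult: "\<lbrakk>g \<in> carrier G; h \<in> carrier G; x \<in> topspace X\<rbrakk> \<Longrightarrow> act (g \<otimes> h) x = act g (act h x)"
    and act_cont: "g \<in> carrier G \<Longrightarrow> continuous_map X X (act g)"
    and f_cont: "continuous_map X sphere_top f" and f_open: "open_map X sphere_top f"
    and f_surj: "f ` topspace X = topspace sphere_top"
    and f_act: "\<lbrakk>g \<in> carrier G; x \<in> topspace X\<rbrakk> \<Longrightarrow> f (act g x) = f x"
    and f_fibre: "\<lbrakk>x \<in> topspace X; y \<in> topspace X; f x = f y\<rbrakk> \<Longrightarrow> \<exists>g\<in>carrier G. act g x = y"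
begin

lemma act_closed [simp]: "g \<in> carrier G \<Longrightarrow> x \<in> topspace X \<Longrightarrow> act g x \<in> topspace X"
  using continuous_map_funspace[OF act_cont] by auto

lemma act_inv [simp]:
  assumes "g \<in> carrier G" "x \<in> topspace X"
  shows "act (inv g) (act g x) = x" "act g (act (inv g) x) = x"
  using assms by (simp_all add: act_one flip: act_mult)

text \<open>A slice is the preimage in \<open>X\<close> of a section of \<open>X/L \<rightarrow> X/G\<close> over \<open>D\<close>.\<close>

definition slice :: "'a set \<Rightarrow> complex option set \<Rightarrow> 'x set \<Rightarrow> bool" where
  "slice L D A \<longleftrightarrow> openin X A \<and> f ` A \<subseteq> D \<and>
     (\<forall>g\<in>carrier G. \<forall>a\<in>A. act g a \<in> A \<longleftrightarrow> g \<in> L) \<and>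
     (\<forall>x\<in>topspace X. f x \<in> D \<longrightarrow> (\<exists>g\<in>carrier G. act g x \<in> A))"

lemma sliceD:
  assumes "slice L D A"
  shows "openin X A" "a \<in> A \<Longrightarrow> f a \<in> D" "a \<in> A \<Longrightarrow> a \<in> topspace X"
    "\<lbrakk>g \<in> carrier G; a \<in> A\<rbrakk> \<Longrightarrow> act g a \<in> A \<longleftrightarrow> g \<in> L"
    "\<lbrakk>x \<in> topspace X; f x \<in> D\<rbrakk> \<Longrightarrow> \<exists>g\<in>carrier G. act g x \<in> A"
  using assms openin_subset unfolding slice_def by blast+

lemma slice_subset:
  assumes A: "slice L D A" and D': "openin sphere_top D'" "D' \<subseteq> D"
  shows "slice L D' (A \<inter> {x \<in> topspace X. f x \<in> D'})"
  unfolding slice_def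
proof (intro conjI ballI impI)
  show "openin X (A \<inter> {x \<in> topspace X. f x \<in> D'})"
    using sliceD(1)[OF A] openin_continuous_map_preimage[OF f_cont D'(1)] by blast
  fix g a assume "g \<in> carrier G" "a \<in> A \<inter> {x \<in> topspace X. f x \<in> D'}"
  then show "act g a \<in> A \<inter> {x \<in> topspace X. f x \<in> D'} \<longleftrightarrow> g \<in> L"
    using sliceD(4)[OF A, of g a] f_act[of g a] by auto
next
  fix x assume "x \<in> topspace X" "f x \<in> D'"
  then show "\<exists>g\<in>carrier G. act g x \<in> A \<inter> {x \<in> topspace X. f x \<in> D'}"
    using sliceD(5)[OF A, of x] D'(2) f_act by auto
qed auto

lemma slice_translate:
  assumes L: "L \<lhd> G" and A: "slice L D A" and h: "h \<in> carrier G"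
  shows "slice L D {x \<in> topspace X. act h x \<in> A}"
  unfolding slice_def
proof (intro conjI ballI impI)
  show "openin X {x \<in> topspace X. act h x \<in> A}"
    using openin_continuous_map_preimage[OF act_cont[OF h] sliceD(1)[OF A]] .
  show "f ` {x \<in> topspace X. act h x \<in> A} \<subseteq> D"
    using sliceD(2)[OF A] f_act[OF h] by force
  fix g a assume g: "g \<in> carrier G" and a: "a \<in> {x \<in> topspace X. act h x \<in> A}"
  have "act h (act g a) = act (h \<otimes> g \<otimes> inv h) (act h a)"
    using g h a by (simp add: act_mult)
  moreover have "act (h \<otimes> g \<otimes> inv h) (act h a) \<in> A \<longleftrightarrow> h \<otimes> g \<otimes> inv h \<in> L"
    using sliceD(4)[OF A] g h a by simp
  moreover have "h \<otimes> g \<otimes> inv h \<in> L \<longleftrightarrow> g \<in> L"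
  proof
    assume "h \<otimes> g \<otimes> inv h \<in> L"
    then have "inv h \<otimes> (h \<otimes> g \<otimes> inv h) \<otimes> h \<in> L"
      using normal.inv_op_closed1[OF L h] by simp
    moreover have "inv h \<otimes> (h \<otimes> g \<otimes> inv h) \<otimes> h = g"
      using g h by (simp add: m_assoc) (simp flip: m_assoc)
    ultimately show "g \<in> L"
      by simp
  qed (rule normal.inv_op_closed2[OF L h])
  ultimately show "act g a \<in> {x \<in> topspace X. act h x \<in> A} \<longleftrightarrow> g \<in> L"
    using g a by simp
next
  fix x assume x: "x \<in> topspace X" "f x \<in> D"
  then obtain g where g: "g \<in> carrier G" "act g x \<in> A"
    using sliceD(5)[OF A] by blast
  then have "act h (act (inv h \<otimes> g) x) \<in> A"
    using h x by (simp add: act_mult)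
  then show "\<exists>g\<in>carrier G. act g x \<in> {x \<in> topspace X. act h x \<in> A}"
    using g h x by (intro bexI[of _ "inv h \<otimes> g"]) auto
qed

text \<open>The translates of \<open>B\<close> cut \<open>A\<close> over the overlap into open pieces whose images in the sphere
  are equal or disjoint. As the overlap is connected, one translate of \<open>B\<close> contains all of \<open>A\<close>
  there, and the union of \<open>A\<close> with it is the slice sought.\<close>

lemma slice_union:
  assumes L: "L \<lhd> G" and A: "slice L D A" and B: "slice L E B"
    and D: "openin sphere_top D" and E: "openin sphere_top E" and DE: "connectedin sphere_top (D \<inter> E)"
  shows "\<exists>C. slice L (D \<union> E) C"
proof -
  define tr where "tr h = {x \<in> topspace X. act h x \<in> B}" for h
  have tr: "slice L E (tr h)" if "h \<in> carrier G" for h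
    unfolding tr_def by (rule slice_translate[OF L B that])
  have tr_ex: "\<exists>h\<in>carrier G. x \<in> tr h" if "x \<in> topspace X" "f x \<in> E" for x
    using sliceD(5)[OF B that] that by (auto simp: tr_def)
  have conj: "g \<in> L" if "g \<in> carrier G" "h \<in> carrier G" "x \<in> tr h" "act g x \<in> tr h" for g h x
    using sliceD(4)[OF tr] that by blast
  define O' where "O' h = f ` (A \<inter> tr h)" for h
  have openO: "openin sphere_top (O' h)" if "h \<in> carrier G" for h
    using f_open sliceD(1)[OF A] sliceD(1)[OF tr[OF that]] by (auto simp: O'_def open_map_def)
  have sub: "O' h \<subseteq> D \<inter> E" if "h \<in> carrier G" for h
    using sliceD(2)[OF A] sliceD(2)[OF tr[OF that]] by (auto simp: O'_def)
  have inO: "x \<in> tr h" if x: "x \<in> A" "f x \<in> O' h" and h: "h \<in> carrier G" for x h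
  proof -
    obtain y where y: "y \<in> A" "y \<in> tr h" "f y = f x"
      using x by (auto simp: O'_def)
    then obtain g where g: "g \<in> carrier G" "act g y = x"
      using f_fibre sliceD(3)[OF A] x by metis
    then have "g \<in> L"
      using sliceD(4)[OF A] y x by blast
    then show ?thesis
      using sliceD(4)[OF tr[OF h]] g y by blast
  qed
  have cover: "\<exists>h\<in>carrier G. d \<in> O' h" if d: "d \<in> D \<inter> E" for d
  proof -
    obtain x where x: "x \<in> topspace X" "f x = d"
      using d D f_surj openin_subset by (metis IntD1 imageE subsetD)
    then obtain g where g: "g \<in> carrier G" "act g x \<in> A"
      using sliceD(5)[OF A] d by blast
    then obtain h where "h \<in> carrier G" "act g x \<in> tr h"
      using tr_ex[of "act g x"] x d f_act by auto
    then show ?thesis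
      using g x f_act by (auto simp: O'_def intro!: bexI[of _ h] image_eqI[of _ f "act g x"])
  qed
  have eq: "O' h = O' k" if hk: "h \<in> carrier G" "k \<in> carrier G" and ne: "O' h \<inter> O' k \<noteq> {}" for h k
  proof -
    obtain x where x: "x \<in> A" "x \<in> tr h" "f x \<in> O' k"
      using ne by (auto simp: O'_def)
    then have xk: "x \<in> tr k"
      using inO hk by blast
    have "y \<in> tr k \<longleftrightarrow> y \<in> tr h" if y: "y \<in> A" for y
    proof -
      have *: "h' \<otimes> inv k' \<in> L" if "h' \<in> carrier G" "k' \<in> carrier G" "x \<in> tr h'" "x \<in> tr k'" for h' k'
      proof -
        have "act (h' \<otimes> inv k') (act k' x) \<in> B" "act k' x \<in> B"
          using that by (auto simp: tr_def act_mult)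
        then show ?thesis
          using sliceD(4)[OF B, of "h' \<otimes> inv k'"] that by simp
      qed
      have **: "y \<in> tr h'" if hk': "h' \<in> carrier G" "k' \<in> carrier G" "x \<in> tr h'" "x \<in> tr k'" "y \<in> tr k'" for h' k'
      proof -
        have "act (h' \<otimes> inv k') (act k' y) \<in> B"
          using *[OF hk'(1-4)] sliceD(4)[OF B, of "h' \<otimes> inv k'" "act k' y"] hk' by (simp add: tr_def)
        then show ?thesis
          using hk' by (simp add: tr_def act_mult)
      qed
      show ?thesis
        using **[of h k] **[of k h] hk x(2) xk by blast
    qed
    then show ?thesis
      by (auto simp: O'_def)
  qed
  have "\<exists>h\<in>carrier G. D \<inter> E \<subseteq> O' h"
  proof (cases "D \<inter> E = {}")
    case False
    then obtain d h where h: "h \<in> carrier G" "d \<in> O' h" "d \<in> D \<inter> E"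
      using cover by blast
    define R where "R = \<Union>{O' k | k. k \<in> carrier G \<and> O' k \<inter> O' h = {}}"
    have "openin sphere_top R"
      unfolding R_def using openO by (intro openin_Union) auto
    moreover have "D \<inter> E \<subseteq> O' h \<union> R"
    proof
      fix e assume "e \<in> D \<inter> E"
      then obtain k where k: "k \<in> carrier G" "e \<in> O' k"
        using cover by blast
      show "e \<in> O' h \<union> R"
      proof (cases "O' k \<inter> O' h = {}")
        case True
        then show ?thesis
          unfolding R_def using k by blast
      next
        case False
        then show ?thesis
          using eq[OF k(1) h(1)] k(2) by simp
      qed
    qed
    moreover have "O' h \<inter> R = {}"
      unfolding R_def by blast
    ultimately have "R \<inter> (D \<inter> E) = {}"
      using DE openO[OF h(1)] h(2,3) unfolding connectedin by blast
    then show ?thesis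
      using \<open>D \<inter> E \<subseteq> O' h \<union> R\<close> h(1) by blast
  qed auto
  then obtain h where h: "h \<in> carrier G" "D \<inter> E \<subseteq> O' h"
    by blast
  have fit: "x \<in> tr h" if "x \<in> A" "f x \<in> E" for x
    using inO that h sliceD(2)[OF A] by blast
  have "slice L (D \<union> E) (A \<union> tr h)"
    unfolding slice_def
  proof (intro conjI ballI impI)
    show "openin X (A \<union> tr h)"
      using sliceD(1)[OF A] sliceD(1)[OF tr[OF h(1)]] by blast
    show "f ` (A \<union> tr h) \<subseteq> D \<union> E"
      using sliceD(2)[OF A] sliceD(2)[OF tr[OF h(1)]] by blast
    fix g a assume g: "g \<in> carrier G" and a: "a \<in> A \<union> tr h"
    then have aX: "a \<in> topspace X"
      using sliceD(3)[OF A] sliceD(3)[OF tr[OF h(1)]] by blast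
    have fa: "f (act g a) = f a"
      using f_act[OF g aX] .
    have iA: "act g a \<in> A \<longleftrightarrow> g \<in> L" if "a \<in> A"
      using sliceD(4)[OF A g that] .
    have iT: "act g a \<in> tr h \<longleftrightarrow> g \<in> L" if "a \<in> tr h"
      using sliceD(4)[OF tr[OF h(1)] g that] .
    show "act g a \<in> A \<union> tr h \<longleftrightarrow> g \<in> L"
    proof
      assume "act g a \<in> A \<union> tr h"
      then consider "a \<in> A" "act g a \<in> A" | "a \<in> tr h" "act g a \<in> tr h"
        using a fit[of a] fit[of "act g a"] fa sliceD(2)[OF tr[OF h(1)]] by fastforce
      then show "g \<in> L"
        using iA iT by cases blast+
    qed (use a iA iT in blast)
  next
    fix x assume "x \<in> topspace X" "f x \<in> D \<union> E"
    then show "\<exists>g\<in>carrier G. act g x \<in> A \<union> tr h"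
      using sliceD(5)[OF A, of x] sliceD(5)[OF tr[OF h(1)], of x] by blast
  qed
  then show ?thesis
    by blast
qed

text \<open>A small neighbourhood of a point of the fibre meets its translate under \<open>g\<close> only if \<open>g\<close>
  stabilizes the point; saturating it by \<open>L\<close> gives the slice.\<close>

lemma local_slice:
  assumes L: "L \<lhd> G" and stab: "\<And>g x. \<lbrakk>g \<in> carrier G; x \<in> topspace X; act g x = x\<rbrakk> \<Longrightarrow> g \<in> L"
    and y: "y \<in> topspace sphere_top"
  shows "\<exists>D A. openin sphere_top D \<and> y \<in> D \<and> slice L D A"
proof -
  obtain x where x: "x \<in> topspace X" "f x = y"
    using y unfolding f_surj[symmetric] by blast
  have "\<exists>U. openin X U \<and> x \<in> U \<and> (\<forall>u\<in>U. act g u \<notin> U)" if g: "g \<in> carrier G" "act g x \<noteq> x" for g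
  proof -
    obtain M N where MN: "openin X M" "openin X N" "x \<in> M" "act g x \<in> N" "disjnt M N"
      using haus x g unfolding Hausdorff_space_def by (metis act_closed)
    let ?U = "M \<inter> {u \<in> topspace X. act g u \<in> N}"
    have "openin X ?U"
      using openin_continuous_map_preimage[OF act_cont[OF g(1)] MN(2)] MN(1) by blast
    then show ?thesis
      using MN x by (intro exI[of _ ?U]) (auto simp: disjnt_def)
  qed
  then obtain U where U: "\<And>g. \<lbrakk>g \<in> carrier G; act g x \<noteq> x\<rbrakk> \<Longrightarrow> openin X (U g) \<and> x \<in> U g \<and> (\<forall>u\<in>U g. act g u \<notin> U g)"
    by metis
  define V where "V = topspace X \<inter> \<Inter>(U ` {g \<in> carrier G. act g x \<noteq> x})"
  have V: "openin X V" "x \<in> V"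
    unfolding V_def using U fin x by (auto intro!: openin_Int_Inter)
  have move: "g \<in> L" if "g \<in> carrier G" "u \<in> V" "act g u \<in> V" for g u
  proof (rule ccontr)
    assume "g \<notin> L"
    then have "act g x \<noteq> x"
      using stab that x by blast
    then show False
      using U[OF that(1)] that by (auto simp: V_def)
  qed
  define A where "A = \<Union>((\<lambda>l. {u \<in> topspace X. act l u \<in> V}) ` L)"
  have LG: "L \<subseteq> carrier G" and subL: "subgroup L G"
    using L normal_imp_subgroup subgroup.subset by blast+
  have A_iff: "u \<in> A \<longleftrightarrow> u \<in> topspace X \<and> (\<exists>l\<in>L. act l u \<in> V)" for u
    by (auto simp: A_def)
  have "slice L (f ` V) A"
    unfolding slice_def
  proof (intro conjI ballI impI)
    show "openin X A"
      unfolding A_def using openin_continuous_map_preimage[OF act_cont V(1)] LG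
      by (intro openin_Union) auto
    show "f ` A \<subseteq> f ` V"
    proof
      fix z assume "z \<in> f ` A"
      then obtain u l where u: "u \<in> topspace X" "l \<in> L" "act l u \<in> V" "z = f u"
        by (auto simp: A_iff)
      then have "z = f (act l u)"
        using f_act LG by (metis subsetD)
      then show "z \<in> f ` V"
        using u by blast
    qed
    fix g a assume g: "g \<in> carrier G" and a: "a \<in> A"
    obtain l where l: "l \<in> L" "act l a \<in> V" and aX: "a \<in> topspace X"
      using a by (auto simp: A_iff)
    have lG: "l \<in> carrier G"
      using l LG by blast
    show "act g a \<in> A \<longleftrightarrow> g \<in> L"
    proof
      assume "act g a \<in> A"
      then obtain k where k: "k \<in> L" "act k (act g a) \<in> V"
        by (auto simp: A_iff)
      have kG: "k \<in> carrier G"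
        using k LG by blast
      have "act (k \<otimes> g \<otimes> inv l) (act l a) \<in> V"
        using k kG lG g aX by (simp add: act_mult)
      then have "k \<otimes> g \<otimes> inv l \<in> L"
        using move[of "k \<otimes> g \<otimes> inv l" "act l a"] l(2) kG lG g by simp
      then have "inv k \<otimes> (k \<otimes> g \<otimes> inv l) \<otimes> l \<in> L"
        using subL k l by (simp add: subgroup.m_closed subgroup.m_inv_closed)
      moreover have "inv k \<otimes> (k \<otimes> g \<otimes> inv l) \<otimes> l = g"
        using kG lG g by (simp add: m_assoc) (simp flip: m_assoc)
      ultimately show "g \<in> L"
        by simp
    next
      assume gL: "g \<in> L"
      have "act (l \<otimes> inv g) (act g a) = act l a"
        using g lG aX by (simp add: act_mult)
      moreover have "l \<otimes> inv g \<in> L"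
        using subL gL l by (simp add: subgroup.m_closed subgroup.m_inv_closed)
      ultimately show "act g a \<in> A"
        using l(2) g aX unfolding A_iff by (metis act_closed)
    qed
  next
    fix z assume z: "z \<in> topspace X" "f z \<in> f ` V"
    then obtain u where u: "u \<in> V" "f z = f u"
      by blast
    moreover have uX: "u \<in> topspace X"
      using u V openin_subset by blast
    ultimately obtain g where g: "g \<in> carrier G" "act g z = u"
      using f_fibre z by blast
    have "u \<in> A"
      using u uX subgroup.one_closed[OF subL] act_one unfolding A_iff by metis
    then show "\<exists>g\<in>carrier G. act g z \<in> A"
      using g by blast
  qed
  moreover have "openin sphere_top (f ` V)" "y \<in> f ` V"
    using f_open V x by (auto simp: open_map_def)
  ultimately show ?thesis
    by blast
qed

text \<open>Gluing along a disc and a neighbourhood of infinity produces a slice over the whole sphere.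
  Such a slice is open and closed in \<open>X\<close>, since its complement is a union of translates, so it is
  \<open>X\<close>, and then every group element preserves it.\<close>

theorem stabilizers_generate:
  assumes L: "L \<lhd> G" and stab: "\<And>g x. \<lbrakk>g \<in> carrier G; x \<in> topspace X; act g x = x\<rbrakk> \<Longrightarrow> g \<in> L"
  shows "L = carrier G"
proof -
  define sliced where "sliced D \<longleftrightarrow> openin sphere_top D \<and> (\<exists>A. slice L D A)" for D
  have sub: "sliced D'" if "sliced D" "openin sphere_top D'" "D' \<subseteq> D" for D D'
    using that slice_subset unfolding sliced_def by blast
  have un: "sliced (D \<union> E)" if "sliced D" "sliced E" "connectedin sphere_top (D \<inter> E)" for D E
    using that slice_union[OF L] unfolding sliced_def by blast
  have loc: "\<exists>D. sliced D \<and> y \<in> D" for y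
  proof -
    have "\<exists>D A. openin sphere_top D \<and> y \<in> D \<and> slice L D A"
    proof (rule local_slice[OF L])
      show "y \<in> topspace sphere_top"
        by (cases y) auto
    qed (rule stab)
    then obtain D A where D: "openin sphere_top D" "y \<in> D" "slice L D A"
      by (elim exE conjE)
    then have "sliced D"
      unfolding sliced_def by (intro conjI exI)
    then show ?thesis
      using D(2) by (intro exI conjI)
  qed
  have openS: "openin sphere_top (Some ` U) \<longleftrightarrow> open U" for U :: "complex set"
    by simp
  have connS: "connectedin sphere_top (Some ` U)" if "connected U" for U :: "complex set"
    by (rule connectedin_continuous_map_image[OF continuous_map_Some]) (simp add: that)
  have box: "sliced (Some ` box a b)" for a b
  proof (rule glue_over_box[where Q = "\<lambda>U. sliced (Some ` U)"])
    show "sliced (Some ` V)" if "sliced (Some ` U)" "open V" "V \<subseteq> U" for U V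
      using sub[OF that(1)] that by (simp add: image_mono)
    show "sliced (Some ` (U \<union> V))" if "sliced (Some ` U)" "sliced (Some ` V)" "connected (U \<inter> V)" for U V
    proof -
      have "Some ` U \<inter> Some ` V = Some ` (U \<inter> V)"
        by auto
      then show ?thesis
        using un[OF that(1,2)] connS[OF that(3)] by (simp add: image_Un)
    qed
    fix z
    obtain D where D: "sliced D" "Some z \<in> D"
      using loc by blast
    have "openin sphere_top D"
      using D by (simp add: sliced_def)
    then have "openin euclidean {w \<in> topspace euclidean. Some w \<in> D}"
      by (rule openin_continuous_map_preimage[OF continuous_map_Some])
    then have "open {w. Some w \<in> D}"
      by simp
    moreover have "sliced (Some ` {w. Some w \<in> D})"
      by (rule sub[OF D(1)]) (use calculation in auto)
    ultimately show "\<exists>U. open U \<and> z \<in> U \<and> sliced (Some ` U)"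
      using D(2) by blast
  qed
  obtain D where D: "sliced D" "None \<in> D"
    using loc by blast
  then have "openin sphere_top D"
    by (simp add: sliced_def)
  then obtain C where C: "compact C" "D = insert None (Some ` (UNIV - C))"
    using D(2) unfolding openin_Alexandroff_compactification by auto
  obtain M where M: "M > 0" "\<And>z. z \<in> C \<Longrightarrow> norm z \<le> M"
    using compact_imp_bounded[OF C(1)] unfolding bounded_pos by (elim exE conjE) auto
  \<comment> \<open>The overlap of the two pieces is an annulus, which is connected.\<close>
  define D1 where "D1 = insert None (Some ` (UNIV - cball (0::complex) M))"
  define D2 where "D2 = Some ` ball (0::complex) (M + 1)"
  have "openin sphere_top D1"
    unfolding D1_def openin_Alexandroff_compactification
    by (intro disjI2 exI[of _ "cball 0 M"]) auto
  then have s1: "sliced D1"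
    by (rule sub[OF D(1)]) (use C M in \<open>auto simp: D1_def\<close>)
  obtain a :: complex where "ball (0::complex) (M + 1) \<subseteq> box (- a) a"
    using bounded_subset_box_symmetric[OF bounded_ball] by blast
  then have s2: "sliced D2"
    unfolding D2_def using sub[OF box[of "- a" a]] by (simp add: image_mono)
  have "D1 \<inter> D2 = Some ` {z. M < norm z \<and> norm z < M + 1}"
    by (auto simp: D1_def D2_def)
  moreover have "connected {z :: complex. M < norm z \<and> norm z < M + 1}"
    using connected_annulus(1)[of M "0 :: complex" "M + 1"] by simp
  ultimately have "sliced (D1 \<union> D2)"
    using un[OF s1 s2] connS by simp
  moreover have "D1 \<union> D2 = UNIV"
  proof -
    have "y \<in> D1 \<union> D2" for y
      using M(1) by (cases y) (auto simp: D1_def D2_def)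
    then show ?thesis
      by blast
  qed
  ultimately obtain A where A: "slice L UNIV A"
    by (auto simp: sliced_def)
  have ne: "topspace X \<noteq> {}"
    using f_surj by auto
  have "openin X (topspace X - A)"
  proof (subst openin_subopen, intro ballI)
    fix x assume x: "x \<in> topspace X - A"
    then obtain g where g: "g \<in> carrier G" "act g x \<in> A"
      using sliceD(5)[OF A] by blast
    let ?N = "{z \<in> topspace X. act g z \<in> A}"
    have "inv g \<notin> L"
      using sliceD(4)[OF A, of "inv g" "act g x"] g x by simp
    then have "?N \<inter> A = {}"
      using sliceD(4)[OF A g(1)] g L normal_imp_subgroup subgroup.m_inv_closed by fastforce
    moreover have "openin X ?N"
      using openin_continuous_map_preimage[OF act_cont[OF g(1)] sliceD(1)[OF A]] .
    ultimately show "\<exists>T. openin X T \<and> x \<in> T \<and> T \<subseteq> topspace X - A"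
      using x g by (intro exI[of _ ?N]) auto
  qed
  then have "closedin X A"
    using sliceD(1)[OF A] by (simp add: closedin_def openin_subset)
  moreover have "A \<noteq> {}"
    using ne sliceD(5)[OF A] by blast
  ultimately have AX: "A = topspace X"
    using conn sliceD(1)[OF A] unfolding connected_space_clopen_in by blast
  have "g \<in> L" if "g \<in> carrier G" for g
    using sliceD(4)[OF A that] ne AX that by (metis act_closed ex_in_conv)
  then show ?thesis
    using L normal_imp_subgroup subgroup.subset by blast
qed

end

section \<open>Deck groups and their descent\<close>

lemma deck_carrier_iff:
  "t \<in> carrier (deck_group A f) \<longleftrightarrow>
     t \<in> Bij (points A) \<and> biholomorphic_map A A t \<and> (\<forall>a\<in>points A. f (t a) = f a)"
  by (simp add: deck_group_def)

lemma deck_one: "\<one>\<^bsub>deck_group A f\<^esub> = (\<lambda>x\<in>points A. x)"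
  by (simp add: deck_group_def BijGroup_def)

lemma deck_mult_eq:
  assumes "s \<in> carrier (deck_group A f)" "t \<in> carrier (deck_group A f)"
  shows "s \<otimes>\<^bsub>deck_group A f\<^esub> t = compose (points A) s t"
  using assms by (simp add: deck_group_def BijGroup_def)

lemma deckD:
  assumes "t \<in> carrier (deck_group A f)"
  shows deck_holomorphic: "holomorphic_map A A t"
    and deck_points: "a \<in> points A \<Longrightarrow> t a \<in> points A"
    and deck_over: "a \<in> points A \<Longrightarrow> f (t a) = f a"
    and deck_extensional: "t \<in> extensional (points A)"
proof -
  have t: "t \<in> Bij (points A)" "biholomorphic_map A A t" "\<forall>a\<in>points A. f (t a) = f a"
    using assms by (simp_all add: deck_carrier_iff)
  then show hol: "holomorphic_map A A t"
    by (simp add: biholomorphic_map_def)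
  show "a \<in> points A \<Longrightarrow> t a \<in> points A"
    by (rule holomorphic_map_points[OF hol])
  show "a \<in> points A \<Longrightarrow> f (t a) = f a"
    using t(3) by blast
  show "t \<in> extensional (points A)"
    by (rule Bij_imp_extensional[OF t(1)])
qed

lemma deck_eqI:
  assumes "s \<in> carrier (deck_group A f)" "t \<in> carrier (deck_group A f')"
    and "\<And>a. a \<in> points A \<Longrightarrow> s a = t a"
  shows "s = t"
  using extensionalityI[OF deck_extensional[OF assms(1)] deck_extensional[OF assms(2)] assms(3)] .

lemma deck_mult_apply:
  assumes "s \<in> carrier (deck_group A f)" "t \<in> carrier (deck_group A f)" "a \<in> points A"
  shows "(s \<otimes>\<^bsub>deck_group A f\<^esub> t) a = s (t a)"
  using assms by (simp add: deck_mult_eq compose_def)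

lemma deckI:
  assumes A: "riemann_surface A" and h: "holomorphic_map A A h" and k: "holomorphic_map A A k"
    and hk: "\<And>a. a \<in> points A \<Longrightarrow> h (k a) = a" and kh: "\<And>a. a \<in> points A \<Longrightarrow> k (h a) = a"
    and f: "\<And>a. a \<in> points A \<Longrightarrow> f (h a) = f a"
  shows "restrict h (points A) \<in> carrier (deck_group A f)"
proof -
  have hol: "holomorphic_map A A (restrict h (points A))"
    by (rule holomorphic_map_cong[OF A _ h]) simp
  have "bij_betw (restrict h (points A)) (points A) (points A)"
    using holomorphic_map_points[OF h] holomorphic_map_points[OF k] hk kh
    by (intro bij_betw_byWitness[where f' = k]) auto
  moreover have "biholomorphic_map A A (restrict h (points A))"
    unfolding biholomorphic_map_def
    using hol k holomorphic_map_points[OF k] hk kh by (intro conjI exI[of _ k]) auto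
  ultimately show ?thesis
    using f by (simp add: deck_carrier_iff Bij_def)
qed

lemma group_deck_group:
  assumes A: "riemann_surface A"
  shows "group (deck_group A f)"
proof (rule groupI)
  let ?G = "deck_group A f"
  show one: "\<one>\<^bsub>?G\<^esub> \<in> carrier ?G"
    unfolding deck_one by (rule deckI[OF A, of "\<lambda>x. x" "\<lambda>x. x"]) (auto intro: holomorphic_map_id[OF A])
  have inv: "\<exists>k. holomorphic_map A A k \<and> (\<forall>x\<in>points A. k (t x) = x) \<and> (\<forall>x\<in>points A. t (k x) = x)"
    if "t \<in> carrier ?G" for t
    using that by (auto simp: deck_carrier_iff biholomorphic_map_def)
  show closed: "x \<otimes>\<^bsub>?G\<^esub> y \<in> carrier ?G" if xy: "x \<in> carrier ?G" "y \<in> carrier ?G" for x y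
  proof -
    obtain k where k: "holomorphic_map A A k" "\<forall>z\<in>points A. k (x z) = z" "\<forall>z\<in>points A. x (k z) = z"
      using inv xy by blast
    obtain l where l: "holomorphic_map A A l" "\<forall>z\<in>points A. l (y z) = z" "\<forall>z\<in>points A. y (l z) = z"
      using inv xy by blast
    have "restrict (x \<circ> y) (points A) \<in> carrier ?G"
      by (rule deckI[OF A, of _ "l \<circ> k"])
        (use xy k l in \<open>auto intro!: holomorphic_map_compose[OF A A A]
          simp: deck_holomorphic deck_points deck_over holomorphic_map_points\<close>)
    moreover have "restrict (x \<circ> y) (points A) = x \<otimes>\<^bsub>?G\<^esub> y"
      using deck_mult_eq[OF xy] by (auto simp: compose_def)
    ultimately show ?thesis
      by simp
  qed
  show "x \<otimes>\<^bsub>?G\<^esub> y \<otimes>\<^bsub>?G\<^esub> z = x \<otimes>\<^bsub>?G\<^esub> (y \<otimes>\<^bsub>?G\<^esub> z)"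
    if "x \<in> carrier ?G" "y \<in> carrier ?G" "z \<in> carrier ?G" for x y z
    by (rule deck_eqI[of _ A f _ f]) (use that in \<open>simp_all add: closed deck_mult_apply deck_points\<close>)
  show "\<one>\<^bsub>?G\<^esub> \<otimes>\<^bsub>?G\<^esub> x = x" if "x \<in> carrier ?G" for x
    by (rule deck_eqI[of _ A f _ f])
      (use that one closed deck_points[OF that] in \<open>simp_all add: deck_mult_apply deck_one\<close>)
  show "\<exists>y\<in>carrier ?G. y \<otimes>\<^bsub>?G\<^esub> x = \<one>\<^bsub>?G\<^esub>" if x: "x \<in> carrier ?G" for x
  proof -
    obtain k where k: "holomorphic_map A A k" "\<forall>z\<in>points A. k (x z) = z" "\<forall>z\<in>points A. x (k z) = z"
      using inv x by blast
    have "f (k a) = f a" if "a \<in> points A" for a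
      using deck_over[OF x holomorphic_map_points[OF k(1) that]] k that by simp
    then have kG: "restrict k (points A) \<in> carrier ?G"
      by (intro deckI[OF A k(1) deck_holomorphic[OF x]]) (use k in auto)
    have "restrict k (points A) \<otimes>\<^bsub>?G\<^esub> x = \<one>\<^bsub>?G\<^esub>"
      by (rule deck_eqI[OF closed[OF kG x] one])
        (use k deck_points[OF x] in \<open>simp add: deck_mult_apply[OF kG x] deck_one\<close>)
    then show ?thesis
      using kG by blast
  qed
qed

lemma deck_inv_apply:
  assumes A: "riemann_surface A" and t: "t \<in> carrier (deck_group A f)" and a: "a \<in> points A"
  shows "(inv\<^bsub>deck_group A f\<^esub> t) (t a) = a" "t ((inv\<^bsub>deck_group A f\<^esub> t) a) = a"
proof -
  interpret group "deck_group A f"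
    by (rule group_deck_group[OF A])
  show "(inv\<^bsub>deck_group A f\<^esub> t) (t a) = a" "t ((inv\<^bsub>deck_group A f\<^esub> t) a) = a"
    using deck_mult_apply[of "inv\<^bsub>deck_group A f\<^esub> t" A f t a] deck_mult_apply[of t A f "inv\<^bsub>deck_group A f\<^esub> t" a] t a
    by (simp_all add: deck_one)
qed

definition locally_injective_at :: "'a surface \<Rightarrow> ('a \<Rightarrow> 'b) \<Rightarrow> 'a \<Rightarrow> bool" where
  "locally_injective_at A f a \<longleftrightarrow> (\<exists>N. open_in A N \<and> a \<in> N \<and> inj_on f N)"

text \<open>Both \<open>t\<close> and the identity are lifts of \<open>f\<close> through itself, and they agree at \<open>a\<close>.\<close>

lemma deck_fixed_point:
  assumes A: "riemann_surface A" and t: "t \<in> carrier (deck_group A f)"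
    and a: "a \<in> points A" "t a = a" "locally_injective_at A f a"
  shows "t = \<one>\<^bsub>deck_group A f\<^esub>"
proof -
  obtain N where N: "open_in A N" "a \<in> N" "inj_on f N"
    using a(3) by (auto simp: locally_injective_at_def)
  have "t x = x" if "x \<in> points A" for x
    using lifts_agree[OF A A deck_holomorphic[OF t] holomorphic_map_id[OF A], of f a N x] a N t that
    by (simp add: deck_over)
  then show ?thesis
    using deck_extensional[OF t] unfolding deck_one by (intro extensionalityI[of _ "points A"]) auto
qed

text \<open>Evaluation at a generic point embeds the group into a fibre.\<close>

lemma finite_deck_group:
  assumes A: "compact_riemann_surface A" and B: "riemann_surface B" and f: "holomorphic_map A B f"
    and nc: "\<not> f constant_on points A"
  shows "finite (carrier (deck_group A f))"
proof -
  have RA: "riemann_surface A"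
    using A by (simp add: compact_riemann_surface_def)
  interpret group "deck_group A f"
    by (rule group_deck_group[OF RA])
  have ne: "points A \<noteq> {}"
    using RA by (simp add: riemann_surface_def)
  obtain N a where N: "open_in A N" "a \<in> N" "N \<subseteq> points A" "inj_on f N"
    using locally_injective_somewhere[OF RA B f nc openin_topspace ne] .
  have a: "a \<in> points A"
    using N by blast
  have "inj_on (\<lambda>t. t a) (carrier (deck_group A f))"
  proof (rule inj_onI)
    fix s t assume st: "s \<in> carrier (deck_group A f)" "t \<in> carrier (deck_group A f)" "s a = t a"
    have "inv\<^bsub>deck_group A f\<^esub> s \<otimes>\<^bsub>deck_group A f\<^esub> t = \<one>\<^bsub>deck_group A f\<^esub>"
    proof (rule deck_fixed_point[OF RA _ a])
      show "(inv\<^bsub>deck_group A f\<^esub> s \<otimes>\<^bsub>deck_group A f\<^esub> t) a = a"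
        using st a deck_inv_apply(1)[OF RA st(1) a] by (simp add: deck_mult_apply)
      show "locally_injective_at A f a"
        using N by (auto simp: locally_injective_at_def)
    qed (use st in simp)
    moreover have "t = s \<otimes>\<^bsub>deck_group A f\<^esub> (inv\<^bsub>deck_group A f\<^esub> s \<otimes>\<^bsub>deck_group A f\<^esub> t)"
      using st by (simp flip: m_assoc)
    ultimately show "s = t"
      using st by simp
  qed
  moreover have "(\<lambda>t. t a) ` carrier (deck_group A f) \<subseteq> {b \<in> points A. f b = f a}"
    using a deck_points deck_over by auto
  ultimately show ?thesis
    using finite_fibres[OF A B f nc] by (meson finite_imageD finite_subset)
qed

text \<open>A deck transformation \<open>t\<close> of \<open>g \<circ> h\<close> permutes the fibres of \<open>h\<close> as soon as \<open>g\<close> is Galois: some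
  deck transformation \<open>\<sigma>\<close> of \<open>g\<close> satisfies \<open>h \<circ> t = \<sigma> \<circ> h\<close> at one generic point, and both sides
  are lifts of \<open>g \<circ> h\<close>.\<close>

locale descent =
  fixes A :: "'a surface" and B :: "'b surface" and C :: "'c surface" and h :: "'a \<Rightarrow> 'b" and g :: "'b \<Rightarrow> 'c"
  assumes A: "compact_riemann_surface A" and B: "compact_riemann_surface B" and C: "riemann_surface C"
    and h: "holomorphic_map A B h" and g: "holomorphic_map B C g"
    and nc: "\<not> (g \<circ> h) constant_on points A" and galois: "galois_map B g"
begin

abbreviation "upper \<equiv> deck_group A (g \<circ> h)"
abbreviation "lower \<equiv> deck_group B g"

lemma surfaces: "riemann_surface A" "riemann_surface B"
  using A B by (simp_all add: compact_riemann_surface_def)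

sublocale upper: group upper
  by (rule group_deck_group[OF surfaces(1)])

sublocale lower: group lower
  by (rule group_deck_group[OF surfaces(2)])

lemma h_nonconstant: "\<not> h constant_on points A"
proof
  assume "h constant_on points A"
  then have "(g \<circ> h) constant_on points A"
    unfolding constant_on_def by (metis comp_apply)
  then show False
    using nc by blast
qed

lemma h_surj: "h ` points A = points B"
  by (rule surj_of_nonconstant[OF A surfaces(2) h h_nonconstant])

lemma h_points [simp]: "a \<in> points A \<Longrightarrow> h a \<in> points B"
  by (rule holomorphic_map_points[OF h])

lemma generic_point: obtains a where "a \<in> points A" "locally_injective_at B g (h a)"
proof -
  have gh: "holomorphic_map A C (g \<circ> h)"
    by (rule holomorphic_map_compose[OF surfaces C h g])
  have ne: "points A \<noteq> {}"
    using surfaces(1) by (simp add: riemann_surface_def)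
  obtain N a where N: "open_in A N" "a \<in> N" "N \<subseteq> points A" "inj_on (g \<circ> h) N"
    using locally_injective_somewhere[OF surfaces(1) C gh nc openin_topspace ne] .
  have "open_in B (h ` N)"
    using holomorphic_map_open[OF surfaces h h_nonconstant] N(1) by (simp add: open_map_def)
  moreover have "inj_on g (h ` N)"
    using N(4) by (rule inj_on_imageI)
  ultimately show ?thesis
    using that[of a] N unfolding locally_injective_at_def by blast
qed

lemma descent_exists:
  assumes t: "t \<in> carrier upper"
  shows "\<exists>\<sigma>\<in>carrier lower. \<forall>a\<in>points A. h (t a) = \<sigma> (h a)"
proof -
  obtain a where a: "a \<in> points A" "locally_injective_at B g (h a)"
    by (rule generic_point)
  then obtain N where N: "open_in B N" "h a \<in> N" "inj_on g N"
    by (auto simp: locally_injective_at_def)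
  have ta: "t b \<in> points A" "g (h (t b)) = g (h b)" if "b \<in> points A" for b
    using deck_points[OF t that] deck_over[OF t that] by auto
  then obtain \<rho> where \<rho>: "\<rho> \<in> carrier lower" "\<rho> (h (t a)) = h a"
    using galois a(1) unfolding galois_map_def by (metis h_points)
  have fixed: "h b = (\<rho> \<circ> (h \<circ> t)) b" if b: "b \<in> points A" for b
  proof (rule lifts_agree[OF surfaces h _ _ a(1) _ N b])
    show "holomorphic_map A B (\<rho> \<circ> (h \<circ> t))"
      using surfaces h \<rho>(1) t by (intro holomorphic_map_compose[of A B B] holomorphic_map_compose[of A A B])
        (auto simp: deck_holomorphic)
    show "g (h x) = g ((\<rho> \<circ> (h \<circ> t)) x)" if "x \<in> points A" for x
      using deck_over[OF \<rho>(1), of "h (t x)"] ta[OF that] by simp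
  qed (use \<rho> in simp)
  have "h (t b) = (inv\<^bsub>lower\<^esub> \<rho>) (h b)" if "b \<in> points A" for b
  proof -
    have "h b = \<rho> (h (t b))"
      using fixed[OF that] by simp
    then show ?thesis
      using deck_inv_apply(1)[OF surfaces(2) \<rho>(1), of "h (t b)"] ta(1)[OF that] by (metis h_points)
  qed
  then show ?thesis
    using \<rho>(1) by blast
qed

definition descend :: "('a \<Rightarrow> 'a) \<Rightarrow> 'b \<Rightarrow> 'b" where
  "descend t = (SOME \<sigma>. \<sigma> \<in> carrier lower \<and> (\<forall>a\<in>points A. h (t a) = \<sigma> (h a)))"

lemma descend:
  assumes "t \<in> carrier upper"
  shows "descend t \<in> carrier lower" "a \<in> points A \<Longrightarrow> descend t (h a) = h (t a)"
proof -
  have "\<exists>\<sigma>. \<sigma> \<in> carrier lower \<and> (\<forall>a\<in>points A. h (t a) = \<sigma> (h a))"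
    using descent_exists[OF assms] by blast
  then have "descend t \<in> carrier lower \<and> (\<forall>a\<in>points A. h (t a) = descend t (h a))"
    unfolding descend_def by (rule someI_ex)
  then show "descend t \<in> carrier lower" "a \<in> points A \<Longrightarrow> descend t (h a) = h (t a)"
    by auto
qed

lemma descend_eqI:
  assumes "t \<in> carrier upper" "\<sigma> \<in> carrier lower" "\<And>a. a \<in> points A \<Longrightarrow> h (t a) = \<sigma> (h a)"
  shows "descend t = \<sigma>"
  using assms descend[OF assms(1)] h_surj by (intro deck_eqI[of _ B g _ g]) (auto simp flip: h_surj)

lemma descend_hom: "descend \<in> hom upper lower"
proof (rule homI)
  fix s t assume st: "s \<in> carrier upper" "t \<in> carrier upper"
  show "descend (s \<otimes>\<^bsub>upper\<^esub> t) = descend s \<otimes>\<^bsub>lower\<^esub> descend t"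
  proof (rule descend_eqI)
    fix a assume a: "a \<in> points A"
    then show "h ((s \<otimes>\<^bsub>upper\<^esub> t) a) = (descend s \<otimes>\<^bsub>lower\<^esub> descend t) (h a)"
      using deck_points[OF st(2) a] st by (simp add: deck_mult_apply descend)
  qed (use st descend in auto)
qed (rule descend)

lemma descend_eq_one_iff:
  assumes t: "t \<in> carrier upper"
  shows "descend t = \<one>\<^bsub>lower\<^esub> \<longleftrightarrow> (\<forall>a\<in>points A. h (t a) = h a)"
  using descend[OF t] descend_eqI[OF t lower.one_closed] by (auto simp: deck_one)

text \<open>Transitivity is asked for on a single fibre only, because for the upper half of a tower it
  is known only over points where the lower half is locally injective.\<close>

lemma descend_surj_on:
  assumes a: "a \<in> points A" "locally_injective_at B g (h a)"
    and trans: "\<And>b. \<lbrakk>b \<in> points A; g (h a) = g (h b)\<rbrakk> \<Longrightarrow> \<exists>t\<in>carrier upper. t a = b"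
    and \<sigma>: "\<sigma> \<in> carrier lower"
  shows "\<exists>t\<in>carrier upper. descend t = \<sigma>"
proof -
  obtain b where b: "b \<in> points A" "h b = \<sigma> (h a)"
    using deck_points[OF \<sigma>, of "h a"] a(1) h_surj by (metis h_points imageE)
  then have "g (h a) = g (h b)"
    using deck_over[OF \<sigma>, of "h a"] a(1) by simp
  then obtain t where t: "t \<in> carrier upper" "t a = b"
    using trans a b by blast
  have "inv\<^bsub>lower\<^esub> \<sigma> \<otimes>\<^bsub>lower\<^esub> descend t = \<one>\<^bsub>lower\<^esub>"
  proof (rule deck_fixed_point[OF surfaces(2) _ _ _ a(2)])
    show "(inv\<^bsub>lower\<^esub> \<sigma> \<otimes>\<^bsub>lower\<^esub> descend t) (h a) = h a"
      using descend[OF t(1)] \<sigma> a b t deck_inv_apply(1)[OF surfaces(2) \<sigma>, of "h a"]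
      by (simp add: deck_mult_apply)
  qed (use \<sigma> t descend a in auto)
  moreover have "descend t = \<sigma> \<otimes>\<^bsub>lower\<^esub> (inv\<^bsub>lower\<^esub> \<sigma> \<otimes>\<^bsub>lower\<^esub> descend t)"
    using \<sigma> descend(1)[OF t(1)] by (simp flip: lower.m_assoc)
  ultimately have "descend t = \<sigma>"
    using \<sigma> by simp
  then show ?thesis
    using t(1) by blast
qed

end

section \<open>Pulling back a complex structure along a local homeomorphism\<close>

definition lifted_surface :: "'w topology \<Rightarrow> 's surface \<Rightarrow> ('w \<Rightarrow> 's) \<Rightarrow> 'w surface" where
  "lifted_surface X S h =
     \<lparr>surf_top = X,
      charts = {(U, v \<circ> h) | U V v. openin X U \<and> inj_on h U \<and> h ` U \<subseteq> V \<and> (V, v) \<in> charts S}\<rparr>"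

locale local_homeomorphism =
  fixes X :: "'w topology" and S :: "'s surface" and h :: "'w \<Rightarrow> 's"
  assumes S: "riemann_surface S"
    and X: "topspace X \<noteq> {}" "connected_space X" "Hausdorff_space X"
    and cont: "continuous_map X (surf_top S) h" and opn: "open_map X (surf_top S) h"
    and locinj: "\<And>x. x \<in> topspace X \<Longrightarrow> \<exists>U. openin X U \<and> x \<in> U \<and> inj_on h U"
begin

abbreviation "W \<equiv> lifted_surface X S h"

lemma surf_top_W [simp]: "surf_top W = X"
  by (simp add: lifted_surface_def)

lemma chart_WE:
  assumes "(U, u) \<in> charts W"
  obtains V v where "u = v \<circ> h" "openin X U" "inj_on h U" "h ` U \<subseteq> V" "(V, v) \<in> charts S"
  using assms by (auto simp: lifted_surface_def)

lemma chart_W_at: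
  assumes x: "x \<in> topspace X"
  obtains U V v where "(U, v \<circ> h) \<in> charts W" "x \<in> U" "openin X U" "h ` U \<subseteq> V" "(V, v) \<in> charts S"
proof -
  obtain U where U: "openin X U" "x \<in> U" "inj_on h U"
    using locinj x by blast
  have hx: "h x \<in> points S"
    using continuous_map_funspace[OF cont] x by blast
  obtain V v where v: "(V, v) \<in> charts S" "h x \<in> V"
    using chart_at[OF S hx] .
  let ?U = "U \<inter> {y \<in> topspace X. h y \<in> V}"
  have "openin X ?U"
    using U(1) openin_continuous_map_preimage[OF cont chart_open[OF S v(1)]] by blast
  moreover have "inj_on h ?U"
    using U(3) by (rule inj_on_subset) blast
  moreover have "h ` ?U \<subseteq> V"
    by blast
  ultimately have "(?U, v \<circ> h) \<in> charts W"
    using v(1) unfolding lifted_surface_def by auto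
  moreover have "x \<in> ?U"
    using U(2) x v(2) by blast
  ultimately show ?thesis
    using that[of ?U v V] \<open>openin X ?U\<close> \<open>h ` ?U \<subseteq> V\<close> v(1) by blast
qed

lemma chart_W_inverse:
  assumes "inj_on h U" "h ` U \<subseteq> V" "(V, v) \<in> charts S" "x \<in> U"
  shows "inv_into U (v \<circ> h) (v (h x)) = x" "inv_into V v (v (h x)) = h x"
proof -
  have "inj_on (v \<circ> h) U"
    using assms chart_inj[OF S assms(3)] by (meson comp_inj_on inj_on_subset)
  then show "inv_into U (v \<circ> h) (v (h x)) = x"
    using inv_into_f_f[of "v \<circ> h" U x] assms(4) by simp
  show "inv_into V v (v (h x)) = h x"
    using chart_inverse[OF S assms(3)] assms(2,4) by blast
qed

lemma open_image: "openin X U \<Longrightarrow> open_in S (h ` U)"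
  using opn by (simp add: open_map_def)

lemma lifted_chart_homeomorphic:
  assumes U: "openin X U" "inj_on h U" "h ` U \<subseteq> V" and v: "(V, v) \<in> charts S"
  shows "homeomorphic_map (subtopology X U) (top_of_set (v ` h ` U)) (v \<circ> h)"
proof (rule homeomorphic_map_compose)
  have US: "U \<subseteq> topspace X" "h ` U \<subseteq> points S"
    using openin_subset[OF U(1)] openin_subset[OF open_image[OF U(1)]] .
  show "homeomorphic_map (subtopology X U) (subtopology (surf_top S) (h ` U)) h"
  proof (rule bijective_open_imp_homeomorphic_map)
    show "continuous_map (subtopology X U) (subtopology (surf_top S) (h ` U)) h"
      by (rule continuous_map_into_subtopology[OF continuous_map_from_subtopology[OF cont]]) auto
    show "open_map (subtopology X U) (subtopology (surf_top S) (h ` U)) h"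
      using U(1) open_image by (auto simp: open_map_def openin_open_subtopology)
  qed (use US U(2) in \<open>auto simp: Int_absorb1 Int_absorb2\<close>)
  have V: "V \<subseteq> points S"
    by (rule chart_subset[OF S v])
  have "homeomorphic_map (subtopology (subtopology (surf_top S) V) (h ` U))
      (subtopology (top_of_set (v ` V)) (v ` h ` U)) v"
    by (rule homeomorphic_map_subtopologies[OF chart_homeomorphic[OF S v]]) (use U(3) V in auto)
  moreover have "V \<inter> h ` U = h ` U" "v ` V \<inter> v ` h ` U = v ` h ` U"
    using U(3) by auto
  ultimately show "homeomorphic_map (subtopology (surf_top S) (h ` U)) (top_of_set (v ` h ` U)) v"
    by (simp add: subtopology_subtopology)
qed

lemma riemann_surface_lifted: "riemann_surface W"
  unfolding riemann_surface_def surf_top_W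
proof (intro conjI ballI)
  show "(\<Union>(U, u)\<in>charts W. U) = topspace X"
  proof
    show "(\<Union>(U, u)\<in>charts W. U) \<subseteq> topspace X"
      by (auto elim!: chart_WE dest!: openin_subset)
    show "topspace X \<subseteq> (\<Union>(U, u)\<in>charts W. U)"
    proof
      fix x assume "x \<in> topspace X"
      then obtain U V v where "(U, v \<circ> h) \<in> charts W" "x \<in> U"
        by (rule chart_W_at)
      then show "x \<in> (\<Union>(U, u)\<in>charts W. U)"
        by blast
    qed
  qed
  fix c assume "c \<in> charts W"
  then obtain U u where c: "c = (U, u)" "(U, u) \<in> charts W"
    by (cases c) auto
  obtain V v where v: "u = v \<circ> h" "openin X U" "inj_on h U" "h ` U \<subseteq> V" "(V, v) \<in> charts S"
    by (rule chart_WE[OF c(2)])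
  have "open (v ` h ` U)"
    by (rule chart_image_open[OF S v(5) open_image[OF v(2)] v(4)])
  then have op: "open (u ` U)"
    by (simp add: v(1) image_comp)
  have "homeomorphic_map (subtopology X U) (top_of_set (v ` h ` U)) (v \<circ> h)"
    by (rule lifted_chart_homeomorphic[OF v(2-5)])
  then have "homeomorphic_map (subtopology X U) (top_of_set (u ` U)) u"
    by (simp add: v(1) image_comp)
  then show "case c of (U, u) \<Rightarrow> openin X U \<and> open (u ` U) \<and>
      homeomorphic_map (subtopology X U) (top_of_set (u ` U)) u"
    using op v(2) by (simp add: c(1))
  have "(u' \<circ> inv_into U u) holomorphic_on u ` (U \<inter> U')" if c': "(U', u') \<in> charts W" for U' u'
  proof -
    obtain V' v' where v': "u' = v' \<circ> h" "openin X U'" "inj_on h U'" "h ` U' \<subseteq> V'" "(V', v') \<in> charts S"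
      by (rule chart_WE[OF c'])
    have "(v' \<circ> inv_into V v) holomorphic_on u ` (U \<inter> U')"
      by (rule holomorphic_on_subset[OF transition_holomorphic[OF S v(5) v'(5)]])
        (use v(1,4) v'(4) in auto)
    then show ?thesis
    proof (rule holomorphic_transform)
      fix z assume "z \<in> u ` (U \<inter> U')"
      then obtain x where x: "x \<in> U" "z = v (h x)"
        using v(1) by auto
      show "(v' \<circ> inv_into V v) z = (u' \<circ> inv_into U u) z"
        using chart_W_inverse[OF v(3-5) x(1)] by (simp add: v(1) v'(1) x(2))
    qed
  qed
  then show "case c of (U, u) \<Rightarrow> \<forall>(V, v)\<in>charts W. (v \<circ> inv_into U u) holomorphic_on u ` (U \<inter> V)"
    by (auto simp: c(1))
qed (rule X)+

lemma holomorphic_lifted: "holomorphic_map W S h"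
proof (rule holomorphic_map_localI[OF riemann_surface_lifted S])
  show "continuous_map (surf_top W) (surf_top S) h"
    using cont by simp
  fix x assume "x \<in> points W"
  then have "x \<in> topspace X"
    by simp
  then obtain U V v where u: "(U, v \<circ> h) \<in> charts W" "x \<in> U" "openin X U" "h ` U \<subseteq> V" "(V, v) \<in> charts S"
    by (rule chart_W_at)
  have U: "inj_on (v \<circ> h) U" "U \<subseteq> points W"
    using chartD[OF riemann_surface_lifted u(1)] by auto
  have "(v \<circ> h \<circ> inv_into U (v \<circ> h)) holomorphic_on (v \<circ> h) ` U"
  proof (rule holomorphic_transform[of "\<lambda>z. z"])
    show "z = (v \<circ> h \<circ> inv_into U (v \<circ> h)) z" if "z \<in> (v \<circ> h) ` U" for z
      using f_inv_into_f[OF that] by simp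
  qed (rule holomorphic_on_ident)
  then show "\<exists>U u V v Wa. (U, u) \<in> charts W \<and> (V, v) \<in> charts S \<and> open_in W Wa \<and> x \<in> Wa \<and> Wa \<subseteq> U \<and>
      h ` Wa \<subseteq> V \<and> (v \<circ> h \<circ> inv_into U u) holomorphic_on u ` Wa"
    using u surf_top_W by (metis order_refl)
qed

lemma unramified_lifted: "unramified W h"
  using locinj by (auto simp: unramified_def)

end

section \<open>Extensions of a cyclic group by an elementary abelian group\<close>

context group
begin

text \<open>In a minimal subfamily of the characters with trivial common kernel, every character is \<open>1\<close>
  on some element that all the others kill, and these elements form a basis.\<close>

lemma separated_by_characters_iso:
  fixes \<xi> :: "'i \<Rightarrow> 'a \<Rightarrow> int"
  assumes q: "prime q" and fin: "finite I"
    and hom: "\<And>i. i \<in> I \<Longrightarrow> \<xi> i \<in> hom G (integer_mod_group q)"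
    and sep: "\<And>x. \<lbrakk>x \<in> carrier G; \<And>i. i \<in> I \<Longrightarrow> \<xi> i x = 0\<rbrakk> \<Longrightarrow> x = \<one>"
  shows "\<exists>s\<le>card I. G \<cong> product_group {..<s} (\<lambda>_. integer_mod_group q)"
proof -
  have q0: "q > 0" "int q > 0"
    using q prime_gt_0_nat by auto
  define good where
    "good J \<longleftrightarrow> J \<subseteq> I \<and> (\<forall>x\<in>carrier G. (\<forall>i\<in>J. \<xi> i x = 0) \<longrightarrow> x = \<one>)" for J
  have "good I"
    using sep by (auto simp: good_def)
  then obtain J where J: "good J" and min: "\<And>J'. good J' \<Longrightarrow> card J \<le> card J'"
    using arg_min_natI[of good I card] arg_min_nat_le[of good _ card] by metis
  have JI: "J \<subseteq> I" and finJ: "finite J"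
    using J fin finite_subset by (auto simp: good_def)
  have homJ: "\<xi> i \<in> hom G (integer_mod_group q)" if "i \<in> J" for i
    using hom JI that by auto
  have mult: "\<xi> i (x \<otimes> y) = (\<xi> i x + \<xi> i y) mod int q"
    if "i \<in> J" "x \<in> carrier G" "y \<in> carrier G" for i x y
    using hom_mult[OF homJ] that by simp
  have range: "\<xi> i x \<in> {0..<int q}" if "i \<in> J" "x \<in> carrier G" for i x
    using hom_in_carrier[OF homJ] that q0 by (simp add: carrier_integer_mod_group)
  have pow: "\<xi> i (x [^] n) = (int n * \<xi> i x) mod int q"
    if "i \<in> J" "x \<in> carrier G" for i x and n :: nat
    using hom_nat_pow[OF homJ[OF that(1)] that(2)] by (simp add: is_group)
  have dual: "\<exists>e\<in>carrier G. \<xi> j e = 1 \<and> (\<forall>i\<in>J - {j}. \<xi> i e = 0)" if j: "j \<in> J" for j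
  proof -
    have "\<not> good (J - {j})"
      using min[of "J - {j}"] j finJ by (meson card_Diff1_less linorder_not_le)
    then obtain x where x: "x \<in> carrier G" "\<forall>i\<in>J - {j}. \<xi> i x = 0" "x \<noteq> \<one>"
      using JI by (auto simp: good_def)
    then have "\<xi> j x \<noteq> 0"
      using J by (auto simp: good_def)
    then have "\<not> int q dvd \<xi> j x"
      using range[OF j x(1)] zdvd_not_zless by fastforce
    then have "coprime (int q) (\<xi> j x)"
      using q by (intro prime_imp_coprime) auto
    then obtain m where m: "[\<xi> j x * m = 1] (mod int q)"
      using cong_solve_coprime_int coprime_commute by blast
    let ?n = "nat (m mod int q)"
    have "int ?n = m mod int q"
      using q0 by simp
    then have "\<xi> j (x [^] ?n) = ((m mod int q) * \<xi> j x) mod int q"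
      using pow[OF j x(1), of ?n] by (simp only:)
    also have "\<dots> = 1 mod int q"
      using m by (simp add: cong_def mult.commute mod_mult_left_eq mod_mult_right_eq)
    also have "\<dots> = 1"
      using q prime_gt_1_nat by simp
    finally show ?thesis
      using x pow by (intro bexI[of _ "x [^] ?n"]) auto
  qed
  have onto: "\<exists>x\<in>carrier G. \<forall>i\<in>J. \<xi> i x = (if i \<in> F then a i else 0)"
    if "finite F" "F \<subseteq> J" "\<And>i. i \<in> J \<Longrightarrow> a i \<in> {0..<int q}" for F a
    using that
  proof (induction F)
    case empty
    have "\<xi> i \<one> = 0" if "i \<in> J" for i
      using hom_one[OF homJ[OF that]] is_group by simp
    then show ?case
      by auto
  next
    case (insert j F)
    then obtain x where x: "x \<in> carrier G" "\<forall>i\<in>J. \<xi> i x = (if i \<in> F then a i else 0)"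
      by auto
    obtain e where e: "e \<in> carrier G" "\<xi> j e = 1" "\<forall>i\<in>J - {j}. \<xi> i e = 0"
      using dual[of j] insert.prems(1) by blast
    let ?y = "x \<otimes> e [^] nat (a j)"
    have "\<xi> i ?y = (if i \<in> insert j F then a i else 0)" if i: "i \<in> J" for i
    proof -
      have aj: "a j \<in> {0..<int q}" and ai: "a i \<in> {0..<int q}"
        using insert.prems i by auto
      have eq: "\<xi> i ?y = (\<xi> i x + (int (nat (a j)) * \<xi> i e) mod int q) mod int q"
        using mult[OF i] pow[OF i] x e by simp
      show ?thesis
      proof (cases "i = j")
        case True
        then show ?thesis
          using eq x e aj i insert.hyps by auto
      next
        case False
        then show ?thesis
          using eq x e ai i by auto
      qed
    qed
    then show ?case
      using x e by (intro bexI[of _ ?y]) auto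
  qed
  define s where "s = card J"
  obtain f where f: "bij_betw f {..<s} J"
    using finJ ex_bij_betw_nat_finite unfolding s_def lessThan_atLeast0 by blast
  have fJ: "f k \<in> J" if "k < s" for k
    using f that by (auto simp: bij_betw_def)
  let ?P = "product_group {..<s} (\<lambda>_. integer_mod_group q)"
  let ?\<Phi> = "\<lambda>x. \<lambda>k\<in>{..<s}. \<xi> (f k) x"
  have h: "?\<Phi> \<in> hom G ?P"
    using mult range fJ q0 by (intro homI) (auto simp: carrier_integer_mod_group)
  interpret \<Phi>: group_hom G ?P ?\<Phi>
    using h is_group by (simp add: group_hom_def group_hom_axioms_def)
  have "inj_on ?\<Phi> (carrier G)"
    unfolding \<Phi>.inj_on_one_iff
  proof (intro allI impI)
    fix x assume x: "x \<in> carrier G" and one: "?\<Phi> x = \<one>\<^bsub>?P\<^esub>"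
    have eq: "\<xi> (f k) x = 0" if "k < s" for k
      using that fun_cong[OF one, of k] by simp
    have "\<xi> i x = 0" if "i \<in> J" for i
      using eq that f by (metis bij_betw_def imageE lessThan_iff)
    then show "x = \<one>"
      using J x by (auto simp: good_def)
  qed
  moreover have "?\<Phi> ` carrier G = carrier ?P"
  proof
    show "carrier ?P \<subseteq> ?\<Phi> ` carrier G"
    proof
      fix a assume a: "a \<in> carrier ?P"
      let ?a = "\<lambda>i. a (inv_into {..<s} f i)"
      have inv: "inv_into {..<s} f i \<in> {..<s}" if "i \<in> J" for i
        using that f by (metis bij_betw_def inv_into_into)
      have "?a i \<in> {0..<int q}" if "i \<in> J" for i
        using inv[OF that] a q0 PiE_mem[of a "{..<s}" "\<lambda>_. {0..<int q}"]
        by (auto simp: carrier_integer_mod_group)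
      then obtain x where x: "x \<in> carrier G" "\<forall>i\<in>J. \<xi> i x = ?a i"
        using onto[of J ?a] finJ by auto
      have "?\<Phi> x = a"
      proof
        fix k show "?\<Phi> x k = a k"
        proof (cases "k < s")
          case True
          then show ?thesis
            using x fJ f by (simp add: bij_betw_def inv_into_f_f)
        next
          case False
          then show ?thesis
            using a by (auto simp: PiE_def extensional_def)
        qed
      qed
      then show "a \<in> ?\<Phi> ` carrier G"
        using x by blast
    qed
  qed (use h in \<open>auto simp: hom_def\<close>)
  ultimately have "?\<Phi> \<in> iso G ?P"
    using h by (simp add: iso_def bij_betw_def)
  then have "G \<cong> ?P"
    by (rule is_isoI)
  moreover have "s \<le> card I"
    using JI fin by (simp add: s_def card_mono)
  ultimately show ?thesis
    by blast
qed

end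

text \<open>The cycles of \<open>c\<close> away from the fixed point all have length \<open>p\<close>, because their lengths divide
  the prime \<open>p\<close> and no other point is fixed.\<close>

lemma card_cong_one_of_unique_fixed_point:
  fixes c :: "'a \<Rightarrow> 'a"
  assumes p: "prime p" and fin: "finite K" and cK: "\<And>x. x \<in> K \<Longrightarrow> c x \<in> K"
    and per: "\<And>x. x \<in> K \<Longrightarrow> (c ^^ p) x = x"
    and e: "e \<in> K" "c e = e" and fix_e: "\<And>x. \<lbrakk>x \<in> K; c x = x\<rbrakk> \<Longrightarrow> x = e"
  shows "[card K = 1] (mod p)"
proof -
  have p0: "p > 0"
    using p prime_gt_0_nat by simp
  have cn: "(c ^^ n) x \<in> K" if "x \<in> K" for n x
    using that cK by (induction n) auto
  have mult: "(c ^^ (p * m)) x = x" if "x \<in> K" for m x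
    using that per by (induction m) (auto simp: funpow_add algebra_simps)
  have modp: "(c ^^ n) x = (c ^^ (n mod p)) x" if "x \<in> K" for n x
  proof -
    have "(c ^^ n) x = (c ^^ (n mod p + p * (n div p))) x"
      by simp
    then show ?thesis
      using mult[OF that, of "n div p"] by (simp only: funpow_add comp_apply)
  qed
  \<comment> \<open>Lying on the same cycle; forward iterates suffice, as \<open>c\<close> is periodic.\<close>
  define r where "r = {(x, y). x \<in> K - {e} \<and> y \<in> K - {e} \<and> (\<exists>n. y = (c ^^ n) x)}"
  have symm: "\<exists>m. x = (c ^^ m) y" if "x \<in> K" "y = (c ^^ n) x" for x y n
  proof -
    have "(c ^^ (p * n - n)) y = (c ^^ (p * n)) x"
      using that p0 by (metis comp_apply funpow_add le_add_diff_inverse2 mult_le_mono1 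
          One_nat_def Suc_leI nat_mult_1)
    then show ?thesis
      using mult that by metis
  qed
  have eq: "equiv (K - {e}) r"
  proof (rule equivI)
    show "refl_on (K - {e}) r"
      by (auto simp: refl_on_def r_def intro: exI[of _ 0])
    show "sym r"
      using symm by (auto simp: sym_def r_def)
    show "trans r"
      by (auto simp: trans_def r_def) (metis comp_apply funpow_add)
    show "r \<subseteq> (K - {e}) \<times> (K - {e})"
      by (auto simp: r_def)
  qed
  have "p dvd card (K - {e})"
  proof (rule equiv_imp_dvd_card[OF _ eq])
    fix X assume "X \<in> (K - {e}) // r"
    then obtain x where x: "x \<in> K" "x \<noteq> e" and X: "X = r `` {x}"
      by (auto simp: quotient_def)
    have ne: "(c ^^ n) x \<noteq> e" for n
    proof
      assume "(c ^^ n) x = e"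
      then obtain m where "x = (c ^^ m) e"
        using symm[OF x(1), of e n] by auto
      moreover have "(c ^^ m) e = e" for m
        using e by (induction m) auto
      ultimately show False
        using x by auto
    qed
    have X': "X = (\<lambda>n. (c ^^ n) x) ` {..<p}"
      using x ne cn modp[OF x(1)] p0 unfolding X r_def
      by (auto simp: image_iff) (metis mod_less_divisor lessThan_iff)
    have "inj_on (\<lambda>n. (c ^^ n) x) {..<p}"
    proof (rule linorder_inj_onI)
      fix i j assume ij: "i < j" "i \<in> {..<p}" "j \<in> {..<p}"
      show "(c ^^ i) x \<noteq> (c ^^ j) x"
      proof
        assume a: "(c ^^ i) x = (c ^^ j) x"
        define d where "d = j - i"
        define y where "y = (c ^^ i) x"
        have "(c ^^ d) y = (c ^^ (d + i)) x"
          by (simp add: y_def funpow_add)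
        then have y: "y \<in> K" "(c ^^ d) y = y"
          using cn x a ij by (auto simp: y_def d_def)
        have d: "(c ^^ (d * m)) y = y" for m
          using y by (induction m) (auto simp: funpow_add)
        have "coprime d p"
          using p ij unfolding d_def
          by (intro prime_imp_coprime[THEN coprime_commute[THEN iffD1]]) (auto dest: dvd_imp_le)
        then obtain m where m: "[d * m = 1] (mod p)"
          using cong_solve_coprime_nat by auto
        have "c y = y"
          using d[of m] modp[OF y(1), of "d * m"] modp[OF y(1), of 1] m
          by (simp add: cong_def)
        then show False
          using fix_e y ne unfolding y_def by blast
      qed
    qed auto
    then show "p dvd card X"
      by (simp add: X' card_image)
  qed (use fin in auto)
  moreover have "card K = Suc (card (K - {e}))"
    using e fin card.remove by metis
  ultimately show ?thesis
    by (auto simp: cong_def mod_Suc dvd_eq_mod_eq_0)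
qed


text \<open>The model is the deck group \<open>G\<close> of a tower \<open>Z \<rightarrow> Y \<rightarrow> S \<rightarrow> \<complex>P\<^sup>1\<close>: \<open>K\<close> consists of the deck
  transformations over \<open>S\<close>, \<open>\<xi>\<close> is the character of \<open>K\<close> with kernel the deck transformations over
  \<open>Y\<close>, and \<open>T\<close> is the set of elements with a fixed point.\<close>

locale faithful_tower_group = group G for G (structure) +
  fixes p q :: nat and \<theta> \<xi> :: "'a \<Rightarrow> int" and T K :: "'a set"
  defines "K \<equiv> kernel G (integer_mod_group p) \<theta>"
  assumes p: "prime p" and q: "prime q" and pq: "q \<noteq> p"
    and \<theta>: "\<theta> \<in> hom G (integer_mod_group p)" "\<exists>g\<in>carrier G. \<theta> g \<noteq> 0"
    and \<xi>: "\<xi> \<in> hom (G\<lparr>carrier := K\<rparr>) (integer_mod_group q)" "\<exists>k\<in>K. \<xi> k \<noteq> 0"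
    and core: "\<And>k. \<lbrakk>k \<in> K; \<And>g. g \<in> carrier G \<Longrightarrow> \<xi> (g \<otimes> k \<otimes> inv g) = 0\<rbrakk> \<Longrightarrow> k = \<one>"
    and T: "T \<subseteq> carrier G" "\<And>t n. t \<in> T \<Longrightarrow> t [^] (n::nat) \<in> T" "T \<inter> K \<subseteq> {\<one>}"
    and generating: "\<And>L. \<lbrakk>L \<lhd> G; T \<subseteq> L\<rbrakk> \<Longrightarrow> L = carrier G"
begin

lemma pq_pos: "p > 0" "int p > 0" "q > 0" "int q > 0" "p > 1"
  using p q prime_gt_0_nat prime_gt_1_nat by auto

sublocale \<theta>: group_hom G "integer_mod_group p" \<theta>
  using \<theta> is_group by (simp add: group_hom_def group_hom_axioms_def)

lemma \<theta>_mult: "x \<in> carrier G \<Longrightarrow> y \<in> carrier G \<Longrightarrow> \<theta> (x \<otimes> y) = (\<theta> x + \<theta> y) mod int p"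
  by simp

lemma \<theta>_range: "x \<in> carrier G \<Longrightarrow> \<theta> x \<in> {0..<int p}"
  using \<theta>.hom_closed pq_pos by (simp add: carrier_integer_mod_group)

lemma \<theta>_pow: "x \<in> carrier G \<Longrightarrow> \<theta> (x [^] (n::nat)) = (int n * \<theta> x) mod int p"
  using hom_nat_pow[OF \<theta>.homh, of x n] is_group by simp

lemma in_K: "x \<in> K \<longleftrightarrow> x \<in> carrier G \<and> \<theta> x = 0"
  by (simp add: K_def kernel_def)

lemma K_normal: "K \<lhd> G"
  unfolding K_def by (rule \<theta>.normal_kernel)

sublocale K: group "G\<lparr>carrier := K\<rparr>"
  using K_normal normal_imp_subgroup subgroup_imp_group by blast

lemma K_carrier [simp]: "x \<in> K \<Longrightarrow> x \<in> carrier G"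
  by (simp add: in_K)

lemma K_closed: "x \<in> K \<Longrightarrow> y \<in> K \<Longrightarrow> x \<otimes> y \<in> K" "\<one> \<in> K" "x \<in> K \<Longrightarrow> inv x \<in> K"
  "x \<in> K \<Longrightarrow> x [^] (n::nat) \<in> K"
  by (auto simp: in_K \<theta>_pow pq_pos)

lemma K_conj: "g \<in> carrier G \<Longrightarrow> x \<in> K \<Longrightarrow> g \<otimes> x \<otimes> inv g \<in> K"
  by (rule normal.inv_op_closed2[OF K_normal])

lemma \<xi>_mult: "x \<in> K \<Longrightarrow> y \<in> K \<Longrightarrow> \<xi> (x \<otimes> y) = (\<xi> x + \<xi> y) mod int q"
  using hom_mult[OF \<xi>(1)] by simp

lemma \<xi>_range: "x \<in> K \<Longrightarrow> \<xi> x \<in> {0..<int q}"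
  using hom_in_carrier[OF \<xi>(1)] pq_pos by (simp add: carrier_integer_mod_group)

lemma \<xi>_one: "\<xi> \<one> = 0"
  using hom_one[OF \<xi>(1)] K.is_group by simp

lemma conj_mult:
  assumes "g \<in> carrier G" "x \<in> carrier G" "y \<in> carrier G"
  shows "g \<otimes> (x \<otimes> y) \<otimes> inv g = (g \<otimes> x \<otimes> inv g) \<otimes> (g \<otimes> y \<otimes> inv g)"
proof -
  have "inv g \<otimes> (g \<otimes> (y \<otimes> inv g)) = y \<otimes> inv g"
    using assms by (simp flip: m_assoc)
  then show ?thesis
    using assms by (simp add: m_assoc)
qed

lemma K_eqI:
  assumes "x \<in> K" "y \<in> K"
    and eq: "\<And>g. g \<in> carrier G \<Longrightarrow> \<xi> (g \<otimes> x \<otimes> inv g) = \<xi> (g \<otimes> y \<otimes> inv g)"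
  shows "x = y"
proof -
  have "x \<otimes> inv y = \<one>"
  proof (rule core)
    fix g assume g: "g \<in> carrier G"
    have "\<xi> (g \<otimes> (x \<otimes> inv y) \<otimes> inv g) = (\<xi> (g \<otimes> y \<otimes> inv g) + \<xi> (g \<otimes> inv y \<otimes> inv g)) mod int q"
      using assms g by (simp add: conj_mult \<xi>_mult K_conj K_closed)
    also have "\<dots> = \<xi> (g \<otimes> (y \<otimes> inv y) \<otimes> inv g)"
      using assms(1,2) g by (simp only: conj_mult \<xi>_mult K_conj K_closed K_carrier inv_closed)
    also have "\<dots> = 0"
      using assms g by (simp add: \<xi>_one)
    finally show "\<xi> (g \<otimes> (x \<otimes> inv y) \<otimes> inv g) = 0" .
  qed (use assms K_closed in auto)
  then show ?thesis
    using assms by (metis K_carrier inv_closed inv_equality inv_inv)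
qed

text \<open>The next two facts hold since the conjugates of \<open>\<xi>\<close> embed \<open>K\<close> into a power of \<open>\<int>/q\<close>.\<close>

lemma K_comm: "x \<in> K \<Longrightarrow> y \<in> K \<Longrightarrow> x \<otimes> y = y \<otimes> x"
  by (rule K_eqI) (simp_all add: conj_mult \<xi>_mult K_conj K_closed add.commute)

lemma K_pow_q: "x \<in> K \<Longrightarrow> x [^] q = \<one>"
proof (rule K_eqI)
  fix g assume x: "x \<in> K" and g: "g \<in> carrier G"
  have "\<xi> (g \<otimes> x [^] n \<otimes> inv g) = (int n * \<xi> (g \<otimes> x \<otimes> inv g)) mod int q" for n :: nat
    by (induction n)
      (use x g in \<open>simp_all add: conj_mult \<xi>_mult \<xi>_one K_conj K_closed mod_simps algebra_simps\<close>)
  then show "\<xi> (g \<otimes> x [^] q \<otimes> inv g) = \<xi> (g \<otimes> \<one> \<otimes> inv g)"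
    using g by (simp add: \<xi>_one)
qed (use K_closed in auto)

lemma K_pow_p_trivial: "x \<in> K \<Longrightarrow> x [^] p = \<one> \<Longrightarrow> x = \<one>"
proof -
  assume x: "x \<in> K" "x [^] p = \<one>"
  have "coprime p q"
    using p q pq primes_coprime by blast
  then obtain m where m: "[p * m = 1] (mod q)"
    using cong_solve_coprime_nat by auto
  then have "(p * m) mod q = 1"
    using prime_gt_1_nat[OF q] by (simp add: cong_def)
  then obtain d where e: "p * m = q * d + 1"
    by (metis mult_div_mod_eq)
  have "x [^] (p * m) = \<one>"
    using x by (simp flip: nat_pow_pow)
  moreover have "x [^] (q * d + 1) = x [^] (q * d) \<otimes> x"
    using x by (simp flip: nat_pow_mult)
  moreover have "x [^] (q * d) = \<one>"
    using x by (simp add: K_pow_q flip: nat_pow_pow)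
  ultimately show "x = \<one>"
    using x e by simp
qed

text \<open>This replaces Cauchy's theorem: \<open>t\<^sup>p\<close> lies in \<open>T \<inter> K\<close>, which is trivial. A power of an element
  of \<open>T\<close> outside \<open>K\<close> then generates a complement of \<open>K\<close>.\<close>

lemma T_pow_p: "t \<in> T \<Longrightarrow> t [^] p = \<one>"
proof -
  assume t: "t \<in> T"
  then have "t \<in> carrier G"
    using T(1) by blast
  then have "t [^] p \<in> K"
    by (simp add: in_K \<theta>_pow)
  then show ?thesis
    using T(2)[OF t, of p] T(3) by blast
qed

lemma obtain_\<tau>:
  obtains \<tau> where "\<tau> \<in> carrier G" "\<theta> \<tau> = 1" "\<tau> [^] p = \<one>"
proof -
  have "\<not> T \<subseteq> K"
    using generating[OF K_normal] \<theta>(2) in_K by auto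
  then obtain t where t: "t \<in> T" "\<theta> t \<noteq> 0"
    using T(1) in_K by blast
  then have tG: "t \<in> carrier G"
    using T(1) by blast
  have "\<not> int p dvd \<theta> t"
    using \<theta>_range[OF tG] t(2) zdvd_not_zless[of "\<theta> t" "int p"] by auto
  then have "coprime (int p) (\<theta> t)"
    using p by (intro prime_imp_coprime) auto
  then obtain m where m: "[\<theta> t * m = 1] (mod int p)"
    using cong_solve_coprime_int coprime_commute by blast
  let ?n = "nat (m mod int p)"
  have "int ?n = m mod int p"
    using pq_pos by simp
  then have "\<theta> (t [^] ?n) = ((m mod int p) * \<theta> t) mod int p"
    using \<theta>_pow[OF tG, of ?n] by (simp only:)
  also have "\<dots> = 1 mod int p"
    using m by (simp add: cong_def mult.commute mod_mult_left_eq mod_mult_right_eq)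
  also have "\<dots> = 1"
    using pq_pos by simp
  finally show ?thesis
    using that[of "t [^] ?n"] tG T_pow_p[OF T(2)[OF t(1)]] by simp
qed

definition \<tau> :: 'a where
  "\<tau> = (SOME t. t \<in> carrier G \<and> \<theta> t = 1 \<and> t [^] p = \<one>)"

lemma \<tau>: "\<tau> \<in> carrier G" "\<theta> \<tau> = 1" "\<tau> [^] p = \<one>"
proof -
  have "\<exists>t. t \<in> carrier G \<and> \<theta> t = 1 \<and> t [^] p = \<one>"
    using obtain_\<tau> by metis
  then have "\<tau> \<in> carrier G \<and> \<theta> \<tau> = 1 \<and> \<tau> [^] p = \<one>"
    unfolding \<tau>_def by (rule someI_ex)
  then show "\<tau> \<in> carrier G" "\<theta> \<tau> = 1" "\<tau> [^] p = \<one>"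
    by auto
qed

lemma \<tau>_pow_mod: "\<tau> [^] n = \<tau> [^] (n mod p)" for n :: nat
proof -
  have "\<tau> [^] n = \<tau> [^] (p * (n div p)) \<otimes> \<tau> [^] (n mod p)"
    using \<tau> by (simp add: nat_pow_mult)
  also have "\<tau> [^] (p * (n div p)) = \<one>"
    using \<tau> by (simp flip: nat_pow_pow)
  finally show ?thesis
    using \<tau> by simp
qed

definition twist :: "nat \<Rightarrow> 'a \<Rightarrow> 'a" where
  "twist n x = \<tau> [^] n \<otimes> x \<otimes> inv (\<tau> [^] n)"

lemma twist_closed: "x \<in> carrier G \<Longrightarrow> twist n x \<in> carrier G" "x \<in> K \<Longrightarrow> twist n x \<in> K"
  using \<tau> by (simp_all add: twist_def K_conj)

lemma twist_mult:
  "x \<in> carrier G \<Longrightarrow> y \<in> carrier G \<Longrightarrow> twist n (x \<otimes> y) = twist n x \<otimes> twist n y"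
  using \<tau> by (simp add: twist_def conj_mult)

lemma twist_0: "x \<in> carrier G \<Longrightarrow> twist 0 x = x"
  by (simp add: twist_def)

lemma twist_p: "x \<in> carrier G \<Longrightarrow> twist p x = x"
  using \<tau> by (simp add: twist_def)

lemma twist_twist: "x \<in> carrier G \<Longrightarrow> twist m (twist n x) = twist (m + n) x"
  using \<tau> by (simp add: twist_def inv_mult_group m_assoc flip: nat_pow_mult)

text \<open>With \<open>n = p\<close> this is the norm of the action of \<open>\<langle>\<tau>\<rangle>\<close> on \<open>K\<close>, which is also
  \<open>(x \<tau>)\<^sup>p\<close>.\<close>

fun norm_upto :: "nat \<Rightarrow> 'a \<Rightarrow> 'a" where
  "norm_upto 0 x = \<one>"
| "norm_upto (Suc n) x = norm_upto n x \<otimes> twist n x"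

lemma norm_closed: "x \<in> K \<Longrightarrow> norm_upto n x \<in> K"
  by (induction n) (auto simp: K_closed twist_closed)

lemma norm_mult: "x \<in> K \<Longrightarrow> y \<in> K \<Longrightarrow> norm_upto n (x \<otimes> y) = norm_upto n x \<otimes> norm_upto n y"
proof (induction n)
  case (Suc n)
  let ?a = "norm_upto n x" and ?b = "norm_upto n y" and ?c = "twist n x" and ?d = "twist n y"
  have K: "?a \<in> K" "?b \<in> K" "?c \<in> K" "?d \<in> K"
    using Suc.prems norm_closed twist_closed by auto
  have "?a \<otimes> ?b \<otimes> (?c \<otimes> ?d) = ?a \<otimes> (?b \<otimes> ?c) \<otimes> ?d"
    using K by (simp add: m_assoc)
  also have "?b \<otimes> ?c = ?c \<otimes> ?b"
    using K K_comm by blast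
  finally show ?case
    using Suc K by (simp add: twist_mult m_assoc)
qed simp

text \<open>The factors of the partial norm of \<open>\<tau> x \<tau>\<^sup>-\<^sup>1\<close> are those of \<open>x\<close> moved up by one; for \<open>n = p\<close> the
  shift is cyclic, which makes the norm invariant.\<close>

lemma norm_shift: "x \<in> K \<Longrightarrow> x \<otimes> norm_upto n (twist 1 x) = norm_upto n x \<otimes> twist n x"
proof (induction n)
  case 0
  then show ?case
    by (simp add: twist_0)
next
  case (Suc n)
  have "twist 1 x \<in> K"
    using Suc.prems twist_closed by blast
  then have "x \<otimes> norm_upto (Suc n) (twist 1 x) = (x \<otimes> norm_upto n (twist 1 x)) \<otimes> twist n (twist 1 x)"
    using Suc.prems by (simp add: m_assoc norm_closed twist_closed del: One_nat_def)
  then show ?case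
    using Suc by (simp add: twist_twist)
qed

lemma norm_twist:
  assumes "x \<in> K" shows "norm_upto p (twist n x) = norm_upto p x"
proof -
  have step: "norm_upto p (twist 1 x) = norm_upto p x" if x: "x \<in> K" for x
  proof -
    have "x \<otimes> norm_upto p (twist 1 x) = norm_upto p x \<otimes> x"
      using norm_shift[of x p] x by (simp add: twist_p)
    also have "\<dots> = x \<otimes> norm_upto p x"
      using K_comm norm_closed x by blast
    finally show ?thesis
      using x by (simp add: norm_closed twist_closed)
  qed
  show ?thesis
  proof (induction n)
    case 0
    then show ?case
      using assms by (simp add: twist_0)
  next
    case (Suc n)
    then show ?case
      using step[of "twist n x"] assms by (simp add: twist_twist twist_closed)
  qed
qed

text \<open>The component in \<open>K\<close> of \<open>g = k \<tau>\<^sup>i\<close>, where \<open>i = \<theta> g\<close> is taken in \<open>{0..<p}\<close>.\<close>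

definition offset :: "'a \<Rightarrow> 'a" where
  "offset g = g \<otimes> inv (\<tau> [^] nat (\<theta> g))"

lemma \<theta>_\<tau>_pow: "\<theta> (\<tau> [^] n) = int n mod int p" for n :: nat
  using \<tau> by (simp add: \<theta>_pow)

lemma offset_decomp: "g \<in> carrier G \<Longrightarrow> g = offset g \<otimes> \<tau> [^] nat (\<theta> g)"
  using \<tau> by (simp add: offset_def m_assoc)

lemma offset_in_K:
  assumes g: "g \<in> carrier G" shows "offset g \<in> K"
proof -
  have G: "offset g \<in> carrier G" "\<tau> [^] nat (\<theta> g) \<in> carrier G"
    using g \<tau> by (simp_all add: offset_def)
  have "\<theta> (\<tau> [^] nat (\<theta> g)) = \<theta> g"
    using g \<theta>_range[of g] \<theta>_\<tau>_pow[of "nat (\<theta> g)"] by simp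
  then have "\<theta> g = (\<theta> (offset g) + \<theta> g) mod int p"
    using \<theta>_mult[OF G] offset_decomp[OF g] by simp
  then have "(\<theta> (offset g) + \<theta> g) mod int p = (0 + \<theta> g) mod int p"
    using g \<theta>_range[of g] by simp
  then have "\<theta> (offset g) mod int p = 0"
    by (metis mod_0 cong_def cong_add_rcancel)
  then show ?thesis
    using G \<theta>_range[of "offset g"] by (simp add: in_K)
qed

lemma offset_mult:
  assumes "g \<in> carrier G" "h \<in> carrier G"
  shows "offset (g \<otimes> h) = offset g \<otimes> twist (nat (\<theta> g)) (offset h)"
proof -
  let ?a = "nat (\<theta> g)" and ?b = "nat (\<theta> h)"
  have "nat (\<theta> (g \<otimes> h)) = (?a + ?b) mod p"
    using assms \<theta>_range[of g] \<theta>_range[of h] by (simp add: nat_mod_distrib nat_add_distrib)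
  then have "\<tau> [^] nat (\<theta> (g \<otimes> h)) = \<tau> [^] ?a \<otimes> \<tau> [^] ?b"
    using \<tau>_pow_mod[of "?a + ?b"] \<tau> by (simp add: nat_pow_mult)
  moreover have "inv (\<tau> [^] ?a) \<otimes> (\<tau> [^] ?a \<otimes> (h \<otimes> (inv (\<tau> [^] ?b) \<otimes> inv (\<tau> [^] ?a))))
      = h \<otimes> (inv (\<tau> [^] ?b) \<otimes> inv (\<tau> [^] ?a))"
    using \<tau> assms by (simp flip: m_assoc)
  ultimately show ?thesis
    using assms \<tau> by (simp add: offset_def twist_def inv_mult_group m_assoc)
qed

text \<open>Writing \<open>g = k \<tau>\<^sup>i\<close>, the map \<open>g \<mapsto> norm k\<close> is a homomorphism into the \<open>q\<close>-group \<open>K\<close>, so it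
  kills the elements of \<open>T\<close>, whose order divides \<open>p\<close>. Hence it is trivial.\<close>

lemma norm_trivial: "x \<in> K \<Longrightarrow> norm_upto p x = \<one>"
proof -
  assume x: "x \<in> K"
  let ?\<nu> = "\<lambda>g. norm_upto p (offset g)"
  have "?\<nu> \<in> hom G G"
    by (rule homI) (simp_all add: offset_in_K norm_closed offset_mult norm_mult norm_twist twist_closed)
  then interpret \<nu>: group_hom G G ?\<nu>
    using is_group by (simp add: group_hom_def group_hom_axioms_def)
  have "T \<subseteq> kernel G G ?\<nu>"
  proof
    fix t assume t: "t \<in> T"
    then have tG: "t \<in> carrier G"
      using T(1) by blast
    have "?\<nu> t [^] p = ?\<nu> (t [^] p)"
      using hom_nat_pow[OF \<nu>.homh tG] is_group by simp
    also have "\<dots> = \<one>"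
      using t by (simp only: T_pow_p \<nu>.hom_one)
    finally have "?\<nu> t = \<one>"
      using K_pow_p_trivial norm_closed offset_in_K tG by blast
    then show "t \<in> kernel G G ?\<nu>"
      using tG by (simp add: kernel_def)
  qed
  then have "x \<in> kernel G G ?\<nu>"
    using generating[OF \<nu>.normal_kernel] x by simp
  moreover have "offset x = x"
    using x by (simp add: offset_def in_K)
  ultimately show ?thesis
    by (simp add: kernel_def)
qed

text \<open>The norm of an element commuting with \<open>\<tau>\<close> is its \<open>p\<close>-th power.\<close>

lemma fixed_imp_one: "x \<in> K \<Longrightarrow> twist 1 x = x \<Longrightarrow> x = \<one>"
proof -
  assume x: "x \<in> K" "twist 1 x = x"
  have tw: "twist n x = x" for n
  proof (induction n)
    case (Suc n)
    then show ?case
      using x twist_twist[of x 1 n] by simp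
  qed (use x in \<open>simp add: twist_0\<close>)
  have "norm_upto n x = x [^] n" for n
    by (induction n) (simp_all add: tw)
  then show "x = \<one>"
    using norm_trivial[OF x(1)] K_pow_p_trivial x(1) by simp
qed

text \<open>The trivial norm is a linear relation between the \<open>p\<close> twists of \<open>\<xi>\<close>. Dropping one of them
  costs nothing, and this is where the bound \<open>p - 1\<close> on the rank comes from.\<close>

lemma twisted_characters_separate:
  assumes x: "x \<in> K" and zero: "\<And>j. j < p - 1 \<Longrightarrow> \<xi> (twist j x) = 0"
  shows "x = \<one>"
proof (rule core)
  fix g assume g: "g \<in> carrier G"
  have norm0: "\<xi> (norm_upto n x) = 0" if "n \<le> p - 1" for n
    using that by (induction n) (simp_all add: \<xi>_one \<xi>_mult norm_closed twist_closed x zero)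
  \<comment> \<open>The last character vanishes too, since the sum of all \<open>p\<close> of them is \<open>\<xi>\<close> of the norm.\<close>
  have "norm_upto p x = norm_upto (p - 1) x \<otimes> twist (p - 1) x"
    using pq_pos norm_upto.simps(2)[of "p - 1" x] by simp
  then have "(\<xi> (norm_upto (p - 1) x) + \<xi> (twist (p - 1) x)) mod int q = 0"
    using \<xi>_mult[of "norm_upto (p - 1) x" "twist (p - 1) x"] norm_closed twist_closed x
    by (metis norm_trivial \<xi>_one)
  then have "\<xi> (twist (p - 1) x) = 0"
    using norm0[of "p - 1"] \<xi>_range[of "twist (p - 1) x"] twist_closed x by simp
  moreover have "nat (\<theta> g) < p"
    using \<theta>_range[OF g] pq_pos by (auto simp: nat_less_iff)
  ultimately have 1: "\<xi> (twist (nat (\<theta> g)) x) = 0"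
    using zero by (cases "nat (\<theta> g) = p - 1") auto
  have K: "offset g \<in> K" "twist (nat (\<theta> g)) x \<in> K"
    using g x offset_in_K twist_closed by auto
  have "g \<otimes> x \<otimes> inv g = offset g \<otimes> twist (nat (\<theta> g)) x \<otimes> inv (offset g)"
    by (subst (1 2) offset_decomp[OF g])
      (use g x \<tau> K in \<open>simp add: twist_def inv_mult_group m_assoc\<close>)
  also have "\<dots> = twist (nat (\<theta> g)) x"
    using K K_comm[OF K] by (simp add: m_assoc)
  finally show "\<xi> (g \<otimes> x \<otimes> inv g) = 0"
    using 1 by simp
qed (rule x)

definition P :: "'a set" where
  "P = range (\<lambda>i::nat. \<tau> [^] i)"

lemma P_subgroup: "subgroup P G"
proof (rule subgroupI)
  fix a assume "a \<in> P"
  then obtain i :: nat where i: "a = \<tau> [^] i"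
    by (auto simp: P_def)
  have "i * (p - 1) + i = p * i"
    using pq_pos by (metis Suc_diff_1 add.commute mult.commute mult_Suc_right)
  then have "\<tau> [^] (i * (p - 1)) \<otimes> \<tau> [^] i = \<tau> [^] (p * i)"
    using \<tau> by (simp add: nat_pow_mult)
  also have "\<dots> = \<one>"
    using \<tau> by (simp flip: nat_pow_pow)
  finally have "inv a = \<tau> [^] (i * (p - 1))"
    using \<tau> i by (metis inv_equality nat_pow_closed)
  then show "inv a \<in> P"
    by (simp add: P_def)
qed (use \<tau> in \<open>auto simp: P_def nat_pow_mult\<close>)

lemma P_iso: "G\<lparr>carrier := P\<rparr> \<cong> integer_mod_group p"
proof -
  have eq: "\<tau> [^] n = \<tau> [^] nat (\<theta> (\<tau> [^] n))" for n :: nat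
    using \<tau>_pow_mod[of n] by (simp add: \<theta>_\<tau>_pow nat_mod_distrib)
  have PG: "x \<in> carrier G" if "x \<in> P" for x
    using P_subgroup subgroup.mem_carrier that by metis
  then have "\<theta> \<in> hom (G\<lparr>carrier := P\<rparr>) (integer_mod_group p)"
    by (intro homI) (use hom_in_carrier[OF \<theta>(1)] in auto)
  moreover have "inj_on \<theta> P"
    using eq by (metis (no_types, lifting) P_def inj_onI imageE)
  moreover have "\<theta> ` P = {0..<int p}"
  proof
    show "\<theta> ` P \<subseteq> {0..<int p}"
      using PG \<theta>_range by blast
    show "{0..<int p} \<subseteq> \<theta> ` P"
    proof
      fix i assume i: "i \<in> {0..<int p}"
      then have "\<theta> (\<tau> [^] nat i) = i"
        using \<theta>_\<tau>_pow[of "nat i"] by simp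
      then show "i \<in> \<theta> ` P"
        by (metis P_def image_eqI rangeI)
    qed
  qed
  ultimately have "\<theta> \<in> iso (G\<lparr>carrier := P\<rparr>) (integer_mod_group p)"
    using pq_pos by (simp add: iso_def bij_betw_def carrier_integer_mod_group)
  then show ?thesis
    by (rule is_isoI)
qed

lemma K_inter_P: "K \<inter> P = {\<one>}"
proof -
  have "x = \<one>" if "x \<in> K" "x \<in> P" for x
  proof -
    obtain i :: nat where i: "x = \<tau> [^] i"
      using \<open>x \<in> P\<close> by (auto simp: P_def)
    then have "i mod p = 0"
      using \<open>x \<in> K\<close> by (simp add: in_K \<theta>_\<tau>_pow flip: of_nat_mod)
    then show ?thesis
      using \<tau>_pow_mod[of i] i by simp
  qed
  moreover have "\<one> \<in> P"
    using P_subgroup subgroup.one_closed by blast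
  ultimately show ?thesis
    using K_closed by blast
qed

lemma K_mult_P: "K <#> P = carrier G"
proof
  show "K <#> P \<subseteq> carrier G"
    using P_subgroup subgroup.mem_carrier by (fastforce simp: set_mult_def)
  show "carrier G \<subseteq> K <#> P"
    using offset_decomp offset_in_K by (fastforce simp: set_mult_def P_def)
qed

text \<open>The rank is bounded by the number of separating characters, and the congruence counts the
  orbits of \<open>\<tau>\<close> on \<open>K\<close>, of which only \<open>{\<one>}\<close> has length one.\<close>

theorem elementary_abelian_semidirect_cyclic:
  "\<exists>s\<in>{1..p - 1}. [q ^ s = 1] (mod p) \<and> internal_semidirect_product G K P \<and>
     G\<lparr>carrier := K\<rparr> \<cong> product_group {..<s} (\<lambda>_. integer_mod_group q) \<and>
     G\<lparr>carrier := P\<rparr> \<cong> integer_mod_group p"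
proof -
  let ?K = "G\<lparr>carrier := K\<rparr>"
  have "\<exists>s\<le>card {..<p - 1}. ?K \<cong> product_group {..<s} (\<lambda>_. integer_mod_group q)"
  proof (rule K.separated_by_characters_iso[where \<xi> = "\<lambda>j x. \<xi> (twist j x)"])
    show "(\<lambda>x. \<xi> (twist i x)) \<in> hom ?K (integer_mod_group q)" for i
      using hom_in_carrier[OF \<xi>(1)]
      by (intro homI) (simp_all add: twist_mult \<xi>_mult twist_closed)
  qed (use q twisted_characters_separate in auto)
  then obtain s where s: "s \<le> p - 1" and iso: "?K \<cong> product_group {..<s} (\<lambda>_. integer_mod_group q)"
    by auto
  then obtain \<Phi> where "bij_betw \<Phi> K (\<Pi>\<^sub>E i\<in>{..<s}. {0..<int q})"
    using pq_pos by (auto simp: is_iso_def iso_def carrier_integer_mod_group)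
  moreover have "card (\<Pi>\<^sub>E i\<in>{..<s}. {0..<int q}) = q ^ s"
    by (simp add: card_PiE)
  ultimately have card: "card K = q ^ s" "finite K"
    by (auto simp: bij_betw_same_card bij_betw_finite intro: finite_PiE)
  have "s \<noteq> 0"
  proof
    assume "s = 0"
    then have "card K = 1"
      using card by simp
    then obtain y where "K = {y}"
      using card_1_singletonE by blast
    then show False
      using \<xi>(2) \<xi>_one K_closed(2) by auto
  qed
  moreover have "[q ^ s = 1] (mod p)"
    unfolding card(1)[symmetric]
  proof (rule card_cong_one_of_unique_fixed_point[OF p card(2), of "twist 1" \<one>])
    show "(twist 1 ^^ p) x = x" if x: "x \<in> K" for x
    proof -
      have "(twist 1 ^^ n) x = twist n x" for n
        by (induction n) (use x in \<open>simp_all add: twist_0 twist_twist\<close>)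
      then show ?thesis
        using x by (simp add: twist_p)
    qed
    show "twist 1 \<one> = \<one>"
      using \<tau> by (simp add: twist_def)
  qed (auto simp: twist_closed K_closed intro: fixed_imp_one)
  ultimately have "s \<in> {1..p - 1}" "[q ^ s = 1] (mod p)"
    using s by auto
  then show ?thesis
    using iso P_iso P_subgroup K_normal K_inter_P K_mult_P
    unfolding internal_semidirect_product_def by blast
qed

end

section \<open>Galois towers over the sphere\<close>

lemma surf_top_projective_line [simp]: "surf_top projective_line = sphere_top"
  by (simp add: projective_line_def)

lemma riemann_surface_projective_line: "riemann_surface projective_line"
  using compact_riemann_surface_projective_line by (simp add: compact_riemann_surface_def)

lemma iso_integer_mod_group_eq_0_iff:
  assumes "group H" "\<alpha> \<in> iso H (integer_mod_group n)" "x \<in> carrier H"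
  shows "\<alpha> x = 0 \<longleftrightarrow> x = \<one>\<^bsub>H\<^esub>"
proof -
  have "\<alpha> \<one>\<^bsub>H\<^esub> = 0"
    using hom_one[of \<alpha> H "integer_mod_group n"] assms by (simp add: iso_def)
  moreover have "inj_on \<alpha> (carrier H)" "\<one>\<^bsub>H\<^esub> \<in> carrier H"
    using assms by (auto simp: iso_def bij_betw_def group.is_monoid monoid.one_closed)
  ultimately show ?thesis
    using assms(3) by (metis inj_onD)
qed

lemma iso_integer_mod_group_onto_1:
  assumes "\<alpha> \<in> iso H (integer_mod_group n)" "n > 1"
  obtains x where "x \<in> carrier H" "\<alpha> x = 1"
proof -
  have "1 \<in> \<alpha> ` carrier H"
    using assms by (auto simp: iso_def bij_betw_def carrier_integer_mod_group)
  then show ?thesis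
    using that by (metis imageE)
qed

lemma deck_pow_fixed_point:
  assumes A: "riemann_surface A" and t: "t \<in> carrier (deck_group A f)" and a: "a \<in> points A" "t a = a"
  shows "(t [^]\<^bsub>deck_group A f\<^esub> (n::nat)) a = a"
proof -
  interpret group "deck_group A f"
    by (rule group_deck_group[OF A])
  show ?thesis
    by (induction n) (use t a in \<open>simp_all add: deck_one deck_mult_apply\<close>)
qed

text \<open>Minimality of \<open>Z\<close> is left to the theorems that use it, so that \<open>Z = Y\<close> with \<open>\<pi>\<close> the
  identity is an instance whenever \<open>\<phi> \<circ> \<psi>\<close> is Galois.\<close>

locale galois_tower =
  fixes Z :: "'z surface" and Y :: "'y surface" and S :: "'s surface"
    and \<pi> :: "'z \<Rightarrow> 'y" and \<psi> :: "'y \<Rightarrow> 's" and \<phi> :: "'s \<Rightarrow> complex option"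
  assumes Z: "compact_riemann_surface Z" and Y: "compact_riemann_surface Y" and S: "compact_riemann_surface S"
    and \<pi>: "holomorphic_map Z Y \<pi>" and \<psi>: "holomorphic_map Y S \<psi>" and \<phi>: "holomorphic_map S projective_line \<phi>"
    and nc: "\<not> (\<phi> \<circ> (\<psi> \<circ> \<pi>)) constant_on points Z"
    and etale: "unramified Y \<psi>" and galois_\<psi>: "galois_map Y \<psi>" and galois_\<phi>: "galois_map S \<phi>"
    and galois: "galois_map Z (\<phi> \<circ> (\<psi> \<circ> \<pi>))"
begin

lemma surfaces: "riemann_surface Z" "riemann_surface Y" "riemann_surface S" "riemann_surface projective_line"
  using Z Y S riemann_surface_projective_line by (simp_all add: compact_riemann_surface_def)

lemma holomorphic_\<psi>\<pi>: "holomorphic_map Z S (\<psi> \<circ> \<pi>)"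
  by (rule holomorphic_map_compose[OF surfaces(1-3) \<pi> \<psi>])

lemma holomorphic_composite: "holomorphic_map Z projective_line (\<phi> \<circ> (\<psi> \<circ> \<pi>))"
  by (rule holomorphic_map_compose[OF surfaces(1,3,4) holomorphic_\<psi>\<pi> \<phi>])

lemma nonconstant_\<psi>\<pi>: "\<not> (\<psi> \<circ> \<pi>) constant_on points Z"
proof
  assume "(\<psi> \<circ> \<pi>) constant_on points Z"
  then have "(\<phi> \<circ> (\<psi> \<circ> \<pi>)) constant_on points Z"
    unfolding constant_on_def by (metis comp_apply)
  then show False
    using nc by blast
qed

sublocale outer: descent Z S projective_line "\<psi> \<circ> \<pi>" \<phi>
  by unfold_locales (rule Z S surfaces(4) holomorphic_\<psi>\<pi> \<phi> nc galois_\<phi>)+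

sublocale inner: descent Z Y S \<pi> \<psi>
  by unfold_locales (rule Z Y surfaces(3) \<pi> \<psi> nonconstant_\<psi>\<pi> galois_\<psi>)+

abbreviation "G \<equiv> deck_group Z (\<phi> \<circ> (\<psi> \<circ> \<pi>))"
abbreviation "N \<equiv> carrier (deck_group Z (\<psi> \<circ> \<pi>))"

lemma N_subset: "N \<subseteq> carrier G"
  by (auto simp: deck_carrier_iff)

lemma restrict_to_N: "G\<lparr>carrier := N\<rparr> = deck_group Z (\<psi> \<circ> \<pi>)"
  by (simp add: deck_group_def)

lemma N_iff: "t \<in> N \<longleftrightarrow> t \<in> carrier G \<and> outer.descend t = \<one>\<^bsub>deck_group S \<phi>\<^esub>"
proof (cases "t \<in> carrier G")
  case True
  then show ?thesis
    by (simp add: outer.descend_eq_one_iff) (auto simp: deck_carrier_iff)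
qed (use N_subset in auto)

lemma etale_locally_injective: "y \<in> points Y \<Longrightarrow> locally_injective_at Y \<psi> y"
  using etale by (auto simp: unramified_def locally_injective_at_def)

text \<open>Over a point of the sphere, \<open>Z/L\<close> could ramify only through stabilizers outside \<open>L\<close>.\<close>

lemma fixed_points_generate:
  assumes L: "L \<lhd> G" and stab: "\<And>t z. \<lbrakk>t \<in> carrier G; z \<in> points Z; t z = z\<rbrakk> \<Longrightarrow> t \<in> L"
  shows "L = carrier G"
proof -
  interpret act: finite_action_over_sphere G "surf_top Z" "\<lambda>t. t" "\<phi> \<circ> (\<psi> \<circ> \<pi>)"
  proof (unfold_locales)
    show "finite (carrier G)"
      by (rule finite_deck_group[OF Z surfaces(4) holomorphic_composite nc])
    show "Hausdorff_space (surf_top Z)" "connected_space (surf_top Z)"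
      using surfaces(1) by (auto simp: riemann_surface_def)
    show "\<one>\<^bsub>G\<^esub> z = z" if "z \<in> points Z" for z
      using that by (simp add: deck_one)
    show "(g \<otimes>\<^bsub>G\<^esub> h) z = g (h z)" if "g \<in> carrier G" "h \<in> carrier G" "z \<in> points Z" for g h z
      by (rule deck_mult_apply[OF that])
    show "continuous_map (surf_top Z) (surf_top Z) g" if "g \<in> carrier G" for g
      by (rule holomorphic_map_continuous[OF deck_holomorphic[OF that]])
    show "continuous_map (surf_top Z) sphere_top (\<phi> \<circ> (\<psi> \<circ> \<pi>))"
      using holomorphic_map_continuous[OF holomorphic_composite] by simp
    show "open_map (surf_top Z) sphere_top (\<phi> \<circ> (\<psi> \<circ> \<pi>))"
      using holomorphic_map_open[OF surfaces(1,4) holomorphic_composite nc] by simp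
    show "(\<phi> \<circ> (\<psi> \<circ> \<pi>)) ` points Z = topspace sphere_top"
      using surj_of_nonconstant[OF Z surfaces(4) holomorphic_composite nc]
      by (simp only: surf_top_projective_line)
    show "(\<phi> \<circ> (\<psi> \<circ> \<pi>)) (g z) = (\<phi> \<circ> (\<psi> \<circ> \<pi>)) z" if "g \<in> carrier G" "z \<in> points Z" for g z
      by (rule deck_over[OF that])
    show "\<exists>g\<in>carrier G. g x = y"
      if "x \<in> points Z" "y \<in> points Z" "(\<phi> \<circ> (\<psi> \<circ> \<pi>)) x = (\<phi> \<circ> (\<psi> \<circ> \<pi>)) y" for x y
      using galois that unfolding galois_map_def by blast
  qed
  show ?thesis
    by (rule act.stabilizers_generate[OF L]) (rule stab)
qed

text \<open>The character \<open>\<theta>\<close> comes from descending to \<open>S\<close>, the character \<open>\<xi>\<close> from descending to \<open>Y\<close>. An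
  element of \<open>N\<close> with a fixed point in \<open>Z\<close> is trivial since \<open>\<psi>\<close> is unramified: its descent to \<open>Y\<close>
  fixes a point, hence is trivial, and the same holds for all its conjugates.\<close>

theorem deck_group_structure:
  assumes p: "prime p" and q: "prime q" and pq: "q \<noteq> p"
    and deck_\<phi>: "deck_group S \<phi> \<cong> integer_mod_group p" and deck_\<psi>: "deck_group Y \<psi> \<cong> integer_mod_group q"
    and faithful: "\<And>k. \<lbrakk>k \<in> carrier G; \<And>g z. \<lbrakk>g \<in> carrier G; z \<in> points Z\<rbrakk> \<Longrightarrow> \<pi> (g (k z)) = \<pi> (g z)\<rbrakk> \<Longrightarrow> k = \<one>\<^bsub>G\<^esub>"
  shows "\<exists>s\<in>{1..p - 1}. [q ^ s = 1] (mod p) \<and>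
     (\<exists>P. internal_semidirect_product G N P \<and>
        G\<lparr>carrier := N\<rparr> \<cong> product_group {..<s} (\<lambda>_. integer_mod_group q) \<and>
        G\<lparr>carrier := P\<rparr> \<cong> integer_mod_group p)"
proof -
  obtain \<alpha> where \<alpha>: "\<alpha> \<in> iso (deck_group S \<phi>) (integer_mod_group p)"
    using deck_\<phi> by (auto simp: is_iso_def)
  obtain \<beta> where \<beta>: "\<beta> \<in> iso (deck_group Y \<psi>) (integer_mod_group q)"
    using deck_\<psi> by (auto simp: is_iso_def)
  define \<theta> where "\<theta> = \<alpha> \<circ> outer.descend"
  define \<xi> where "\<xi> = \<beta> \<circ> inner.descend"
  have \<theta>: "\<theta> \<in> hom G (integer_mod_group p)"
    unfolding \<theta>_def using \<alpha> by (intro hom_compose[OF outer.descend_hom]) (simp add: iso_def)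
  have \<xi>: "\<xi> \<in> hom (deck_group Z (\<psi> \<circ> \<pi>)) (integer_mod_group q)"
    unfolding \<xi>_def using \<beta> by (intro hom_compose[OF inner.descend_hom]) (simp add: iso_def)
  have \<theta>_0: "\<theta> t = 0 \<longleftrightarrow> t \<in> N" if "t \<in> carrier G" for t
    using iso_integer_mod_group_eq_0_iff[OF outer.lower.is_group \<alpha> outer.descend(1)[OF that]] that
    by (simp add: \<theta>_def N_iff)
  have \<xi>_0: "\<xi> t = 0 \<longleftrightarrow> (\<forall>z\<in>points Z. \<pi> (t z) = \<pi> z)" if "t \<in> N" for t
    using iso_integer_mod_group_eq_0_iff[OF inner.lower.is_group \<beta> inner.descend(1)[OF that]]
      inner.descend_eq_one_iff[OF that] by (simp add: \<xi>_def)
  have kernel: "kernel G (integer_mod_group p) \<theta> = N"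
    using N_subset \<theta>_0 by (auto simp: kernel_def)
  have "N \<lhd> G"
    using group_hom.normal_kernel[of G "integer_mod_group p" \<theta>] \<theta> outer.upper.is_group
    by (simp add: group_hom_def group_hom_axioms_def kernel)
  then have conj_N: "g \<otimes>\<^bsub>G\<^esub> k \<otimes>\<^bsub>G\<^esub> inv\<^bsub>G\<^esub> g \<in> N" if "g \<in> carrier G" "k \<in> N" for g k
    using normal.inv_op_closed2 that by metis
  have conj_apply: "(g \<otimes>\<^bsub>G\<^esub> k \<otimes>\<^bsub>G\<^esub> inv\<^bsub>G\<^esub> g) (g z) = g (k z)"
    if "g \<in> carrier G" "k \<in> carrier G" "z \<in> points Z" for g k z
    using that deck_inv_apply(1)[OF surfaces(1) that(1,3)] deck_points[OF that(1,3)]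
    by (simp add: deck_mult_apply)
  have core: "k = \<one>\<^bsub>G\<^esub>"
    if k: "k \<in> N" and vanish: "\<And>g. g \<in> carrier G \<Longrightarrow> \<xi> (g \<otimes>\<^bsub>G\<^esub> k \<otimes>\<^bsub>G\<^esub> inv\<^bsub>G\<^esub> g) = 0" for k
  proof (rule faithful)
    show kG: "k \<in> carrier G"
      using k N_subset by blast
    fix g z assume gz: "g \<in> carrier G" "z \<in> points Z"
    have "\<pi> ((g \<otimes>\<^bsub>G\<^esub> k \<otimes>\<^bsub>G\<^esub> inv\<^bsub>G\<^esub> g) (g z)) = \<pi> (g z)"
      using \<xi>_0[OF conj_N[OF gz(1) k]] vanish[OF gz(1)] deck_points[OF gz] by blast
    then show "\<pi> (g (k z)) = \<pi> (g z)"
      by (simp add: conj_apply[OF gz(1) kG gz(2)])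
  qed
  define T where "T = {t \<in> carrier G. \<exists>z\<in>points Z. t z = z}"
  interpret faithful_tower_group G p q \<theta> \<xi> T "kernel G (integer_mod_group p) \<theta>"
  proof (unfold_locales, unfold kernel restrict_to_N)
    show "\<exists>g\<in>carrier G. \<theta> g \<noteq> 0"
    proof -
      obtain \<sigma> where \<sigma>: "\<sigma> \<in> carrier (deck_group S \<phi>)" "\<alpha> \<sigma> = 1"
        using iso_integer_mod_group_onto_1[OF \<alpha>] p prime_gt_1_nat by blast
      obtain a where a: "a \<in> points Z" "locally_injective_at S \<phi> ((\<psi> \<circ> \<pi>) a)"
        by (rule outer.generic_point)
      have "\<exists>t\<in>carrier G. outer.descend t = \<sigma>"
        using outer.descend_surj_on[OF a _ \<sigma>(1)] galois a(1) unfolding galois_map_def by auto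
      then show ?thesis
        unfolding \<theta>_def by (metis \<sigma>(2) comp_apply zero_neq_one)
    qed
    show "\<exists>k\<in>N. \<xi> k \<noteq> 0"
    proof -
      obtain \<sigma> where \<sigma>: "\<sigma> \<in> carrier (deck_group Y \<psi>)" "\<beta> \<sigma> = 1"
        using iso_integer_mod_group_onto_1[OF \<beta>] q prime_gt_1_nat by blast
      obtain a where a: "a \<in> points Z" "locally_injective_at S \<phi> ((\<psi> \<circ> \<pi>) a)"
        by (rule outer.generic_point)
      have "\<exists>t\<in>N. t a = b" if b: "b \<in> points Z" "\<psi> (\<pi> a) = \<psi> (\<pi> b)" for b
      proof -
        obtain t where t: "t \<in> carrier G" "t a = b"
          using galois a(1) b unfolding galois_map_def by (metis comp_apply)
        have "outer.descend t ((\<psi> \<circ> \<pi>) a) = (\<psi> \<circ> \<pi>) a"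
          using outer.descend(2)[OF t(1) a(1)] t(2) b(2) by simp
        then have "outer.descend t = \<one>\<^bsub>deck_group S \<phi>\<^esub>"
          using outer.descend(1)[OF t(1)] outer.h_points[OF a(1)] a(2) deck_fixed_point surfaces(3) by metis
        then show ?thesis
          using t N_iff by blast
      qed
      then have "\<exists>t\<in>N. inner.descend t = \<sigma>"
        using inner.descend_surj_on[OF a(1) etale_locally_injective _ \<sigma>(1)] a(1) by simp
      then show ?thesis
        unfolding \<xi>_def by (metis \<sigma>(2) comp_apply zero_neq_one)
    qed
    show "t [^]\<^bsub>G\<^esub> n \<in> T" if tT: "t \<in> T" for t and n :: nat
    proof -
      obtain z where z: "t \<in> carrier G" "z \<in> points Z" "t z = z"
        using tT by (auto simp: T_def)
      have "(t [^]\<^bsub>G\<^esub> n) z = z" "t [^]\<^bsub>G\<^esub> n \<in> carrier G"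
        using deck_pow_fixed_point[OF surfaces(1) z] outer.upper.nat_pow_closed[OF z(1)] .
      then show ?thesis
        using z(2) unfolding T_def by blast
    qed
    show "T \<inter> N \<subseteq> {\<one>\<^bsub>G\<^esub>}"
    proof
      fix t assume "t \<in> T \<inter> N"
      then obtain z where t: "t \<in> N" "t \<in> carrier G" and z: "z \<in> points Z" "t z = z"
        by (auto simp: T_def)
      have "\<xi> (g \<otimes>\<^bsub>G\<^esub> t \<otimes>\<^bsub>G\<^esub> inv\<^bsub>G\<^esub> g) = 0" if g: "g \<in> carrier G" for g
      proof -
        let ?k = "g \<otimes>\<^bsub>G\<^esub> t \<otimes>\<^bsub>G\<^esub> inv\<^bsub>G\<^esub> g"
        have k: "?k \<in> N"
          by (rule conj_N[OF g t(1)])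
        have gz: "g z \<in> points Z"
          by (rule deck_points[OF g z(1)])
        have "?k (g z) = g z"
          using conj_apply[OF g t(2) z(1)] z(2) by simp
        then have "inner.descend ?k (\<pi> (g z)) = \<pi> (g z)"
          using inner.descend(2)[OF k gz] by simp
        then have "inner.descend ?k = \<one>\<^bsub>deck_group Y \<psi>\<^esub>"
          using inner.descend(1)[OF k] inner.h_points[OF gz] etale_locally_injective deck_fixed_point surfaces(2)
          by metis
        then show ?thesis
          using inner.descend_eq_one_iff[OF k] \<xi>_0[OF k] by blast
      qed
      then show "t \<in> {\<one>\<^bsub>G\<^esub>}"
        using core[OF t(1)] by blast
    qed
    show "L = carrier G" if "L \<lhd> G" "T \<subseteq> L" for L
      using that by (intro fixed_points_generate) (auto simp: T_def)
  qed (use p q pq \<theta> \<xi> core in \<open>auto simp: T_def\<close>)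
  show ?thesis
    using elementary_abelian_semidirect_cyclic unfolding kernel by blast
qed

end

section \<open>Faithfulness of the Galois closure\<close>

context galois_tower
begin

text \<open>The image of this map is the smallest quotient of \<open>Z\<close> through which all maps \<open>\<pi> \<circ> t\<close> factor. It
  is unramified over \<open>S\<close>, so its complex structure can be pulled back from \<open>S\<close>, and no quotient
  charts at fixed points have to be constructed.\<close>

definition orbit_map :: "'z \<Rightarrow> ('z \<Rightarrow> 'z) \<Rightarrow> 'y" where
  "orbit_map z = (\<lambda>t\<in>carrier G. \<pi> (t z))"

definition rep :: "'z \<Rightarrow> 'z" where
  "rep z = (SOME z'. z' \<in> points Z \<and> orbit_map z' = orbit_map z)"

text \<open>The quotient lives on a set of representatives, as a surface competing with \<open>Z\<close> must have
  its points in the same type. With the topology pulled back from the product, continuity of maps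
  into it is tested on the coordinates \<open>\<pi> \<circ> t\<close>.\<close>

definition core_top :: "'z topology" where
  "core_top = pullback_topology (rep ` points Z) orbit_map
     (product_topology (\<lambda>_. surf_top Y) (carrier G))"

lemma orbit_map_eq_iff: "orbit_map z = orbit_map w \<longleftrightarrow> (\<forall>t\<in>carrier G. \<pi> (t z) = \<pi> (t w))"
  by (auto simp: orbit_map_def fun_eq_iff restrict_def)

lemma rep:
  assumes "z \<in> points Z" shows "rep z \<in> points Z" "orbit_map (rep z) = orbit_map z"
proof -
  have "rep z \<in> points Z \<and> orbit_map (rep z) = orbit_map z"
    unfolding rep_def by (rule someI[of _ z]) (use assms in simp)
  then show "rep z \<in> points Z" "orbit_map (rep z) = orbit_map z"
    by auto
qed

lemma rep_eqI: "orbit_map z = orbit_map w \<Longrightarrow> rep z = rep w"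
  by (simp add: rep_def)

lemma rep_rep: "w \<in> rep ` points Z \<Longrightarrow> rep w = w"
  using rep rep_eqI by blast

lemma rep_image_subset: "rep ` points Z \<subseteq> points Z"
  using rep by blast

lemma \<pi>_rep: "z \<in> points Z \<Longrightarrow> t \<in> carrier G \<Longrightarrow> \<pi> (t (rep z)) = \<pi> (t z)"
  using rep(2)[of z] by (simp add: orbit_map_eq_iff)

lemma \<pi>_rep_id: "z \<in> points Z \<Longrightarrow> \<pi> (rep z) = \<pi> z"
  using \<pi>_rep[OF _ outer.upper.one_closed, of z] rep(1)[of z] by (simp add: deck_one)

lemma orbit_map_continuous:
  "continuous_map (surf_top Z) (product_topology (\<lambda>_. surf_top Y) (carrier G)) orbit_map"
proof -
  have "continuous_map (surf_top Z) (surf_top Y) (\<lambda>z. orbit_map z t)" if "t \<in> carrier G" for t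
  proof (rule continuous_map_eq)
    show "continuous_map (surf_top Z) (surf_top Y) (\<pi> \<circ> t)"
      by (rule continuous_map_compose[OF holomorphic_map_continuous[OF deck_holomorphic[OF that]]
            holomorphic_map_continuous[OF \<pi>]])
  qed (use that in \<open>simp add: orbit_map_def\<close>)
  then show ?thesis
    by (auto simp: continuous_map_componentwise orbit_map_def)
qed

lemma topspace_core_top: "topspace core_top = rep ` points Z"
proof -
  have "orbit_map z \<in> topspace (product_topology (\<lambda>_. surf_top Y) (carrier G))" if "z \<in> points Z" for z
    using continuous_map_funspace[OF orbit_map_continuous] that by blast
  then show ?thesis
    unfolding core_top_def topspace_pullback_topology using rep(1) by blast
qed

lemma core_topI:
  assumes "continuous_map X (product_topology (\<lambda>_. surf_top Y) (carrier G)) (orbit_map \<circ> f)"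
    and "\<And>x. x \<in> topspace X \<Longrightarrow> f x \<in> rep ` points Z"
  shows "continuous_map X core_top f"
  unfolding core_top_def by (rule continuous_map_pullback'[OF assms(1)]) (use assms(2) in blast)

lemma rep_continuous: "continuous_map (surf_top Z) core_top rep"
proof (rule core_topI)
  show "continuous_map (surf_top Z) (product_topology (\<lambda>_. surf_top Y) (carrier G)) (orbit_map \<circ> rep)"
    by (rule continuous_map_eq[OF orbit_map_continuous]) (simp add: rep)
qed simp

lemma core_top_orbit_map:
  "continuous_map core_top (product_topology (\<lambda>_. surf_top Y) (carrier G)) orbit_map"
  using continuous_map_pullback[OF continuous_map_id, of "rep ` points Z" orbit_map]
  by (simp add: core_top_def)

lemma core_top_component:
  assumes t: "t \<in> carrier G" shows "continuous_map core_top (surf_top Y) (\<lambda>w. \<pi> (t w))"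
proof (rule continuous_map_eq)
  show "continuous_map core_top (surf_top Y) ((\<lambda>x. x t) \<circ> orbit_map)"
    by (rule continuous_map_compose[OF core_top_orbit_map continuous_map_product_projection[OF t]])
qed (use t in \<open>simp add: orbit_map_def\<close>)

lemma core_top_\<pi>: "continuous_map core_top (surf_top Y) \<pi>"
  by (rule continuous_map_eq[OF core_top_component[OF outer.upper.one_closed]])
    (use rep_image_subset in \<open>auto simp: topspace_core_top deck_one\<close>)

lemma core_top_space:
  "topspace core_top \<noteq> {}" "connected_space core_top" "compact_space core_top" "Hausdorff_space core_top"
proof -
  show "topspace core_top \<noteq> {}"
    using surfaces(1) by (simp add: topspace_core_top riemann_surface_def)
  have "connectedin (surf_top Z) (points Z)" "compactin (surf_top Z) (points Z)"
    using Z by (simp_all add: connectedin_topspace compact_riemann_surface_def riemann_surface_def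
        flip: compact_space_def)
  then have "connectedin core_top (rep ` points Z)" "compactin core_top (rep ` points Z)"
    using connectedin_continuous_map_image[OF rep_continuous] image_compactin[OF _ rep_continuous]
    by blast+
  then show "connected_space core_top" "compact_space core_top"
    by (simp_all add: connectedin_topspace[symmetric] compact_space_def topspace_core_top)
  have "inj_on orbit_map (rep ` points Z)"
    by (rule inj_onI) (metis rep_eqI rep_rep)
  moreover have "Hausdorff_space (product_topology (\<lambda>_. surf_top Y) (carrier G))"
    using surfaces(2) by (simp add: Hausdorff_space_product_topology riemann_surface_def)
  ultimately show "Hausdorff_space core_top"
    using Hausdorff_space_injective_preimage core_top_orbit_map by (metis topspace_core_top)
qed

text \<open>Descent to \<open>S\<close> shows that \<open>\<psi> (\<pi> w)\<close> determines \<open>\<psi> (\<pi> (t w))\<close> for all \<open>t\<close>. Where each coordinate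
  stays in a set on which \<open>\<psi>\<close> is injective, it therefore determines all coordinates of \<open>w\<close>.\<close>

sublocale core: local_homeomorphism core_top S "\<psi> \<circ> \<pi>"
proof
  show "riemann_surface S"
    by (rule surfaces)
  show "continuous_map core_top (surf_top S) (\<psi> \<circ> \<pi>)"
    by (rule continuous_map_compose[OF core_top_\<pi> holomorphic_map_continuous[OF \<psi>]])
  show "open_map core_top (surf_top S) (\<psi> \<circ> \<pi>)"
    unfolding open_map_def
  proof (intro allI impI)
    fix U assume U: "openin core_top U"
    have "open_in Z {z \<in> points Z. rep z \<in> U}"
      by (rule openin_continuous_map_preimage[OF rep_continuous U])
    then have "open_in S ((\<psi> \<circ> \<pi>) ` {z \<in> points Z. rep z \<in> U})"
      using holomorphic_map_open[OF surfaces(1,3) holomorphic_\<psi>\<pi> nonconstant_\<psi>\<pi>]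
      by (simp add: open_map_def)
    moreover have "(\<psi> \<circ> \<pi>) ` {z \<in> points Z. rep z \<in> U} = (\<psi> \<circ> \<pi>) ` U"
    proof
      show "(\<psi> \<circ> \<pi>) ` {z \<in> points Z. rep z \<in> U} \<subseteq> (\<psi> \<circ> \<pi>) ` U"
      proof clarify
        fix z assume z: "z \<in> points Z" "rep z \<in> U"
        then have "(\<psi> \<circ> \<pi>) z = (\<psi> \<circ> \<pi>) (rep z)"
          by (simp add: \<pi>_rep_id)
        then show "(\<psi> \<circ> \<pi>) z \<in> (\<psi> \<circ> \<pi>) ` U"
          using z(2) by (rule image_eqI)
      qed
      have "U \<subseteq> {z \<in> points Z. rep z \<in> U}"
      proof
        fix w assume w: "w \<in> U"
        then have "w \<in> rep ` points Z"
          using openin_subset[OF U] unfolding topspace_core_top by blast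
        then show "w \<in> {z \<in> points Z. rep z \<in> U}"
          using rep_rep[of w] rep_image_subset w by auto
      qed
      then show "(\<psi> \<circ> \<pi>) ` U \<subseteq> (\<psi> \<circ> \<pi>) ` {z \<in> points Z. rep z \<in> U}"
        by (rule image_mono)
    qed
    ultimately show "open_in S ((\<psi> \<circ> \<pi>) ` U)"
      by simp
  qed
  fix w assume w: "w \<in> topspace core_top"
  then have wZ: "w \<in> points Z"
    using rep_image_subset by (auto simp: topspace_core_top)
  have "\<exists>V. open_in Y V \<and> \<pi> (t w) \<in> V \<and> inj_on \<psi> V" if "t \<in> carrier G" for t
    using etale holomorphic_map_points[OF \<pi> deck_points[OF that wZ]] by (simp add: unramified_def)
  then obtain V where V: "\<And>t. t \<in> carrier G \<Longrightarrow> open_in Y (V t) \<and> \<pi> (t w) \<in> V t \<and> inj_on \<psi> (V t)"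
    by metis
  define U where "U = topspace core_top \<inter> (\<Inter>t\<in>carrier G. {x \<in> topspace core_top. \<pi> (t x) \<in> V t})"
  have fin: "finite (carrier G)"
    by (rule finite_deck_group[OF Z surfaces(4) holomorphic_composite nc])
  have "openin core_top U"
    unfolding U_def using fin V w openin_continuous_map_preimage[OF core_top_component]
    by (intro openin_Int_Inter) auto
  moreover have "w \<in> U"
    using V w by (auto simp: U_def)
  moreover have "inj_on (\<psi> \<circ> \<pi>) U"
  proof (rule inj_onI)
    fix x y assume xy: "x \<in> U" "y \<in> U" "(\<psi> \<circ> \<pi>) x = (\<psi> \<circ> \<pi>) y"
    then have R: "x \<in> rep ` points Z" "y \<in> rep ` points Z"
      unfolding U_def topspace_core_top by blast+
    then have P: "x \<in> points Z" "y \<in> points Z"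
      using rep_image_subset by blast+
    have "\<pi> (t x) = \<pi> (t y)" if t: "t \<in> carrier G" for t
    proof -
      have "\<psi> (\<pi> (t x)) = \<psi> (\<pi> (t y))"
        using outer.descend(2)[OF t P(1)] outer.descend(2)[OF t P(2)] xy(3) by simp
      moreover have "\<pi> (t x) \<in> V t" "\<pi> (t y) \<in> V t"
        using xy(1,2) t unfolding U_def by blast+
      ultimately show ?thesis
        using V[OF t] by (meson inj_onD)
    qed
    then have "rep x = rep y"
      by (intro rep_eqI) (unfold orbit_map_eq_iff, blast)
    then show "x = y"
      unfolding rep_rep[OF R(1)] rep_rep[OF R(2)] .
  qed
  ultimately show "\<exists>U. openin core_top U \<and> w \<in> U \<and> inj_on (\<psi> \<circ> \<pi>) U"
    by blast
qed (rule core_top_space)+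

lemma points_core [simp]: "points core.W = rep ` points Z"
  by (simp add: topspace_core_top)

lemma compact_core: "compact_riemann_surface core.W"
  using core.riemann_surface_lifted core_top_space(3) by (simp add: compact_riemann_surface_def)

lemma rep_holomorphic: "holomorphic_map Z core.W rep"
proof (rule holomorphic_map_lift[OF surfaces(1) core.riemann_surface_lifted surfaces(3)])
  show "holomorphic_map Z S (\<psi> \<circ> \<pi> \<circ> rep)"
    by (rule holomorphic_map_cong[OF surfaces(1) _ holomorphic_\<psi>\<pi>]) (simp add: \<pi>_rep_id)
qed (simp_all add: rep_continuous core.holomorphic_lifted core.unramified_lifted)

lemma core_\<pi>_holomorphic: "holomorphic_map core.W Y \<pi>"
  by (rule holomorphic_map_lift[OF core.riemann_surface_lifted surfaces(2,3) _ \<psi> etale])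
    (simp_all add: core_top_\<pi> core.holomorphic_lifted)

definition induced :: "('z \<Rightarrow> 'z) \<Rightarrow> 'z \<Rightarrow> 'z" where
  "induced t w = rep (t w)"

text \<open>Over \<open>S\<close> the induced map covers the descent of \<open>t\<close>; as the quotient is unramified over \<open>S\<close>,
  continuity is all that remains to be shown.\<close>

lemma induced_holomorphic:
  assumes t: "t \<in> carrier G" shows "holomorphic_map core.W core.W (induced t)"
proof (rule holomorphic_map_lift[where g = "\<psi> \<circ> \<pi>",
      OF core.riemann_surface_lifted core.riemann_surface_lifted surfaces(3)])
  have tZ: "w \<in> points Z" "t w \<in> points Z" if "w \<in> rep ` points Z" for w
    using that rep_image_subset deck_points[OF t] by auto
  have "continuous_map core_top (product_topology (\<lambda>_. surf_top Y) (carrier G)) (orbit_map \<circ> induced t)"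
    unfolding continuous_map_componentwise
  proof (intro conjI ballI)
    fix g assume g: "g \<in> carrier G"
    show "continuous_map core_top (surf_top Y) (\<lambda>w. (orbit_map \<circ> induced t) w g)"
    proof (rule continuous_map_eq[OF core_top_component[OF outer.upper.m_closed[OF g t]]])
      fix w assume "w \<in> topspace core_top"
      then have "w \<in> points Z" "t w \<in> points Z"
        using tZ by (simp_all add: topspace_core_top)
      then show "\<pi> ((g \<otimes>\<^bsub>G\<^esub> t) w) = (orbit_map \<circ> induced t) w g"
        using g t by (simp add: orbit_map_def induced_def \<pi>_rep deck_mult_apply)
    qed
  qed (simp add: orbit_map_def image_subset_iff)
  then have "continuous_map core_top core_top (induced t)"
    by (rule core_topI) (use tZ in \<open>simp add: induced_def topspace_core_top\<close>)
  then show "continuous_map (surf_top core.W) (surf_top core.W) (induced t)"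
    by simp
  show "holomorphic_map core.W S (\<psi> \<circ> \<pi> \<circ> induced t)"
  proof (rule holomorphic_map_cong[OF core.riemann_surface_lifted])
    show "holomorphic_map core.W S (outer.descend t \<circ> (\<psi> \<circ> \<pi>))"
      by (rule holomorphic_map_compose[OF core.riemann_surface_lifted surfaces(3,3)
            core.holomorphic_lifted deck_holomorphic[OF outer.descend(1)[OF t]]])
    fix w assume "w \<in> points core.W"
    then have w: "w \<in> points Z" "t w \<in> points Z"
      using tZ[of w] by (simp_all add: topspace_core_top)
    show "(outer.descend t \<circ> (\<psi> \<circ> \<pi>)) w = (\<psi> \<circ> \<pi> \<circ> induced t) w"
      using outer.descend(2)[OF t w(1)] \<pi>_rep_id[OF w(2)] by (simp add: induced_def)
  qed
qed (rule core.holomorphic_lifted core.unramified_lifted)+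

lemma induced_induced:
  assumes "s \<in> carrier G" "t \<in> carrier G" "w \<in> points Z"
  shows "induced s (induced t w) = rep ((s \<otimes>\<^bsub>G\<^esub> t) w)"
proof -
  have tw: "t w \<in> points Z"
    by (rule deck_points[OF assms(2,3)])
  have "orbit_map (s (rep (t w))) = orbit_map ((s \<otimes>\<^bsub>G\<^esub> t) w)"
    unfolding orbit_map_eq_iff
  proof
    fix g assume g: "g \<in> carrier G"
    have "\<pi> ((g \<otimes>\<^bsub>G\<^esub> s) (rep (t w))) = \<pi> ((g \<otimes>\<^bsub>G\<^esub> s) (t w))"
      using \<pi>_rep[OF tw, of "g \<otimes>\<^bsub>G\<^esub> s"] g assms by simp
    then show "\<pi> (g (s (rep (t w)))) = \<pi> (g ((s \<otimes>\<^bsub>G\<^esub> t) w))"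
      using g assms tw rep(1)[OF tw] by (simp add: deck_mult_apply)
  qed
  then show ?thesis
    unfolding induced_def by (rule rep_eqI)
qed

text \<open>The equivalence of points with equal orbit maps is defined with all of \<open>G\<close> and is thus
  preserved by \<open>G\<close>, so the deck transformations of \<open>Z\<close> act on the quotient.\<close>

lemma core_galois: "galois_map core.W (\<phi> \<circ> (\<psi> \<circ> \<pi>))"
  unfolding galois_map_def points_core
proof (intro ballI impI)
  fix w w' assume w: "w \<in> rep ` points Z" "w' \<in> rep ` points Z"
    and eq: "(\<phi> \<circ> (\<psi> \<circ> \<pi>)) w = (\<phi> \<circ> (\<psi> \<circ> \<pi>)) w'"
  have wZ: "w \<in> points Z" "w' \<in> points Z"
    using w rep_image_subset by auto
  then obtain t where t: "t \<in> carrier G" "t w = w'"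
    using galois eq unfolding galois_map_def by blast
  have cancel: "induced a (induced b x) = x"
    if "a \<in> carrier G" "b \<in> carrier G" "a \<otimes>\<^bsub>G\<^esub> b = \<one>\<^bsub>G\<^esub>" "x \<in> points core.W" for a b x
  proof -
    have x: "x \<in> rep ` points Z"
      using that(4) by (simp only: points_core)
    then have "x \<in> points Z"
      using rep_image_subset by blast
    then show ?thesis
      using induced_induced[OF that(1,2), of x] rep_rep[OF x] by (simp add: that(3) deck_one)
  qed
  have "restrict (induced t) (points core.W) \<in> carrier (deck_group core.W (\<phi> \<circ> (\<psi> \<circ> \<pi>)))"
  proof (rule deckI[OF core.riemann_surface_lifted induced_holomorphic induced_holomorphic])
    show "t \<in> carrier G" "inv\<^bsub>G\<^esub> t \<in> carrier G"
      using t(1) by simp_all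
    fix x assume x: "x \<in> points core.W"
    show "induced t (induced (inv\<^bsub>G\<^esub> t) x) = x" "induced (inv\<^bsub>G\<^esub> t) (induced t x) = x"
      using t(1) x by (auto intro!: cancel)
    have "x \<in> points Z"
      using x rep_image_subset unfolding points_core by blast
    then show "(\<phi> \<circ> (\<psi> \<circ> \<pi>)) (induced t x) = (\<phi> \<circ> (\<psi> \<circ> \<pi>)) x"
      using \<pi>_rep_id[OF deck_points[OF t(1)]] deck_over[OF t(1)] by (simp add: induced_def)
  qed
  moreover have "restrict (induced t) (points core.W) w = w'"
    using w(1) t(2) rep_rep[OF w(2)] unfolding points_core by (simp add: induced_def)
  ultimately show "\<exists>u\<in>carrier (deck_group core.W (\<phi> \<circ> (\<psi> \<circ> \<pi>))). u w = w'"
    by blast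
qed

lemma core_branched_covers:
  shows "branched_cover Z core.W rep" "branched_cover core.W Y \<pi>"
    "galois_cover core.W projective_line (\<phi> \<circ> (\<psi> \<circ> \<pi>))"
proof -
  have ne: "\<not> f constant_on points core.W" if "\<And>z. z \<in> points Z \<Longrightarrow> f (rep z) = F z" "\<not> F constant_on points Z"
    for f :: "'z \<Rightarrow> 'k" and F
  proof
    assume "f constant_on points core.W"
    then obtain c where "\<And>w. w \<in> rep ` points Z \<Longrightarrow> f w = c"
      unfolding constant_on_def points_core by blast
    then have "F z = c" if "z \<in> points Z" for z
      using that \<open>\<And>z. z \<in> points Z \<Longrightarrow> f (rep z) = F z\<close> by (metis imageI)
    then show False
      using that(2) by (auto simp: constant_on_def)
  qed
  have "\<not> rep constant_on points Z"
  proof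
    assume "rep constant_on points Z"
    then obtain c where "\<And>z. z \<in> points Z \<Longrightarrow> rep z = c"
      by (auto simp: constant_on_def)
    then have "\<pi> z = \<pi> c" if "z \<in> points Z" for z
      using that \<pi>_rep_id by metis
    then show False
      using inner.h_nonconstant by (auto simp: constant_on_def)
  qed
  then show "branched_cover Z core.W rep"
    using Z compact_core rep_holomorphic by (simp add: branched_cover_def)
  show "branched_cover core.W Y \<pi>"
    using Y compact_core core_\<pi>_holomorphic ne[OF \<pi>_rep_id inner.h_nonconstant]
    by (simp add: branched_cover_def)
  have "holomorphic_map core.W projective_line (\<phi> \<circ> (\<psi> \<circ> \<pi>))"
    by (rule holomorphic_map_compose[OF core.riemann_surface_lifted surfaces(3,4) core.holomorphic_lifted \<phi>])
  moreover have "\<not> (\<phi> \<circ> (\<psi> \<circ> \<pi>)) constant_on points core.W"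
    by (rule ne[OF _ nc]) (simp add: \<pi>_rep_id)
  ultimately show "galois_cover core.W projective_line (\<phi> \<circ> (\<psi> \<circ> \<pi>))"
    using compact_core compact_riemann_surface_projective_line core_galois
    by (simp add: galois_cover_def branched_cover_def)
qed

text \<open>By minimality of the Galois closure, the quotient map \<open>rep\<close> is injective, whereas an element
  \<open>k\<close> in all conjugates of the deck group of \<open>\<pi>\<close> does not change \<open>rep z\<close>.\<close>

theorem galois_closure_faithful:
  assumes closure: "galois_closure Y projective_line (\<phi> \<circ> \<psi>) Z \<pi>"
    and k: "k \<in> carrier G" "\<And>g z. \<lbrakk>g \<in> carrier G; z \<in> points Z\<rbrakk> \<Longrightarrow> \<pi> (g (k z)) = \<pi> (g z)"
  shows "k = \<one>\<^bsub>G\<^esub>"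
proof -
  have "biholomorphic_map Z core.W rep"
    using closure core_branched_covers \<pi>_rep_id unfolding galois_closure_def comp_assoc by blast
  then obtain h where h: "\<And>z. z \<in> points Z \<Longrightarrow> h (rep z) = z"
    by (auto simp: biholomorphic_map_def)
  have "k z = z" if z: "z \<in> points Z" for z
  proof -
    have "rep (k z) = rep z"
      by (rule rep_eqI) (simp add: orbit_map_eq_iff k(2) z)
    then show ?thesis
      using h[OF z] h[OF deck_points[OF k(1) z]] by simp
  qed
  then show ?thesis
    by (intro deck_eqI[OF k(1) outer.upper.one_closed]) (simp add: deck_one)
qed

end

section \<open>Etale cyclic covers of cyclic \<open>p\<close>-gonal curves\<close>

theorem theorem14:
  fixes S :: "'a surface" and Y :: "'b surface"
    and \<phi> :: "'a \<Rightarrow> complex option" and \<psi> :: "'b \<Rightarrow> 'a"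
    and p q g :: nat
  assumes "prime p" and "odd p"
    and "compact_riemann_surface S" and "has_genus S g" and "g \<ge> 2"
    and "cyclic_gonal_cover p S \<phi>"
    and "prime q" and "q \<noteq> p" and "gcd p (q - 1) = 1"
    and "cyclic_etale_cover q Y S \<psi>"
  shows "\<not> galois_map Y (\<phi> \<circ> \<psi>) \<and>
    (\<forall>(Z :: 'c surface) \<pi>.
       galois_closure Y projective_line (\<phi> \<circ> \<psi>) Z \<pi> \<longrightarrow>
       (\<exists>s\<in>{1..p - 1}. [q ^ s = 1] (mod p) \<and>
          (\<exists>N P. internal_semidirect_product (deck_group Z (\<phi> \<circ> \<psi> \<circ> \<pi>)) N P \<and>
             (deck_group Z (\<phi> \<circ> \<psi> \<circ> \<pi>))\<lparr>carrier := N\<rparr>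
               \<cong> product_group {..<s} (\<lambda>_. integer_mod_group q) \<and>
             (deck_group Z (\<phi> \<circ> \<psi> \<circ> \<pi>))\<lparr>carrier := P\<rparr> \<cong> integer_mod_group p)))"
proof -
  have \<phi>: "holomorphic_map S projective_line \<phi>" "\<not> \<phi> constant_on points S" "galois_map S \<phi>"
    and deck_\<phi>: "deck_group S \<phi> \<cong> integer_mod_group p"
    using assms(6) by (auto simp: cyclic_gonal_cover_def galois_cover_def branched_cover_def)
  have Y: "compact_riemann_surface Y" and \<psi>: "holomorphic_map Y S \<psi>" "\<not> \<psi> constant_on points Y"
      "galois_map Y \<psi>" "unramified Y \<psi>" and deck_\<psi>: "deck_group Y \<psi> \<cong> integer_mod_group q"
    using assms(10) by (auto simp: cyclic_etale_cover_def galois_cover_def branched_cover_def)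
  have RY: "riemann_surface Y" and RS: "riemann_surface S"
    using Y assms(3) by (simp_all add: compact_riemann_surface_def)
  have pos: "q > 0" "q > 1"
    using assms(7) prime_gt_0_nat prime_gt_1_nat by auto
  have part1: "\<not> galois_map Y (\<phi> \<circ> \<psi>)"
  proof
    assume gal: "galois_map Y (\<phi> \<circ> \<psi>)"
    have surj: "\<psi> ` points Y = points S"
      by (rule surj_of_nonconstant[OF Y RS \<psi>(1,2)])
    have nc: "\<not> (\<phi> \<circ> (\<psi> \<circ> id)) constant_on points Y"
    proof
      assume "(\<phi> \<circ> (\<psi> \<circ> id)) constant_on points Y"
      then have "\<phi> constant_on \<psi> ` points Y"
        by (auto simp: constant_on_def)
      then show False
        using \<phi>(2) surj by simp
    qed
    have "holomorphic_map Y Y id"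
      using holomorphic_map_id[OF RY] by (simp add: id_def)
    then interpret galois_tower Y Y S id \<psi> \<phi>
      using Y assms(3) \<phi> \<psi> nc gal by unfold_locales simp_all
    obtain s where s: "s \<in> {1..p - 1}" "[q ^ s = 1] (mod p)"
      and iso: "G\<lparr>carrier := N\<rparr> \<cong> product_group {..<s} (\<lambda>_. integer_mod_group q)"
    proof -
      have "k = \<one>\<^bsub>G\<^esub>"
        if k: "k \<in> carrier G" "\<And>g z. \<lbrakk>g \<in> carrier G; z \<in> points Y\<rbrakk> \<Longrightarrow> id (g (k z)) = id (g z)" for k
        using k(2)[OF outer.upper.one_closed] deck_points[OF k(1)]
        by (intro deck_eqI[OF k(1) outer.upper.one_closed]) (simp add: deck_one)
      then show ?thesis
        using deck_group_structure[OF assms(1,7,8) deck_\<phi> deck_\<psi>] that by blast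
    qed
    \<comment> \<open>With \<open>\<pi>\<close> the identity, \<open>N\<close> is the deck group of \<open>\<psi>\<close>, of order \<open>q\<close>; hence \<open>s = 1\<close>.\<close>
    have "deck_group Y \<psi> \<cong> product_group {..<s} (\<lambda>_. integer_mod_group q)"
      using iso unfolding restrict_to_N by simp
    then have "card (carrier (deck_group Y \<psi>)) = card (carrier (product_group {..<s} (\<lambda>_. integer_mod_group q)))"
      by (auto simp: is_iso_def iso_def bij_betw_same_card)
    also have "\<dots> = q ^ s"
      using pos by (simp add: carrier_integer_mod_group card_PiE)
    finally have "q ^ s = card (carrier (integer_mod_group q))"
      using deck_\<psi> by (auto simp: is_iso_def iso_def bij_betw_same_card)
    then have "q ^ s = q ^ 1"
      using pos by (simp add: carrier_integer_mod_group)
    then have "s = 1"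
      using pos(2) power_inject_exp by blast
    then have "[q = 1] (mod p)"
      using s(2) by simp
    then have "p dvd q - 1"
      using pos by (metis cong_altdef_nat less_imp_le_nat)
    then have "gcd p (q - 1) = p"
      by (simp add: gcd_proj1_iff)
    then show False
      using assms(1,9) by simp
  qed
  moreover have "\<exists>s\<in>{1..p - 1}. [q ^ s = 1] (mod p) \<and>
          (\<exists>N P. internal_semidirect_product (deck_group Z (\<phi> \<circ> \<psi> \<circ> \<pi>)) N P \<and>
             (deck_group Z (\<phi> \<circ> \<psi> \<circ> \<pi>))\<lparr>carrier := N\<rparr>
               \<cong> product_group {..<s} (\<lambda>_. integer_mod_group q) \<and>
             (deck_group Z (\<phi> \<circ> \<psi> \<circ> \<pi>))\<lparr>carrier := P\<rparr> \<cong> integer_mod_group p)"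
    if closure: "galois_closure Y projective_line (\<phi> \<circ> \<psi>) Z \<pi>" for Z :: "'c surface" and \<pi>
  proof -
    have "branched_cover Z Y \<pi>" "galois_cover Z projective_line (\<phi> \<circ> (\<psi> \<circ> \<pi>))"
      using closure unfolding galois_closure_def comp_assoc by blast+
    then interpret galois_tower Z Y S \<pi> \<psi> \<phi>
      using Y assms(3) \<phi> \<psi> by unfold_locales (auto simp: galois_cover_def branched_cover_def)
    show ?thesis
      unfolding comp_assoc
      using deck_group_structure[OF assms(1,7,8) deck_\<phi> deck_\<psi> galois_closure_faithful[OF closure]]
      by blast
  qed
  ultimately show ?thesis
    by blast
qed

end
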